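(* Let $L$ be an extremally disconnected compact Hausdorff space. Then the weak essential norm $\|\cdot\|_w$ is minimal on the weak Calkin algebra $\mathscr{B}(C(L))/\mathscr{W}(C(L))$; that is, for every algebra norm $|||\cdot|||$ on $\mathscr{B}(C(L))/\mathscr{W}(C(L))$ there is a constant $c>0$ such that $c\,\|T\|_w\le |||T+\mathscr{W}(C(L))|||$ for all $T\in\mathscr{B}(C(L))$.
   Context: Scalars are real or complex. For a Banach space $E$, $\mathscr{B}(E)$ is the algebra of bounded linear operators on $E$ and $\mathscr{W}(E)$ is the ideal of weakly compact operators (those mapping the unit ball to a relatively weakly compact set). The weak essential norm is the quotient norm $\|T\|_w=\inf\{\|T-W\|: W\in\mathscr{W}(E)\}$ on $\mathscr{B}(E)/\mathscr{W}(E)$. An algebra norm on an algebra is a submultiplicative norm (completeness is not assumed). A topological space is extremally disconnected if the closure of every open set is open. *)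

theory Defs
  imports "HOL-Analysis.Analysis" "HOL-Algebra.QuotRing" "HOL-Algebra.Module"
begin

text \<open>
  HOL-Analysis has normed vector spaces over the reals only. To treat both scalar fields at once, a
  Banach space over the field \<open>'k\<close> (which will be \<open>real\<close> or \<open>complex\<close>) is a real Banach space
  \<open>'e\<close> together with its scalar multiplication \<open>s :: 'k \<Rightarrow> 'e \<Rightarrow> 'e\<close>. The real-linear maps of
  type \<open>'e \<Rightarrow>\<^sub>L 'e\<close> are cut down to the \<open>'k\<close>-linear ones; the norm of \<open>'e \<Rightarrow>\<^sub>L 'e\<close> is the
  operator norm in either case.
\<close>

subsection \<open>Weakly compact operators\<close>

definition weak_topology :: "('k::real_normed_field \<Rightarrow> 'e \<Rightarrow> 'e) \<Rightarrow> 'e::real_normed_vector topology"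
  where "weak_topology s = topology_generated_by
    {blinfun_apply \<phi> -` U | (\<phi> :: 'e \<Rightarrow>\<^sub>L 'k) U. (\<forall>c x. \<phi> (s c x) = c * \<phi> x) \<and> open U}"

definition bounded_ops :: "('k \<Rightarrow> 'e \<Rightarrow> 'e) \<Rightarrow> ('e::real_normed_vector \<Rightarrow>\<^sub>L 'e) set"
  where "bounded_ops s = {T :: 'e \<Rightarrow>\<^sub>L 'e. \<forall>c x. T (s c x) = s c (T x)}"

definition weakly_compact_ops ::
    "('k::real_normed_field \<Rightarrow> 'e \<Rightarrow> 'e) \<Rightarrow> ('e::real_normed_vector \<Rightarrow>\<^sub>L 'e) set"
  where "weakly_compact_ops s =
    {T \<in> bounded_ops s.
       compactin (weak_topology s) (weak_topology s closure_of (blinfun_apply T ` cball 0 1))}"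

definition weak_essential_norm ::
    "('k::real_normed_field \<Rightarrow> 'e \<Rightarrow> 'e) \<Rightarrow> ('e::real_normed_vector \<Rightarrow>\<^sub>L 'e) \<Rightarrow> real"
  where "weak_essential_norm s T = (INF W \<in> weakly_compact_ops s. norm (T - W))"

subsection \<open>The weak Calkin algebra\<close>

definition op_ring :: "('k \<Rightarrow> 'e \<Rightarrow> 'e) \<Rightarrow> ('e::real_normed_vector \<Rightarrow>\<^sub>L 'e) ring"
  where "op_ring s = \<lparr>carrier = bounded_ops s, mult = (o\<^sub>L), one = id_blinfun, zero = 0, add = (+)\<rparr>"

definition op_scale ::
    "('k \<Rightarrow> 'e \<Rightarrow> 'e) \<Rightarrow> 'k \<Rightarrow> ('e::real_normed_vector \<Rightarrow>\<^sub>L 'e) \<Rightarrow> 'e \<Rightarrow>\<^sub>L 'e"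
  where "op_scale s c T = Blinfun (\<lambda>x. s c (T x))"

definition weak_coset ::
    "('k::real_normed_field \<Rightarrow> 'e \<Rightarrow> 'e) \<Rightarrow> ('e::real_normed_vector \<Rightarrow>\<^sub>L 'e) \<Rightarrow> ('e \<Rightarrow>\<^sub>L 'e) set"
  where "weak_coset s T = weakly_compact_ops s +>\<^bsub>op_ring s\<^esub> T"

text \<open>
  The ring structure is that of the quotient ring of HOL-Algebra. Scalars act on cosets through
  representatives, as in the library's product of cosets, so that \<open>c (T + W) = c T + W\<close> also when
  \<open>c = 0\<close> (the elementwise image of a coset under \<open>0\<close> is not a coset).
\<close>

definition weak_calkin ::
    "('k::real_normed_field \<Rightarrow> 'e \<Rightarrow> 'e) \<Rightarrow> ('k, ('e::real_normed_vector \<Rightarrow>\<^sub>L 'e) set) module"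
  where "weak_calkin s =
    (let Q = op_ring s Quot weakly_compact_ops s in
      \<lparr>carrier = carrier Q, mult = mult Q, one = one Q, zero = zero Q, add = add Q,
       smult = (\<lambda>c X. \<Union>T\<in>X. weak_coset s (op_scale s c T))\<rparr>)"

definition algebra_norm :: "('k::real_normed_field, 'a) module \<Rightarrow> ('a \<Rightarrow> real) \<Rightarrow> bool"
  where "algebra_norm A N \<longleftrightarrow>
    (\<forall>x \<in> carrier A. 0 \<le> N x \<and> (N x = 0 \<longleftrightarrow> x = \<zero>\<^bsub>A\<^esub>)) \<and>
    (\<forall>c. \<forall>x \<in> carrier A. N (c \<odot>\<^bsub>A\<^esub> x) = norm c * N x) \<and>
    (\<forall>x \<in> carrier A. \<forall>y \<in> carrier A. N (x \<oplus>\<^bsub>A\<^esub> y) \<le> N x + N y) \<and>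
    (\<forall>x \<in> carrier A. \<forall>y \<in> carrier A. N (x \<otimes>\<^bsub>A\<^esub> y) \<le> N x * N y)"

definition weak_essential_norm_minimal ::
    "('k::real_normed_field \<Rightarrow> 'e \<Rightarrow> 'e::real_normed_vector) \<Rightarrow> bool"
  where "weak_essential_norm_minimal s \<longleftrightarrow>
    (\<forall>N. algebra_norm (weak_calkin s) N \<longrightarrow>
      (\<exists>c>0. \<forall>T \<in> bounded_ops s. c * weak_essential_norm s T \<le> N (weak_coset s T)))"

lemma weak_coset_eq: "weak_coset s T = {W + T | W. W \<in> weakly_compact_ops s}"
  by (auto simp: weak_coset_def op_ring_def a_r_coset_def r_coset_def)

lemma carrier_weak_calkin: "carrier (weak_calkin s) = weak_coset s ` bounded_ops s"
  by (auto simp: weak_calkin_def FactRing_def A_RCOSETS_def RCOSETS_def weak_coset_def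
      a_r_coset_def op_ring_def)

subsection \<open>Scalar multiplication on spaces of continuous functions\<close>

definition cscale ::
    "'k::real_normed_field \<Rightarrow> ('a::topological_space \<Rightarrow>\<^sub>C 'k) \<Rightarrow> 'a \<Rightarrow>\<^sub>C 'k"
  where "cscale c f = Bcontfun (\<lambda>x. c * f x)"

lemma cscale_apply [simp]: "cscale c f x = c * f x"
proof -
  have "bounded ((*) c ` range f)"
    by (intro bounded_linear_image[OF _ bounded_linear_mult_right] bounded_apply_bcontfun)
  then have "(\<lambda>x. c * f x) \<in> bcontfun"
    by (auto simp: bcontfun_def image_image intro!: continuous_intros)
  then show ?thesis
    by (simp add: cscale_def Bcontfun_inverse)
qed

lemma cscale_of_real: "cscale (of_real r) f = r *\<^sub>R f"
  by (rule bcontfun_eqI) (simp add: scaleR_conv_of_real)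

lemma bounded_linear_cscale: "bounded_linear (cscale c)"
proof (rule bounded_linear_intro)
  show "cscale c (f + g) = cscale c f + cscale c g" for f g
    by (rule bcontfun_eqI) (simp add: distrib_left)
  show "cscale c (r *\<^sub>R f) = r *\<^sub>R cscale c f" for r f
    by (rule bcontfun_eqI) simp
  show "norm (cscale c f) \<le> norm f * norm c" for f
    by (rule norm_bound)
      (simp add: norm_mult mult.commute mult_left_mono norm_bounded)
qed

lemma op_scale_cscale_apply: "op_scale cscale c T f = cscale c (T f)"
  unfolding op_scale_def
  by (subst bounded_linear_Blinfun_apply)
    (auto intro: bounded_linear_compose[OF bounded_linear_cscale blinfun.bounded_linear_right])

end

theory Submission
  imports Defs
begin

text \<open>
  Suppose that an algebra norm \<open>N\<close> on the weak Calkin algebra does not dominate the weak essential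
  norm. Then there are operators \<open>T m\<close> for which \<open>N (T m)\<close> is smaller than \<open>1 / m!\<close> times the weak
  essential norm \<open>\<omega> m\<close> of \<open>T m\<close>. The contradiction comes from one fact about a single operator and
  from one trick that treats all \<open>T m\<close> at once.

  The fact (\<open>factors_identity\<close>): if \<open>T\<close> has weak essential norm \<open>d > 0\<close>, then \<open>U T V = d I\<close> for
  operators \<open>V : \<ell>\<^sup>\<infinity> \<rightarrow> C(L)\<close> and \<open>U : C(L) \<rightarrow> \<ell>\<^sup>\<infinity>\<close> whose norms are bounded by absolute constants.

  The trick: view \<open>\<ell>\<^sup>\<infinity>\<close> as \<open>\<ell>\<^sup>\<infinity>(\<ell>\<^sup>\<infinity>)\<close>, the bounded double sequences. As the norms of the operators
  \<open>U m\<close> and \<open>V m\<close> belonging to \<open>T m\<close> are bounded, there is one operator \<open>U'\<close> with rows \<open>U m\<close>, and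
  one operator \<open>V'\<close> that acts on row \<open>m\<close> as \<open>2\<^sup>-\<^sup>m V m\<close>. Row \<open>m\<close> is moved to row \<open>0\<close> by the \<open>m\<close>-th
  power of a shift. There is a projection \<open>E\<close> of \<open>C(L)\<close> onto a copy of \<open>\<ell>\<^sup>\<infinity>\<close>
  (\<open>complemented_sequence_space\<close>), so all this can be made to take place inside \<open>C(L)\<close>, and it
  shows that \<open>\<omega> m E\<close> is a product of \<open>T m\<close>, of \<open>m\<close>-th powers of two fixed operators and of four
  more fixed operators. Hence \<open>\<omega> m N(E) \<le> C K\<^sup>m N(T m) \<le> C K\<^sup>m \<omega> m / m!\<close> with \<open>C\<close> and \<open>K\<close>
  independent of \<open>m\<close>, so \<open>N(E) = 0\<close> and \<open>E\<close> is weakly compact. But it is not.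

  The fact is proved in two steps. For a point \<open>x\<close> let \<open>|\<mu>\<^sub>x|\<close> denote the variation of the
  functional \<open>f \<mapsto> T f x\<close>. Either one finds disjoint clopen sets \<open>B k\<close> and points \<open>y k\<close> with
  \<open>|\<mu>\<^sub>y\<^sub>k|(B k)\<close> bounded below by a multiple of \<open>d\<close>, or the set functions \<open>|\<mu>\<^sub>x|\<close> are controlled
  by the sum \<open>\<lambda>\<close> of finitely many of them (\<open>control_or_disjoint\<close>). In the second case,
  \<open>\<bar>T f\<bar> \<le> M \<lambda>(\<bar>f\<bar>) + 2 c \<bar>\<bar>f\<bar>\<bar>\<close> with \<open>2 c < d\<close>; as \<open>C(L)\<close> is order complete, a Hahn-Banach
  argument splits \<open>T\<close> accordingly as \<open>W + S\<close> (\<open>dominated_split\<close>). Here \<open>\<bar>\<bar>S\<bar>\<bar> \<le> 2 c\<close>, and \<open>W\<close> is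
  continuous for the Hilbert space seminorm \<open>\<lambda>(\<bar>f\<bar>\<^sup>2)\<^sup>1\<^sup>/\<^sup>2\<close> and therefore weakly compact
  (\<open>Hilbertian_compact\<close>), which contradicts the choice of \<open>d\<close>. In the first case, Rosenthal's
  lemma thins out the sets \<open>B k\<close> until each \<open>|\<mu>\<^sub>y\<^sub>k|\<close> has little mass on the closure of the union
  of the other sets. Functions \<open>f k\<close> in the unit ball that are supported on \<open>B k\<close>, with
  \<open>\<bar>T (f k) (y k)\<bar>\<close> bounded below, then span a copy of \<open>\<ell>\<^sup>\<infinity>\<close> (\<open>gluing_operator\<close>) on which
  evaluating \<open>T f\<close> at the points \<open>y k\<close> is, after rescaling, a small perturbation of the identity.

  All of this is carried out for a scalar field that is a Euclidean space. Only the splitting of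
  operators is proved separately for real and for complex scalars.
\<close>

section \<open>Continuous functions on extremally disconnected spaces\<close>

text \<open>
  The argument \<open>L\<close> only names the type of the points.
\<close>

locale extremally_disconnected_compact =
  fixes L :: "'l::t2_space itself"
  assumes compact_UNIV: "compact (UNIV :: 'l set)"
    and open_closure: "open U \<Longrightarrow> open (closure (U :: 'l set))"
begin

text \<open>
  The value \<open>c x\<close> is the infimum of the levels \<open>r\<close> for which \<open>x\<close> lies outside the closure of
  \<open>{s > r}\<close>. Sets of the form \<open>{c < r}\<close> are then open in every space, and sets of the form
  \<open>{c > r}\<close> are unions of the closures of the open sets \<open>{s > q}\<close>, which are open here. Applied to
  a supremum \<open>s\<close> and an infimum \<open>t\<close> of continuous functions, this is the order completeness of the
  space of continuous functions.
\<close>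

lemma semicontinuous_sandwich:
  fixes s t :: "'l \<Rightarrow> real"
  assumes s: "\<And>r. open {x. r < s x}" and t: "\<And>r. open {x. t x < r}" and st: "\<And>x. s x \<le> t x"
  shows "\<exists>c. continuous_on UNIV c \<and> (\<forall>x. s x \<le> c x \<and> c x \<le> t x)"
proof -
  define D where "D x = {r. x \<notin> closure {y. r < s y}}" for x
  define c where "c x = Inf (D x)" for x
  have above: "r \<in> D x" if "t x < r" for x r
  proof -
    have "{y. t y < r} \<inter> {y. r < s y} = {}"
      using st by (auto simp: disjoint_iff) (meson not_less order.trans less_imp_le leD)
    then have "{y. t y < r} \<inter> closure {y. r < s y} = {}"
      using t open_Int_closure_eq_empty by blast
    then show ?thesis using that by (auto simp: D_def)
  qed
  have below: "s x \<le> r" if "r \<in> D x" for x r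
    using that closure_subset[of "{y. r < s y}"] by (force simp: D_def not_less[symmetric])
  have bdd: "bdd_below (D x)" for x
    using below by (meson bdd_below.I)
  have ne: "D x \<noteq> {}" for x
    using above[of x "t x + 1"] by auto
  have up: "r' \<in> D x" if "r \<in> D x" "r \<le> r'" for x r r'
  proof -
    have "{y. r' < s y} \<subseteq> {y. r < s y}" using that by auto
    then show ?thesis using that(1) closure_mono unfolding D_def by blast
  qed
  have "s x \<le> c x" for x
    unfolding c_def using below ne by (meson cInf_greatest)
  moreover have "c x \<le> t x" for x
    unfolding c_def
    by (rule dense_ge) (use above bdd in \<open>meson cInf_lower\<close>)
  moreover have "continuous_on UNIV c"
  proof -
    have lt: "{x. c x < r} = (\<Union>q\<in>{..<r}. - closure {y. q < s y})" for r
      using cInf_less_iff[OF ne bdd] unfolding c_def D_def by auto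
    have gt: "{x. r < c x} = (\<Union>q\<in>{r<..}. closure {y. q < s y})" for r
    proof (intro equalityI subsetI)
      fix x assume "x \<in> {x. r < c x}"
      then obtain q where q: "r < q" "q < c x" using dense by blast
      then have "q \<notin> D x" unfolding c_def using bdd cInf_lower linorder_not_le by blast
      then show "x \<in> (\<Union>q\<in>{r<..}. closure {y. q < s y})" using q by (auto simp: D_def)
    next
      fix x assume "x \<in> (\<Union>q\<in>{r<..}. closure {y. q < s y})"
      then obtain q where q: "r < q" "q \<notin> D x" by (auto simp: D_def)
      then have "q \<le> c x" unfolding c_def using up ne
        by (meson cInf_greatest linorder_le_cases)
      then show "x \<in> {x. r < c x}" using q by auto
    qed
    have "open {x. c x < r}" "open {x. r < c x}" for r
      unfolding lt gt using open_closure s by (auto intro!: open_UN)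
    then have "continuous_map euclidean euclidean c"
      by (simp add: continuous_map_upper_lower_semicontinuous_lt)
    then show ?thesis by simp
  qed
  ultimately show ?thesis by blast
qed

lemma bcontfun_continuous:
  fixes f :: "'l \<Rightarrow> 'b::metric_space"
  assumes "continuous_on UNIV f"
  shows "f \<in> bcontfun"
  using assms compact_continuous_image[OF assms compact_UNIV] compact_imp_bounded
  by (auto simp: bcontfun_def)

lemma apply_Bcontfun:
  fixes f :: "'l \<Rightarrow> 'b::metric_space"
  assumes "continuous_on UNIV f"
  shows "apply_bcontfun (Bcontfun f) = f"
  by (simp add: Bcontfun_inverse bcontfun_continuous assms)

text \<open>
  A coordinate of \<open>g\<close> is lower semicontinuous if it is continued by \<open>- M\<close> off \<open>D\<close>, and upper
  semicontinuous if it is continued by \<open>M\<close>. A continuous function between the two extends it.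
\<close>

lemma continuous_extension:
  fixes g :: "'l \<Rightarrow> 'k::euclidean_space"
  assumes D: "open D" and g: "continuous_on D g" and M: "\<And>x. x \<in> D \<Longrightarrow> norm (g x) \<le> M" "0 \<le> M"
  shows "\<exists>h. continuous_on UNIV h \<and> (\<forall>x\<in>D. h x = g x)"
proof -
  have "\<exists>h. continuous_on UNIV h \<and> (\<forall>x\<in>D. h x = g x \<bullet> b)" if "b \<in> Basis" for b
  proof -
    have gb: "continuous_on D (\<lambda>x. g x \<bullet> b)" by (intro continuous_intros g)
    have le: "\<bar>g x \<bullet> b\<bar> \<le> M" if "x \<in> D" for x
      using M(1)[OF that] Basis_le_norm[OF \<open>b \<in> Basis\<close>, of "g x"] by linarith
    define s where "s x = (if x \<in> D then g x \<bullet> b else - M)" for x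
    define t where "t x = (if x \<in> D then g x \<bullet> b else M)" for x
    have "open {x. r < s x}" for r
    proof (cases "r < - M")
      case True
      then have "{x. r < s x} = UNIV" using le unfolding s_def by (auto dest!: le simp: abs_le_iff)
      then show ?thesis by simp
    next
      case False
      then have "{x. r < s x} = D \<inter> (\<lambda>x. g x \<bullet> b) -` {r<..}" by (auto simp: s_def split: if_splits)
      then show ?thesis using continuous_open_preimage[OF gb D] by simp
    qed
    moreover have "open {x. t x < r}" for r
    proof (cases "M < r")
      case True
      then have "{x. t x < r} = UNIV" unfolding t_def by (auto dest!: le simp: abs_le_iff)
      then show ?thesis by simp
    next
      case False
      then have "{x. t x < r} = D \<inter> (\<lambda>x. g x \<bullet> b) -` {..<r}" by (auto simp: t_def split: if_splits)
      then show ?thesis using continuous_open_preimage[OF gb D] by simp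
    qed
    moreover have "s x \<le> t x" for x
      using \<open>0 \<le> M\<close> by (simp add: s_def t_def)
    ultimately obtain h where h: "continuous_on UNIV h" "\<And>x. s x \<le> h x \<and> h x \<le> t x"
      using semicontinuous_sandwich by metis
    then have "h x = g x \<bullet> b" if "x \<in> D" for x
      using h(2)[of x] that by (auto simp: s_def t_def)
    then show ?thesis using h by auto
  qed
  then obtain h where h: "\<And>b. b \<in> Basis \<Longrightarrow> continuous_on UNIV (h b)"
      "\<And>b x. b \<in> Basis \<Longrightarrow> x \<in> D \<Longrightarrow> h b x = g x \<bullet> b"
    by metis
  have "continuous_on UNIV (\<lambda>x. \<Sum>b\<in>Basis. h b x *\<^sub>R b)"
    by (intro continuous_intros h)
  moreover have "(\<Sum>b\<in>Basis. h b x *\<^sub>R b) = g x" if "x \<in> D" for x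
    using h(2) that by (simp add: euclidean_representation)
  ultimately show ?thesis by blast
qed

text \<open>
  The prescriptions define a continuous function on an open dense set: the union of the sets
  \<open>B n\<close>, together with the complement of the closure of this union.
\<close>

lemma continuous_gluing:
  fixes f :: "nat \<Rightarrow> 'l \<Rightarrow> 'k::euclidean_space"
  assumes B: "\<And>n. open (B n)" "disjoint_family B"
    and f: "\<And>n. continuous_on UNIV (f n)" "\<And>n x. norm (f n x) \<le> M" "0 \<le> M"
  shows "\<exists>h. continuous_on UNIV h \<and> (\<forall>n. \<forall>x\<in>B n. h x = f n x) \<and>
    (\<forall>x. x \<notin> closure (\<Union>n. B n) \<longrightarrow> h x = 0)"
proof -
  define U where "U = (\<Union>n. B n)"
  define g where "g x = (if x \<in> U then f (THE n. x \<in> B n) x else 0)" for x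
  have the: "(THE n. x \<in> B n) = n" if "x \<in> B n" for x n
    using that B(2) by (auto simp: disjoint_family_on_def intro!: the_equality)
  have gB: "g x = f n x" if "x \<in> B n" for x n
    using that the[OF that] by (auto simp: g_def U_def)
  define D where "D n = (case n of 0 \<Rightarrow> - closure U | Suc n \<Rightarrow> B n)" for n
  have D: "open (D n)" "continuous_on (D n) g" for n
  proof -
    show "open (D n)" by (cases n) (auto simp: D_def B)
    show "continuous_on (D n) g"
    proof (cases n)
      case 0
      have "g x = 0" if "x \<in> - closure U" for x
        using that closure_subset[of U] by (auto simp: g_def)
      then have "continuous_on (- closure U) g \<longleftrightarrow> continuous_on (- closure U) (\<lambda>_. 0 :: 'k)"
        by (intro continuous_on_cong refl) auto
      then show ?thesis by (simp add: D_def 0)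
    next
      case (Suc m)
      have "continuous_on (B m) (f m)" using f(1) continuous_on_subset by blast
      then have "continuous_on (B m) g" by (subst continuous_on_cong[OF refl gB]) auto
      then show ?thesis by (simp add: D_def Suc)
    qed
  qed
  have "continuous_on (\<Union>n. D n) g"
    using D by (intro continuous_on_open_UN) auto
  moreover have "open (\<Union>n. D n)" using D by blast
  moreover have "norm (g x) \<le> M" for x
    using f by (simp add: g_def)
  ultimately obtain h where h: "continuous_on UNIV h" "\<And>x. x \<in> (\<Union>n. D n) \<Longrightarrow> h x = g x"
    using continuous_extension[of "\<Union>n. D n" g M] \<open>0 \<le> M\<close> by metis
  have "h x = f n x" if "x \<in> B n" for x n
  proof -
    have "x \<in> D (Suc n)" using that by (simp add: D_def)
    then have "h x = g x" by (intro h(2)) (rule UN_I[OF UNIV_I])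
    then show ?thesis using gB[OF that] by simp
  qed
  moreover have "h x = 0" if "x \<notin> closure U" for x
  proof -
    have "x \<in> D 0" using that by (simp add: D_def)
    then have "h x = g x" by (intro h(2)) (rule UN_I[OF UNIV_I])
    moreover have "x \<notin> U" using that closure_subset[of U] by auto
    ultimately show ?thesis by (simp add: g_def)
  qed
  ultimately show ?thesis using h(1) unfolding U_def by blast
qed

lemma mem_closed_if_on_dense:
  fixes h :: "'l \<Rightarrow> 'k::t1_space"
  assumes "continuous_on UNIV h" "\<And>x. x \<in> U \<Longrightarrow> h x \<in> C" "\<And>x. x \<notin> closure U \<Longrightarrow> h x \<in> C" "closed C"
  shows "h x \<in> C"
proof (cases "x \<in> closure U")
  case True
  have "closed (h -` C)" using assms continuous_closed_vimage[of C h]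
    by (simp add: continuous_on_eq_continuous_at)
  moreover have "U \<subseteq> h -` C" using assms by auto
  ultimately show ?thesis using True closure_minimal by blast
qed (use assms in auto)

text \<open>
  The operator is \<open>a \<mapsto> \<Sum>n. a n * f n\<close>. This sum does not converge in norm; what makes it
  meaningful is that a continuous function with the right values on a dense set exists and is
  unique.
\<close>

lemma gluing_operator:
  fixes f :: "nat \<Rightarrow> 'l \<Rightarrow> 'k::{real_normed_field,euclidean_space}"
  assumes B: "\<And>n. open (B n)" "disjoint_family B"
    and f: "\<And>n. continuous_on UNIV (f n)" "\<And>n x. norm (f n x) \<le> 1"
  shows "\<exists>V :: (nat \<Rightarrow>\<^sub>C 'k) \<Rightarrow>\<^sub>L ('l \<Rightarrow>\<^sub>C 'k). (\<forall>c a. blinfun_apply V (cscale c a) =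
    cscale c (blinfun_apply V a)) \<and> norm V \<le> 1 \<and>
    (\<forall>a n. \<forall>x\<in>B n. blinfun_apply V a x = a n * f n x) \<and>
      (\<forall>a x. x \<notin> closure (\<Union>n. B n) \<longrightarrow> blinfun_apply V a x = 0)"
proof -
  define U where "U = (\<Union>n. B n)"
  have "\<exists>h :: 'l \<Rightarrow>\<^sub>C 'k. (\<forall>n. \<forall>x\<in>B n. h x = a n * f n x) \<and> (\<forall>x. x \<notin> closure U \<longrightarrow> h x = 0)"
    for a :: "nat \<Rightarrow>\<^sub>C 'k"
  proof -
    have "norm (a n * f n x) \<le> norm a" for n x
      using norm_bounded[of a n] f(2)[of n x]
        by (simp add: norm_mult mult_le_one order_trans[OF mult_left_le])
    then obtain h where h: "continuous_on UNIV h" "\<And>n x. x \<in> B n \<Longrightarrow> h x = a n * f n x"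
      "\<And>x. x \<notin> closure U \<Longrightarrow> h x = 0"
      using continuous_gluing[OF B, of "\<lambda>n x. a n * f n x" "norm a"] unfolding U_def
        by (metis continuous_on_mult_left f(1) norm_ge_zero)
    then show ?thesis by (intro exI[of _ "Bcontfun h"]) (auto simp: apply_Bcontfun)
  qed
  then have "\<exists>V :: (nat \<Rightarrow>\<^sub>C 'k) \<Rightarrow> ('l \<Rightarrow>\<^sub>C 'k). \<forall>a. (\<forall>n. \<forall>x\<in>B n. apply_bcontfun (V a) x =
    apply_bcontfun a n * f n x) \<and>
      (\<forall>x. x \<notin> closure U \<longrightarrow> apply_bcontfun (V a) x = 0)"
    by (intro choice allI)
  then obtain V :: "(nat \<Rightarrow>\<^sub>C 'k) \<Rightarrow> ('l \<Rightarrow>\<^sub>C 'k)" where V: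
    "\<And>a n x. x \<in> B n \<Longrightarrow> apply_bcontfun (V a) x = apply_bcontfun a n * f n x"
      "\<And>a x. x \<notin> closure U \<Longrightarrow> apply_bcontfun (V a) x = 0"
    by blast
  have eq: "apply_bcontfun g = apply_bcontfun h"
    if "\<And>n x. x \<in> B n \<Longrightarrow> apply_bcontfun g x = apply_bcontfun h x"
    "\<And>x. x \<notin> closure U \<Longrightarrow> apply_bcontfun g x = apply_bcontfun h x"
    for g h :: "'l \<Rightarrow>\<^sub>C 'k"
  proof
    fix x
    have "apply_bcontfun (g - h) x \<in> {0}"
      by (rule mem_closed_if_on_dense[where U=U])
        (use that in \<open>auto simp: U_def intro!: continuous_intros\<close>)
    then show "g x = h x" by simp
  qed
  have le: "norm (V a) \<le> norm a" for a
  proof (rule norm_bound)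
    fix x
    have "norm (a n * f n x) \<le> norm a" for n x
      using norm_bounded[of a n] f(2)[of n x]
        by (simp add: norm_mult mult_le_one order_trans[OF mult_left_le])
    then have "apply_bcontfun (V a) x \<in> cball 0 (norm a)"
      by (rule_tac mem_closed_if_on_dense[where U=U and h="apply_bcontfun (V a)"])
        (auto simp: U_def V)
    then show "norm (V a x) \<le> norm a" by simp
  qed
  have add: "V (a + b) = V a + V b" for a b
    by (rule bcontfun_eqI, rule fun_cong[OF eq]) (auto simp: V algebra_simps)
  have scale: "V (cscale c a) = cscale c (V a)" for c a
    by (rule bcontfun_eqI, rule fun_cong[OF eq]) (auto simp: V algebra_simps)
  have bl: "bounded_linear V"
  proof (rule bounded_linear_intro[where K=1])
    show "V (r *\<^sub>R a) = r *\<^sub>R V a" for r a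
      using scale[of "of_real r" a] by (simp only: cscale_of_real)
  qed (simp_all add: add le)
  have "norm (Blinfun V) \<le> 1"
    by (rule norm_blinfun_bound) (simp_all add: bounded_linear_Blinfun_apply[OF bl] le)
  then show ?thesis
    unfolding U_def[symmetric]
    by (intro exI[of _ "Blinfun V"]) (simp add: bounded_linear_Blinfun_apply[OF bl] scale V)
qed

end

section \<open>Splitting dominated operators\<close>

definition sublinear :: "('e::real_vector \<Rightarrow> real) \<Rightarrow> bool"
  where "sublinear p \<longleftrightarrow> (\<forall>f g. p (f + g) \<le> p f + p g) \<and> (\<forall>r\<ge>0. \<forall>f. p (r *\<^sub>R f) = r * p f)"

context extremally_disconnected_compact
begin

text \<open>
  The Hahn-Banach theorem for operators with values in an order complete space. Partial operators
  are represented by their graphs: a subspace of pairs \<open>(f, y)\<close> with \<open>y \<le> p f\<close> is single-valued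
  because \<open>p 0 = 0\<close>, so Zorn's lemma can be applied to subspaces ordered by inclusion. To extend a
  maximal graph to a further vector \<open>v\<close>, its value has to lie between two families of continuous
  functions, and \<open>semicontinuous_sandwich\<close> provides it.
\<close>

lemma Kantorovich_extension:
  fixes p :: "'e::real_vector \<Rightarrow> real" and G\<^sub>0 :: "('e \<times> ('l \<Rightarrow>\<^sub>C real)) set"
  assumes p: "sublinear p" and G0: "subspace G\<^sub>0" "\<And>f y x. (f, y) \<in> G\<^sub>0 \<Longrightarrow> apply_bcontfun y x \<le> p f"
  shows "\<exists>W. linear W \<and> (\<forall>f x. apply_bcontfun (W f) x \<le> p f) \<and> (\<forall>f y. (f, y) \<in> G\<^sub>0 \<longrightarrow> W f = y)"
proof -
  define \<A> where "\<A> = {G. subspace G \<and> G\<^sub>0 \<subseteq> G \<and> (\<forall>f y x. (f, y) \<in> G \<longrightarrow> apply_bcontfun y x \<le> p f)}"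
  have padd: "p (f + g) \<le> p f + p g" and pscale: "r \<ge> 0 \<Longrightarrow> p (r *\<^sub>R f) = r * p f" for f g r
    using p by (auto simp: sublinear_def)
  have p0: "p 0 = 0" using pscale[of 0] by simp
  have "\<exists>M\<in>\<A>. \<forall>X\<in>\<A>. M \<subseteq> X \<longrightarrow> X = M"
  proof (rule subset_Zorn_nonempty)
    show "\<A> \<noteq> {}" using G0 by (auto simp: \<A>_def)
    fix \<C> assume \<C>: "\<C> \<noteq> {}" "subset.chain \<A> \<C>"
    then have sub: "\<C> \<subseteq> \<A>" and dir: "\<And>X Y. X \<in> \<C> \<Longrightarrow> Y \<in> \<C> \<Longrightarrow> X \<subseteq> Y \<or> Y \<subseteq> X"
      by (auto simp: subset_chain_def)
    have "subspace (\<Union>\<C>)"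
      unfolding subspace_def
    proof (intro conjI ballI allI)
      show "0 \<in> \<Union>\<C>" using \<C>(1) sub subspace_0 unfolding \<A>_def by blast
      fix x assume x: "x \<in> \<Union>\<C>"
      then show "c *\<^sub>R x \<in> \<Union>\<C>" for c using sub subspace_scale unfolding \<A>_def by blast
      fix y assume "y \<in> \<Union>\<C>"
      then obtain X where "X \<in> \<C>" "x \<in> X" "y \<in> X" using x dir by blast
      then show "x + y \<in> \<Union>\<C>" using sub subspace_add unfolding \<A>_def by blast
    qed
    moreover have "G\<^sub>0 \<subseteq> \<Union>\<C>" using \<C>(1) sub unfolding \<A>_def by blast
    ultimately show "\<Union>\<C> \<in> \<A>" using sub unfolding \<A>_def by blast
  qed
  then obtain M where M: "M \<in> \<A>" and max: "\<And>X. X \<in> \<A> \<Longrightarrow> M \<subseteq> X \<Longrightarrow> X = M" by blast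
  have subM: "subspace M" and G0M: "G\<^sub>0 \<subseteq> M" and pM: "\<And>f y x. (f, y) \<in> M \<Longrightarrow> apply_bcontfun y x \<le> p f"
    using M by (auto simp: \<A>_def)
  have addM: "(f + g, y + z) \<in> M" if "(f, y) \<in> M" "(g, z) \<in> M" for f g y z
    using subspace_add[OF subM that] by simp
  have scaleM: "(r *\<^sub>R f, r *\<^sub>R y) \<in> M" if "(f, y) \<in> M" for f y r
    using subspace_scale[OF subM that, of r] by simp
  have zeroM: "(0, 0) \<in> M" using subspace_0[OF subM] by (simp add: zero_prod_def)
  have uniq: "y = z" if "(f, y) \<in> M" "(f, z) \<in> M" for f y z
  proof (rule bcontfun_eqI)
    fix x
    have "(0, y - z) \<in> M" "(0, z - y) \<in> M"
      using subspace_diff[OF subM that] subspace_diff[OF subM that(2,1)] by simp_all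
    from pM[OF this(1), of x] pM[OF this(2), of x] show "apply_bcontfun y x = apply_bcontfun z x"
      by (simp add: p0)
  qed
  have total: "\<exists>y. (v, y) \<in> M" for v
  proof -
    define s where "s x = (SUP z\<in>M. apply_bcontfun (snd z) x - p (fst z - v))" for x
    define t where "t x = (INF z\<in>M. p (fst z + v) - apply_bcontfun (snd z) x)" for x
    have le: "apply_bcontfun (snd w) x - p (fst w - v) \<le> p (fst z + v) - apply_bcontfun (snd z) x"
      if "w \<in> M" "z \<in> M" for w z x
      using pM[of "fst w + fst z" "snd w + snd z" x] addM[of "fst w" "snd w" "fst z" "snd z"] that
        padd[of "fst w - v" "fst z + v"] by simp
    have ne: "M \<noteq> {}" using zeroM by auto
    have bs: "bdd_above ((\<lambda>z. apply_bcontfun (snd z) x - p (fst z - v)) ` M)" for x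
      by (rule bdd_aboveI2) (rule le[OF _ zeroM])
    have bt: "bdd_below ((\<lambda>z. p (fst z + v) - apply_bcontfun (snd z) x) ` M)" for x
      by (rule bdd_belowI2) (rule le[OF zeroM])
    have "\<exists>c. continuous_on UNIV c \<and> (\<forall>x. s x \<le> c x \<and> c x \<le> t x)"
    proof (rule semicontinuous_sandwich)
      fix r
      have "{x. r < s x} = (\<Union>z\<in>M. {x. r < apply_bcontfun (snd z) x - p (fst z - v)})"
        unfolding s_def less_cSUP_iff[OF ne bs] by auto
      also have "open \<dots>"
        by (intro open_UN ballI open_Collect_less continuous_intros) simp_all
      finally show "open {x. r < s x}" .
      have "{x. t x < r} = (\<Union>z\<in>M. {x. p (fst z + v) - apply_bcontfun (snd z) x < r})"
        unfolding t_def cINF_less_iff[OF ne bt] by auto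
      also have "open \<dots>"
        by (intro open_UN ballI open_Collect_less continuous_intros) simp_all
      finally show "open {x. t x < r}" .
    next
      fix x
      show "s x \<le> t x"
        unfolding s_def t_def
        by (intro cSUP_least[OF ne] cINF_greatest[OF ne] le)
    qed
    then obtain c where c: "continuous_on UNIV c" "\<And>x. s x \<le> c x" "\<And>x. c x \<le> t x" by blast
    have lo: "apply_bcontfun y x - p (f - v) \<le> c x" if "(f, y) \<in> M" for f y x
      using cSUP_upper[OF that bs, of x] c(2)[of x] by (simp add: s_def)
    have hi: "c x \<le> p (h + v) - apply_bcontfun z x" if "(h, z) \<in> M" for h z x
      using cINF_lower[OF bt that, of x] c(3)[of x] by (simp add: t_def)
    define C where "C = Bcontfun c"
    have C: "apply_bcontfun C x = c x" for x by (simp add: C_def apply_Bcontfun c)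
    define M' where "M' = span (insert (v, C) M)"
    have M'_iff: "(f, y) \<in> M' \<longleftrightarrow> (\<exists>k. (f - k *\<^sub>R v, y - k *\<^sub>R C) \<in> M)" for f y
      unfolding M'_def span_insert using subM by (simp add: span_eq_iff[THEN iffD2])
    have "M' \<in> \<A>"
      unfolding \<A>_def
    proof (intro CollectI conjI allI impI)
      show "subspace M'" by (simp add: M'_def)
      show "G\<^sub>0 \<subseteq> M'" using G0M span_superset[of "insert (v, C) M"] by (auto simp: M'_def)
      fix f y x assume "(f, y) \<in> M'"
      then obtain k where k: "(f - k *\<^sub>R v, y - k *\<^sub>R C) \<in> M" using M'_iff by blast
      consider "k = 0" | "k > 0" | "k < 0" by linarith
      then show "apply_bcontfun y x \<le> p f"
      proof cases
        case 1 then show ?thesis using pM[OF k] by simp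
      next
        case 2
        have "c x \<le> p ((1/k) *\<^sub>R (f - k *\<^sub>R v) + v) - apply_bcontfun ((1/k) *\<^sub>R (y - k *\<^sub>R C)) x"
          by (rule hi[OF scaleM[OF k]])
        moreover have "(1/k) *\<^sub>R (f - k *\<^sub>R v) + v = (1/k) *\<^sub>R f" using 2
          by (simp add: scaleR_diff_right)
        ultimately have "k * c x \<le> k * ((1/k) * p f - (1/k) * (apply_bcontfun y x - k * c x))"
          using 2 pscale[of "1/k" f] C by (intro mult_left_mono) simp_all
        then show ?thesis using 2 by (simp add: field_simps)
      next
        case 3
        have "apply_bcontfun ((-1/k) *\<^sub>R (y - k *\<^sub>R C)) x - p ((-1/k) *\<^sub>R (f - k *\<^sub>R v) - v) \<le> c x"
          by (rule lo[OF scaleM[OF k]])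
        moreover have "(-1/k) *\<^sub>R (f - k *\<^sub>R v) - v = (-1/k) *\<^sub>R f" using 3
          by (simp add: scaleR_diff_right)
        ultimately have "(-k) * ((-1/k) * (apply_bcontfun y x - k * c x) - (-1/k) * p f) \<le>
          (-k) * c x"
          using 3 pscale[of "-1/k" f] C by (intro mult_left_mono) simp_all
        then show ?thesis using 3 by (simp add: field_simps)
      qed
    qed
    moreover have "M \<subseteq> M'" using span_superset[of "insert (v, C) M"] by (auto simp: M'_def)
    ultimately have "M' = M" using max by blast
    moreover have "(v, C) \<in> M'" unfolding M'_def by (rule span_base) simp
    ultimately show ?thesis by blast
  qed
  define W where "W f = (THE y. (f, y) \<in> M)" for f
  have W: "(f, W f) \<in> M" for f
    unfolding W_def using total[of f] uniq by (metis the_equality)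
  have Weq: "W f = y" if "(f, y) \<in> M" for f y using uniq W that by blast
  have "linear W"
    by (rule linearI) (use Weq addM scaleM W in auto)
  then show ?thesis using W pM Weq G0M by blast
qed

text \<open>
  On the product space, \<open>(f, g) \<mapsto> p f + q g\<close> is sublinear and dominates the operator that \<open>T\<close>
  induces on the diagonal. The two components of an extension of this operator are \<open>W\<close> and
  \<open>T - W\<close>.
\<close>

lemma dominated_split:
  fixes T :: "'e::real_vector \<Rightarrow> 'l \<Rightarrow>\<^sub>C real"
  assumes T: "linear T" and p: "sublinear p" and q: "sublinear q"
    and Tpq: "\<And>f x. apply_bcontfun (T f) x \<le> p f + q f"
  shows "\<exists>W. linear W \<and> (\<forall>f x. apply_bcontfun (W f) x \<le> p f) \<and>
    (\<forall>f x. apply_bcontfun (T f) x - apply_bcontfun (W f) x \<le> q f)"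
proof -
  define P where "P = (\<lambda>(f, g). p f + q g)"
  have p0: "p 0 = 0" and q0: "q 0 = 0" using p q unfolding sublinear_def
    by (metis mult_zero_left order_refl scaleR_zero_left)+
  have pq: "p (f + g) \<le> p f + p g" "q (f + g) \<le> q f + q g" "r \<ge> 0 \<Longrightarrow> p (r *\<^sub>R f) = r * p f"
      "r \<ge> 0 \<Longrightarrow> q (r *\<^sub>R f) = r * q f" for f g r
    using p q by (simp_all add: sublinear_def)
  have "sublinear P"
    unfolding sublinear_def
  proof (intro conjI allI impI)
    fix z w :: "'e \<times> 'e"
    show "P (z + w) \<le> P z + P w"
      using pq(1)[of "fst z" "fst w"] pq(2)[of "snd z" "snd w"]
        by (simp add: P_def case_prod_unfold)
    show "P (r *\<^sub>R z) = r * P z" if "0 \<le> r" for r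
      using pq(3,4)[OF that] by (simp add: P_def case_prod_unfold distrib_left)
  qed
  moreover have "subspace (range (\<lambda>f. ((f, f), T f)))"
  proof -
    have "linear (\<lambda>f. ((f, f), T f))"
      by (rule linearI) (simp_all add: linear_add[OF T] linear_scale[OF T])
    then show ?thesis using linear_subspace_image subspace_UNIV by blast
  qed
  moreover have "apply_bcontfun y x \<le> P f" if "(f, y) \<in> range (\<lambda>f. ((f, f), T f))" for f y x
    using that Tpq by (auto simp: P_def)
  ultimately have "\<exists>\<Phi>. linear \<Phi> \<and> (\<forall>f x. apply_bcontfun (\<Phi> f) x \<le> P f) \<and>
      (\<forall>f y. (f, y) \<in> range (\<lambda>f. ((f, f), T f)) \<longrightarrow> \<Phi> f = y)"
    by (rule Kantorovich_extension)
  then obtain \<Phi> where \<Phi>: "linear \<Phi>" "\<forall>f x. apply_bcontfun (\<Phi> f) x \<le> P f"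
      and \<Phi>T: "\<forall>f y. (f, y) \<in> range (\<lambda>f. ((f, f), T f)) \<longrightarrow> \<Phi> f = y"
    by (elim exE conjE) (rule that)
  have \<Phi>T: "\<Phi> (f, f) = T f" for f using \<Phi>T by simp
  have "T f - \<Phi> (f, 0) = \<Phi> (0, f)" for f
    using linear_diff[OF \<Phi>(1), of "(f, f)" "(f, 0)"] \<Phi>T by simp
  then have "apply_bcontfun (T f) x - apply_bcontfun (\<Phi> (f, 0)) x = apply_bcontfun (\<Phi> (0, f)) x"
    for f x
    by (metis minus_bcontfun.rep_eq)
  moreover have "linear (\<lambda>f. \<Phi> (f, 0))"
  proof (rule linearI)
    show "\<Phi> (f + g, 0) = \<Phi> (f, 0) + \<Phi> (g, 0)" for f g
      using linear_add[OF \<Phi>(1), of "(f, 0)" "(g, 0)"] by simp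
    show "\<Phi> (r *\<^sub>R f, 0) = r *\<^sub>R \<Phi> (f, 0)" for r f
      using linear_scale[OF \<Phi>(1), of r "(f, 0)"] by simp
  qed
  ultimately show ?thesis
    using \<Phi>(2)[rule_format, of "(f, 0)" for f] \<Phi>(2)[rule_format, of "(0, f)" for f] p0 q0
    by (intro exI[of _ "\<lambda>f. \<Phi> (f, 0)"]) (simp add: P_def)
qed

end

definition scalar_seminorm :: "(('a::topological_space \<Rightarrow>\<^sub>C 'k::real_normed_field) \<Rightarrow> real) \<Rightarrow> bool"
  where "scalar_seminorm p \<longleftrightarrow> (\<forall>f g. p (f + g) \<le> p f + p g) \<and> (\<forall>c f. p (cscale c f) = norm c * p f)"

lemma scalar_seminorm_sublinear: "scalar_seminorm p \<Longrightarrow> sublinear p"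
  unfolding scalar_seminorm_def sublinear_def
  by (metis abs_of_nonneg cscale_of_real norm_of_real)

context extremally_disconnected_compact
begin

lemma dominated_split_real:
  fixes T :: "('l \<Rightarrow>\<^sub>C real) \<Rightarrow>\<^sub>L ('l \<Rightarrow>\<^sub>C real)"
  assumes "T \<in> bounded_ops cscale" and p: "scalar_seminorm p" and q: "scalar_seminorm q"
    and M: "\<And>f. p f \<le> M * norm f" and T: "\<And>f x. norm (apply_bcontfun (T f) x) \<le> p f + q f"
  shows "\<exists>W \<in> bounded_ops cscale. (\<forall>f x. norm (apply_bcontfun (blinfun_apply W f) x) \<le> p f) \<and>
    (\<forall>f x. norm (apply_bcontfun (T f - W f) x) \<le> q f)"
proof -
  have cs: "cscale c f = c *\<^sub>R f" for c and f :: "'l \<Rightarrow>\<^sub>C real"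
    using cscale_of_real[of c f] by simp
  have "linear T" using blinfun.bounded_linear_right bounded_linear.linear by blast
  moreover have "apply_bcontfun (T f) x \<le> p f + q f" for f x using T[of f x] by simp
  ultimately obtain W where W: "linear W" "\<And>f x. apply_bcontfun (W f) x \<le> p f"
      "\<And>f x. apply_bcontfun (T f) x - apply_bcontfun (W f) x \<le> q f"
    using dominated_split[OF _ scalar_seminorm_sublinear[OF p] scalar_seminorm_sublinear[OF q],
      of T] by blast
  have neg: "p (- f) = p f" "q (- f) = q f" for f
    using p q cs[of "-1" f] unfolding scalar_seminorm_def
      by (metis scaleR_minus1_left norm_minus_cancel norm_one mult_1)+
  have Wp: "\<bar>apply_bcontfun (W f) x\<bar> \<le> p f" for f x
    using W(2)[of f x] W(2)[of "- f" x] by (auto simp: linear_neg[OF W(1)] neg)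
  have Wq: "\<bar>apply_bcontfun (T f) x - apply_bcontfun (W f) x\<bar> \<le> q f" for f x
    using W(3)[of f x] W(3)[of "- f" x] by (auto simp: linear_neg[OF W(1)] neg blinfun.minus_right)
  have "norm (W f) \<le> norm f * M" for f
    by (rule norm_bound) (use Wp M order_trans in \<open>fastforce simp: mult.commute\<close>)
  then have bl: "bounded_linear W"
    using W(1) by (intro bounded_linear_intro[where K=M]) (auto simp: linear_add linear_scale)
  show ?thesis
    by (rule bexI[of _ "Blinfun W"])
      (use Wp Wq W(1) in \<open>auto simp: bounded_linear_Blinfun_apply[OF bl] bounded_ops_def cs
        linear_scale\<close>)
qed

text \<open>
  The splitting is applied to the real part of \<open>T\<close>. A real-linear \<open>W\<^sub>1\<close> is the real part of the
  complex-linear operator \<open>f \<mapsto> W\<^sub>1 f - \<i> W\<^sub>1 (\<i> f)\<close>, and bounds on real parts become bounds on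
  absolute values because the seminorms do not change when \<open>f\<close> is multiplied by a scalar of
  modulus 1.
\<close>

lemma dominated_split_complex:
  fixes T :: "('l \<Rightarrow>\<^sub>C complex) \<Rightarrow>\<^sub>L ('l \<Rightarrow>\<^sub>C complex)"
  assumes Tc: "T \<in> bounded_ops cscale" and p: "scalar_seminorm p" and q: "scalar_seminorm q"
    and M: "\<And>f. p f \<le> M * norm f" and T: "\<And>f x. norm (apply_bcontfun (T f) x) \<le> p f + q f"
  shows "\<exists>W \<in> bounded_ops cscale. (\<forall>f x. norm (apply_bcontfun (blinfun_apply W f) x) \<le> p f) \<and>
    (\<forall>f x. norm (apply_bcontfun (T f - W f) x) \<le> q f)"
proof -
  have Tc: "T (cscale c f) = cscale c (T f)" for c f using Tc by (simp add: bounded_ops_def)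
  define T\<^sub>1 where "T\<^sub>1 f = Bcontfun (\<lambda>x. Re (apply_bcontfun (T f) x))" for f
  have T1: "apply_bcontfun (T\<^sub>1 f) x = Re (apply_bcontfun (T f) x)" for f x
    unfolding T\<^sub>1_def by (subst apply_Bcontfun) (auto intro!: continuous_intros)
  have "linear T\<^sub>1"
    by (rule linearI; rule bcontfun_eqI) (simp_all add: T1 blinfun.add_right blinfun.scaleR_right)
  moreover have "apply_bcontfun (T\<^sub>1 f) x \<le> p f + q f" for f x
    using T[of f x] complex_Re_le_cmod[of "apply_bcontfun (T f) x"] by (simp add: T1)
  ultimately obtain W\<^sub>1 where W1: "linear W\<^sub>1" "\<And>f x. apply_bcontfun (W\<^sub>1 f) x \<le> p f"
      "\<And>f x. apply_bcontfun (T\<^sub>1 f) x - apply_bcontfun (W\<^sub>1 f) x \<le> q f"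
    using dominated_split[OF _ scalar_seminorm_sublinear[OF p] scalar_seminorm_sublinear[OF q],
      of T\<^sub>1] by blast
  define W where "W f = Bcontfun (\<lambda>x. Complex (apply_bcontfun (W\<^sub>1 f) x)
    (- apply_bcontfun (W\<^sub>1 (cscale \<i> f)) x))" for f
  have W: "apply_bcontfun (W f) x = Complex (apply_bcontfun (W\<^sub>1 f) x)
    (- apply_bcontfun (W\<^sub>1 (cscale \<i> f)) x)" for f x
    unfolding W_def by (subst apply_Bcontfun) (auto intro!: continuous_intros simp: Complex_eq)
  have cs: "cscale c f = Re c *\<^sub>R f + Im c *\<^sub>R cscale \<i> f" for c and f :: "'l \<Rightarrow>\<^sub>C complex"
    by (rule bcontfun_eqI) (simp add: complex_eq_iff)
  have Wadd: "W (f + g) = W f + W g" for f g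
    by (rule bcontfun_eqI)
      (simp add: W complex_eq_iff linear_add[OF W1(1)]
        bounded_linear.linear[OF bounded_linear_cscale, THEN linear_add])
  have WscaleR: "W (r *\<^sub>R f) = r *\<^sub>R W f" for r f
    by (rule bcontfun_eqI)
      (simp add: W complex_eq_iff linear_scale[OF W1(1)]
        bounded_linear.linear[OF bounded_linear_cscale, THEN linear_scale])
  have ii: "cscale \<i> (cscale \<i> f) = - f" for f :: "'l \<Rightarrow>\<^sub>C complex"
    by (rule bcontfun_eqI) simp
  have Wi: "W (cscale \<i> f) = cscale \<i> (W f)" for f
    by (rule bcontfun_eqI) (simp add: W complex_eq_iff ii linear_neg[OF W1(1)])
  have Wc: "W (cscale c f) = cscale c (W f)" for c f
    by (subst (1 2) cs) (simp add: Wadd WscaleR Wi)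
  have rot: "\<exists>u. norm u = 1 \<and> Re (u * w) = norm w" for w :: complex
  proof (cases "w = 0")
    case False
    then show ?thesis
      by (intro exI[of _ "cnj w / norm w"])
        (simp add: norm_divide complex_norm_square[symmetric] mult.commute[of "cnj w"]
          power2_eq_square)
  qed (auto intro: exI[of _ 1])
  have rp: "p (cscale u f) = p f" "q (cscale u f) = q f" if "norm u = 1" for u f
    using p q that by (simp_all add: scalar_seminorm_def)
  have Wp: "norm (apply_bcontfun (W f) x) \<le> p f" for f x
  proof -
    obtain u where u: "norm u = 1" "Re (u * apply_bcontfun (W f) x) = norm (apply_bcontfun (W f) x)"
      using rot by blast
    have "u * apply_bcontfun (W f) x = apply_bcontfun (W (cscale u f)) x" by (simp add: Wc)
    then have "norm (apply_bcontfun (W f) x) = apply_bcontfun (W\<^sub>1 (cscale u f)) x" using u(2)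
      by (simp add: W)
    then show ?thesis using W1(2)[of "cscale u f" x] rp[OF u(1)] by simp
  qed
  have Wq: "norm (apply_bcontfun (T f - W f) x) \<le> q f" for f x
  proof -
    obtain u where u: "norm u = 1" "Re (u * apply_bcontfun (T f - W f) x) =
      norm (apply_bcontfun (T f - W f) x)"
      using rot by blast
    have "u * apply_bcontfun (T f - W f) x = apply_bcontfun (T (cscale u f) - W (cscale u f)) x"
      by (simp add: Wc Tc algebra_simps)
    then have "norm (apply_bcontfun (T f - W f) x) =
      apply_bcontfun (T\<^sub>1 (cscale u f)) x - apply_bcontfun (W\<^sub>1 (cscale u f)) x"
      using u(2) by (simp add: W T1)
    then show ?thesis using W1(3)[of "cscale u f" x] rp[OF u(1)] by simp
  qed
  have "norm (W f) \<le> norm f * M" for f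
    by (rule norm_bound) (use Wp M order_trans in \<open>fastforce simp: mult.commute\<close>)
  then have bl: "bounded_linear W"
    by (intro bounded_linear_intro[where K=M]) (auto simp: Wadd WscaleR)
  show ?thesis
    by (rule bexI[of _ "Blinfun W"])
      (use Wp Wq Wc in \<open>auto simp: bounded_linear_Blinfun_apply[OF bl] bounded_ops_def\<close>)
qed

end

section \<open>The variation of a functional\<close>

text \<open>
  If \<open>\<phi>\<close> is integration against a measure \<open>\<mu>\<close> and \<open>g \<ge> 0\<close> is lower semicontinuous, this is the
  integral of \<open>g\<close> against the total variation of \<open>\<mu>\<close>.
\<close>

definition variation :: "(('a::topological_space \<Rightarrow>\<^sub>C 'k::real_normed_vector) \<Rightarrow> 'k) \<Rightarrow> ('a \<Rightarrow> real) \<Rightarrow>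
  real"
  where "variation \<phi> g = (SUP f\<in>{f. \<forall>x. norm (apply_bcontfun f x) \<le> g x}. norm (\<phi> f))"

locale scalar_functional =
  fixes \<phi> :: "('a::topological_space \<Rightarrow>\<^sub>C 'k::real_normed_field) \<Rightarrow> 'k" and K :: real
  assumes add: "\<phi> (f + g) = \<phi> f + \<phi> g" and scale: "\<phi> (cscale c f) = c * \<phi> f"
    and bound: "norm (\<phi> f) \<le> K * norm f" and K_nonneg: "0 \<le> K"
begin

lemma bdd_above_variation:
  assumes "\<And>x. g x \<le> R"
  shows "bdd_above ((\<lambda>f. norm (\<phi> f)) ` {f. \<forall>x. norm (apply_bcontfun f x) \<le> g x})"
proof (rule bdd_aboveI2)
  fix f :: "'a \<Rightarrow>\<^sub>C 'k" assume "f \<in> {f. \<forall>x. norm (apply_bcontfun f x) \<le> g x}"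
  then have "norm f \<le> R" by (intro norm_bound) (use assms order_trans in blast)
  then show "norm (\<phi> f) \<le> K * R" using bound[of f] K_nonneg by (meson mult_left_mono order_trans)
qed

lemma variation_upper:
  assumes "\<And>x. norm (apply_bcontfun f x) \<le> g x" "\<And>x. g x \<le> R"
  shows "norm (\<phi> f) \<le> variation \<phi> g"
  unfolding variation_def by (rule cSUP_upper[OF _ bdd_above_variation]) (use assms in auto)

lemma variation_least:
  assumes "\<And>x. 0 \<le> g x" "\<And>f. (\<And>x. norm (apply_bcontfun f x) \<le> g x) \<Longrightarrow> norm (\<phi> f) \<le> b"
  shows "variation \<phi> g \<le> b"
  unfolding variation_def
proof (rule cSUP_least)
  have "0 \<in> {f. \<forall>x. norm (apply_bcontfun f x) \<le> g x}" using assms(1) by simp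
  then show "{f. \<forall>x. norm (apply_bcontfun f x) \<le> g x} \<noteq> {}" by blast
qed (use assms(2) in blast)

lemma variation_nonneg:
  assumes "\<And>x. 0 \<le> g x" "\<And>x. g x \<le> R"
  shows "0 \<le> variation \<phi> g"
proof (rule order_trans)
  show "norm (\<phi> 0) \<le> variation \<phi> g" by (rule variation_upper) (use assms in auto)
qed simp

lemma variation_mono:
  assumes "\<And>x. 0 \<le> g x" "\<And>x. g x \<le> h x" "\<And>x. h x \<le> R"
  shows "variation \<phi> g \<le> variation \<phi> h"
  by (rule variation_least) (use assms order_trans in \<open>blast intro: variation_upper\<close>)+

lemma variation_le:
  assumes "\<And>x. 0 \<le> g x" "\<And>x. g x \<le> R"
  shows "variation \<phi> g \<le> K * R"
proof (rule variation_least)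
  fix f :: "'a \<Rightarrow>\<^sub>C 'k" assume "\<And>x. norm (apply_bcontfun f x) \<le> g x"
  then have "norm f \<le> R" by (intro norm_bound) (use assms order_trans in blast)
  then show "norm (\<phi> f) \<le> K * R" using bound[of f] K_nonneg by (meson mult_left_mono order_trans)
qed (use assms in auto)

lemma variation_scale_le:
  assumes "\<And>x. 0 \<le> g x" "\<And>x. g x \<le> R" and r: "0 < r"
  shows "variation \<phi> (\<lambda>x. r * g x) \<le> r * variation \<phi> g"
proof (rule variation_least)
  fix f :: "'a \<Rightarrow>\<^sub>C 'k" assume f: "\<And>x. norm (apply_bcontfun f x) \<le> r * g x"
  have "norm (\<phi> (cscale (of_real (1/r)) f)) \<le> variation \<phi> g"
    by (rule variation_upper) (use assms f in \<open>auto simp: norm_mult norm_divide field_simps\<close>)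
  then show "norm (\<phi> f) \<le> r * variation \<phi> g" using r
    by (simp add: scale norm_mult norm_divide field_simps)
qed (use assms in auto)

lemma variation_scale:
  assumes "\<And>x. 0 \<le> g x" "\<And>x. g x \<le> R" and r: "0 \<le> r"
  shows "variation \<phi> (\<lambda>x. r * g x) = r * variation \<phi> g"
proof (cases "r = 0")
  case True
  have "variation \<phi> (\<lambda>x. 0) \<le> K * 0" by (rule variation_le) auto
  moreover have "0 \<le> variation \<phi> (\<lambda>x. 0)" by (rule variation_nonneg) auto
  ultimately show ?thesis using True by simp
next
  case False
  then have r: "0 < r" using r by simp
  have "variation \<phi> (\<lambda>x. (1/r) * (r * g x)) \<le> (1/r) * variation \<phi> (\<lambda>x. r * g x)"
    by (rule variation_scale_le[where R="r * R"]) (use r assms in auto)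
  then have "r * variation \<phi> g \<le> variation \<phi> (\<lambda>x. r * g x)" using r by (simp add: field_simps)
  moreover have "variation \<phi> (\<lambda>x. r * g x) \<le> r * variation \<phi> g"
    by (rule variation_scale_le) (use assms r in auto)
  ultimately show ?thesis by simp
qed

text \<open>
  Two functions that are bounded by \<open>g\<close> and \<open>h\<close> can be multiplied by scalars of modulus 1 so that
  the values of \<open>\<phi>\<close> at them do not cancel.
\<close>

lemma variation_superadditive:
  assumes g: "\<And>x. 0 \<le> g x" "\<And>x. g x \<le> R" and h: "\<And>x. 0 \<le> h x" "\<And>x. h x \<le> R"
  shows "variation \<phi> g + variation \<phi> h \<le> variation \<phi> (\<lambda>x. g x + h x)"
proof -
  have rot: "\<exists>u. norm u \<le> 1 \<and> u * w = of_real (norm w)" for w :: 'k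
  proof (cases "w = 0")
    case False
    then show ?thesis by (intro exI[of _ "of_real (norm w) / w"]) (simp add: norm_divide)
  qed (auto intro: exI[of _ 0])
  have "norm (\<phi> f\<^sub>1) + norm (\<phi> f\<^sub>2) \<le> variation \<phi> (\<lambda>x. g x + h x)"
    if f1: "\<And>x. norm (apply_bcontfun f\<^sub>1 x) \<le> g x" and f2: "\<And>x. norm (apply_bcontfun f\<^sub>2 x) \<le> h x"
      for f\<^sub>1 f\<^sub>2
  proof -
    obtain u\<^sub>1 where u1: "norm u\<^sub>1 \<le> 1" "u\<^sub>1 * \<phi> f\<^sub>1 = of_real (norm (\<phi> f\<^sub>1))" using rot by blast
    obtain u\<^sub>2 where u2: "norm u\<^sub>2 \<le> 1" "u\<^sub>2 * \<phi> f\<^sub>2 = of_real (norm (\<phi> f\<^sub>2))" using rot by blast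
    have "norm (\<phi> (cscale u\<^sub>1 f\<^sub>1 + cscale u\<^sub>2 f\<^sub>2)) \<le> variation \<phi> (\<lambda>x. g x + h x)"
    proof (rule variation_upper)
      fix x
      have "norm (u\<^sub>1 * apply_bcontfun f\<^sub>1 x) \<le> norm (apply_bcontfun f\<^sub>1 x)"
          "norm (u\<^sub>2 * apply_bcontfun f\<^sub>2 x) \<le> norm (apply_bcontfun f\<^sub>2 x)"
        using u1(1) u2(1) by (simp_all add: norm_mult mult_left_le_one_le)
      then show "norm (apply_bcontfun (cscale u\<^sub>1 f\<^sub>1 + cscale u\<^sub>2 f\<^sub>2) x) \<le> g x + h x"
        using f1[of x] f2[of x] norm_triangle_ineq[of "u\<^sub>1 * apply_bcontfun f\<^sub>1 x"
          "u\<^sub>2 * apply_bcontfun f\<^sub>2 x"] by simp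
      show "g x + h x \<le> 2 * R" using g(2)[of x] h(2)[of x] by simp
    qed
    moreover have "\<phi> (cscale u\<^sub>1 f\<^sub>1 + cscale u\<^sub>2 f\<^sub>2) = of_real (norm (\<phi> f\<^sub>1) + norm (\<phi> f\<^sub>2))"
      by (simp add: add scale u1 u2)
    ultimately have "\<bar>norm (\<phi> f\<^sub>1) + norm (\<phi> f\<^sub>2)\<bar> \<le> variation \<phi> (\<lambda>x. g x + h x)"
      by (simp only: norm_of_real)
    then show ?thesis by linarith
  qed
  then have "norm (\<phi> f\<^sub>1) + variation \<phi> h \<le> variation \<phi> (\<lambda>x. g x + h x)"
    if f1: "\<And>x. norm (apply_bcontfun f\<^sub>1 x) \<le> g x" for f\<^sub>1
    using variation_least[of h "variation \<phi> (\<lambda>x. g x + h x) - norm (\<phi> f\<^sub>1)"] h(1) that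
      by (fastforce simp: algebra_simps)
  then show ?thesis
    using variation_least[of g "variation \<phi> (\<lambda>x. g x + h x) - variation \<phi> h"] g(1)
      by (fastforce simp: algebra_simps)
qed

text \<open>
  A function bounded by \<open>g + h\<close> is split in the proportion \<open>g : h\<close>. Dividing by \<open>g + h + e\<close>
  instead of \<open>g + h\<close> keeps the parts continuous and leaves a remainder of norm at most \<open>e\<close>.
\<close>

lemma variation_subadditive:
  assumes g: "\<And>x. 0 \<le> g x" "\<And>x. g x \<le> R" "continuous_on UNIV g"
    and h: "\<And>x. 0 \<le> h x" "\<And>x. h x \<le> R" "continuous_on UNIV h"
  shows "variation \<phi> (\<lambda>x. g x + h x) \<le> variation \<phi> g + variation \<phi> h"
proof (rule variation_least)
  fix f :: "'a \<Rightarrow>\<^sub>C 'k" assume f: "\<And>x. norm (apply_bcontfun f x) \<le> g x + h x"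
  have *: "norm (\<phi> f) \<le> variation \<phi> g + variation \<phi> h + K * e" if "e > 0" for e
  proof -
    define w where "w k x = (k x / (g x + h x + e)) *\<^sub>R apply_bcontfun f x"
      for k :: "'a \<Rightarrow> real" and x
    have pos: "g x + h x + e > 0" for x using g(1)[of x] h(1)[of x] that by linarith
    have le: "norm (w k x) \<le> k x" if "0 \<le> k x" for k x
    proof -
      have "norm (w k x) = k x * (norm (apply_bcontfun f x) / (g x + h x + e))"
        using that pos[of x] by (simp add: w_def abs_of_pos)
      also have "\<dots> \<le> k x * 1"
        using that pos[of x] f[of x] \<open>e > 0\<close> by (intro mult_left_mono) (auto simp: field_simps)
      finally show ?thesis by simp
    qed
    have w: "apply_bcontfun (Bcontfun (w k)) x = w k x"
      if "\<And>x. 0 \<le> k x" "\<And>x. k x \<le> B" "continuous_on UNIV k" for k x B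
    proof -
      have "continuous_on UNIV (w k)"
        unfolding w_def using pos that g(3) h(3)
        by (intro continuous_intros) (auto simp: less_imp_neq[symmetric])
      moreover have "norm (w k x) \<le> B" for x using le[of k x] that order_trans by blast
      ultimately have "w k \<in> bcontfun" by (rule bcontfun_normI)
      then show ?thesis by (simp add: Bcontfun_inverse)
    qed
    note wg = w[OF g] and wh = w[OF h]
    have we: "apply_bcontfun (Bcontfun (w (\<lambda>_. e))) x = w (\<lambda>_. e) x" for x
      using w[of "\<lambda>_. e" e] that by simp
    have "f = Bcontfun (w g) + Bcontfun (w h) + Bcontfun (w (\<lambda>_. e))"
    proof (rule bcontfun_eqI)
      fix x
      have "g x / (g x + h x + e) + h x / (g x + h x + e) + e / (g x + h x + e) = 1"
        using pos[of x] by (simp add: add_divide_distrib[symmetric])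
      then have "w g x + w h x + w (\<lambda>_. e) x = apply_bcontfun f x"
        unfolding w_def by (metis scaleR_left_distrib scaleR_one)
      then show "apply_bcontfun f x = apply_bcontfun (Bcontfun (w g) + Bcontfun (w h) +
        Bcontfun (w (\<lambda>_. e))) x"
        by (simp add: wg wh we)
    qed
    then have "\<phi> f = \<phi> (Bcontfun (w g)) + \<phi> (Bcontfun (w h)) + \<phi> (Bcontfun (w (\<lambda>_. e)))"
      by (metis add)
    then have "norm (\<phi> f) \<le> norm (\<phi> (Bcontfun (w g))) + norm (\<phi> (Bcontfun (w h))) +
      norm (\<phi> (Bcontfun (w (\<lambda>_. e))))"
      by (metis norm_triangle_le order_refl add_right_mono norm_triangle_ineq)
    moreover have "norm (\<phi> (Bcontfun (w g))) \<le> variation \<phi> g"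
      by (rule variation_upper[where R=R]) (use g le in \<open>auto simp: wg\<close>)
    moreover have "norm (\<phi> (Bcontfun (w h))) \<le> variation \<phi> h"
      by (rule variation_upper[where R=R]) (use h le in \<open>auto simp: wh\<close>)
    moreover have "norm (\<phi> (Bcontfun (w (\<lambda>_. e)))) \<le> K * e"
    proof -
      have "norm (Bcontfun (w (\<lambda>_. e))) \<le> e"
        by (rule norm_bound) (use le[of "\<lambda>_. e"] that in \<open>auto simp: we\<close>)
      then show ?thesis using bound K_nonneg by (meson mult_left_mono order_trans)
    qed
    ultimately show ?thesis by linarith
  qed
  show "norm (\<phi> f) \<le> variation \<phi> g + variation \<phi> h"
  proof (rule field_le_epsilon)
    fix e :: real assume "e > 0"
    then have "norm (\<phi> f) \<le> variation \<phi> g + variation \<phi> h + K * (e / (K + 1))"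
      using *[of "e / (K + 1)"] K_nonneg by simp
    also have "K * (e / (K + 1)) \<le> e" using K_nonneg \<open>e > 0\<close> by (simp add: field_simps)
    finally show "norm (\<phi> f) \<le> variation \<phi> g + variation \<phi> h + e" by simp
  qed
qed (use g h in \<open>simp add: add_nonneg_nonneg\<close>)

lemma variation_add:
  assumes "\<And>x. 0 \<le> g x" "\<And>x. g x \<le> R" "continuous_on UNIV g"
    and "\<And>x. 0 \<le> h x" "\<And>x. h x \<le> R" "continuous_on UNIV h"
  shows "variation \<phi> (\<lambda>x. g x + h x) = variation \<phi> g + variation \<phi> h"
  by (intro antisym variation_subadditive[where R=R] variation_superadditive[where R=R] assms)

end

lemma scalar_functional_eval:
  fixes T :: "('a::topological_space \<Rightarrow>\<^sub>C 'k::real_normed_field) \<Rightarrow>\<^sub>L ('a \<Rightarrow>\<^sub>C 'k)"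
  assumes "T \<in> bounded_ops cscale"
  shows "scalar_functional (\<lambda>f. apply_bcontfun (T f) x) (norm T)"
proof
  show "norm (apply_bcontfun (T f) x) \<le> norm T * norm f" for f
    using norm_bounded[of "T f" x] norm_blinfun[of T f] by linarith
qed (use assms in \<open>auto simp: bounded_ops_def blinfun.add_right\<close>)

section \<open>Extracting disjoint sets\<close>

text \<open>
  As \<open>\<mu> n\<close> is small on the later sets \<open>A m\<close>, it keeps three quarters of \<open>c\<close> on
  \<open>C n N = A n - (A (n+1) \<union> \<dots> \<union> A N)\<close>, uniformly in \<open>N\<close>. These sets are disjoint for different
  \<open>n \<le> N\<close> and the same \<open>N\<close>, but removing infinitely many sets at once is not possible in an
  algebra of sets, so disjointness for different \<open>N\<close> has to be bought. The total masses being
  bounded, among sufficiently many disjoint sets \<open>C n N\<close> one has small mass for infinitely many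
  \<open>\<mu> m\<close>, by the pigeonhole principle. Choosing such a set again and again, each time keeping only
  those \<open>m\<close>, yields a sequence of sets that have little mass for all later members, so that their
  union can be removed from each later set.
\<close>

lemma disjoint_sets_of_almost_disjoint_masses:
  fixes \<mu> :: "nat \<Rightarrow> 'a set \<Rightarrow> real"
  assumes diff: "\<And>S T. S \<in> \<C> \<Longrightarrow> T \<in> \<C> \<Longrightarrow> S - T \<in> \<C>" and un: "\<And>S T. S \<in> \<C> \<Longrightarrow> T \<in> \<C> \<Longrightarrow> S \<union> T \<in> \<C>"
    and add: "\<And>n S T. S \<in> \<C> \<Longrightarrow> T \<in> \<C> \<Longrightarrow> S \<inter> T = {} \<Longrightarrow> \<mu> n (S \<union> T) = \<mu> n S + \<mu> n T"
    and nonneg: "\<And>n S. 0 \<le> \<mu> n S" and K: "\<And>n S. S \<in> \<C> \<Longrightarrow> \<mu> n S \<le> K"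
    and A: "\<And>n. A n \<in> \<C>" "\<And>n. c \<le> \<mu> n (A n)" and c: "c > 0"
    and small: "\<And>i n. i < n \<Longrightarrow> \<mu> i (A n) \<le> c / 4 * (1/2) ^ n"
  shows "\<exists>(m :: nat \<Rightarrow> nat) B. disjoint_family B \<and> (\<forall>k. B k \<in> \<C> \<and> c / 2 \<le> \<mu> (m k) (B k))"
proof -
  have empty: "{} \<in> \<C>" using diff[OF A(1)[of 0] A(1)[of 0]] by simp
  have UN: "(\<Union>i\<in>I. F i) \<in> \<C>" if "finite I" "\<And>i. i \<in> I \<Longrightarrow> F i \<in> \<C>" for I :: "nat set" and F
    using that by (induction I rule: finite_induct) (auto simp: empty un)
  have \<mu>0: "\<mu> n {} = 0" for n using add[OF empty empty, of n] by simp
  have mono: "\<mu> n S \<le> \<mu> n T" if "S \<in> \<C>" "T \<in> \<C>" "S \<subseteq> T" for n S T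
  proof -
    have "T = S \<union> (T - S)" using that by auto
    then have "\<mu> n T = \<mu> n S + \<mu> n (T - S)" using add[of S "T - S" n] that diff by auto
    then show ?thesis using nonneg[of n "T - S"] by simp
  qed
  have subadd: "\<mu> n (S \<union> T) \<le> \<mu> n S + \<mu> n T" if "S \<in> \<C>" "T \<in> \<C>" for n S T
  proof -
    have "\<mu> n (S \<union> T) = \<mu> n S + \<mu> n (T - S)" using add[of S "T - S" n] that diff by auto
    then show ?thesis using mono[of "T - S" T n] that diff by auto
  qed
  have sub_UN: "\<mu> n (\<Union>i\<in>I. F i) \<le> (\<Sum>i\<in>I. \<mu> n (F i))" if "finite I" "\<And>i. i \<in> I \<Longrightarrow> F i \<in> \<C>"
    for n and I :: "nat set" and F
    using that
  proof (induction I rule: finite_induct)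
    case (insert i I)
    then show ?case using subadd[of "F i" "\<Union>i\<in>I. F i" n] UN[of I F] by auto
  qed (simp add: \<mu>0)
  have add_UN: "\<mu> n (\<Union>i\<in>I. F i) = (\<Sum>i\<in>I. \<mu> n (F i))"
    if "finite I" "\<And>i. i \<in> I \<Longrightarrow> F i \<in> \<C>" "disjoint_family_on F I" for n and I :: "nat set" and F
    using that
  proof (induction I rule: finite_induct)
    case (insert i I)
    have "F i \<inter> (\<Union>j\<in>I. F j) = {}" using insert.hyps(2) insert.prems(2)
      by (auto simp: disjoint_family_on_def)
    moreover have "disjoint_family_on F I" using insert.prems(2)
      by (auto simp: disjoint_family_on_def)
    ultimately show ?case using insert add[of "F i" "\<Union>i\<in>I. F i" n] UN[of I F] by simp
  qed (simp add: \<mu>0)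

  define C where "C n N = A n - (\<Union>m\<in>{n<..N}. A m)" for n N
  have C: "C n N \<in> \<C>" for n N unfolding C_def by (intro diff A UN) auto
  have tail: "(\<Sum>m\<in>{n<..N}. c / 4 * (1/2) ^ m) \<le> c / 4 * (1/2) ^ n" for n N
  proof (cases "n \<le> N")
    case True
    have "(\<Sum>m\<in>{n<..N}. c / 4 * (1/2) ^ m) = c / 4 * (1/2) ^ n - c / 4 * (1/2) ^ N"
      using True
    proof (induction N rule: dec_induct)
      case (step N)
      have "{n<..Suc N} = insert (Suc N) {n<..N}" using step by auto
      then show ?case using step by simp
    qed simp
    then show ?thesis using c by simp
  qed (use c in simp)
  have mass: "3 * c / 4 \<le> \<mu> n (C n N)" for n N
  proof -
    have "\<mu> n (\<Union>m\<in>{n<..N}. A m) \<le> (\<Sum>m\<in>{n<..N}. \<mu> n (A m))" by (intro sub_UN A) auto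
    also have "\<dots> \<le> (\<Sum>m\<in>{n<..N}. c / 4 * (1/2) ^ m)" by (intro sum_mono small) auto
    also have "\<dots> \<le> c / 4 * (1/2) ^ n" by (rule tail)
    also have "\<dots> \<le> c / 4" using c by (simp add: power_le_one)
    finally have "\<mu> n (\<Union>m\<in>{n<..N}. A m) \<le> c / 4" .
    moreover have "\<mu> n (A n) \<le> \<mu> n (C n N \<union> (\<Union>m\<in>{n<..N}. A m))"
      by (intro mono un C A UN) (auto simp: C_def)
    moreover have "\<dots> \<le> \<mu> n (C n N) + \<mu> n (\<Union>m\<in>{n<..N}. A m)"
      by (intro subadd C A UN) auto
    ultimately show ?thesis using A(2)[of n] by linarith
  qed
  have select: "\<exists>n\<in>S. \<exists>N S'. S' \<subseteq> S \<and> infinite S' \<and> (\<forall>m\<in>S'. \<mu> m (C n N) < \<epsilon>)"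
    if S: "infinite S" and \<epsilon>: "\<epsilon> > 0" for S :: "nat set" and \<epsilon> :: real
  proof -
    obtain r :: nat where r: "K < r * \<epsilon>" using \<open>\<epsilon> > 0\<close> reals_Archimedean3 by blast
    obtain F where F: "F \<subseteq> S" "finite F" "card F = Suc r" using infinite_arbitrarily_large[OF S]
      by blast
    define N where "N = Max F"
    have disj: "disjoint_family_on (\<lambda>i. C i N) F"
    proof -
      have "C i N \<inter> C j N = {}" if "i \<in> F" "j \<in> F" "i < j" for i j
        using that Max_ge[OF F(2)] unfolding C_def N_def by auto
      then show ?thesis unfolding disjoint_family_on_def by (metis Int_commute linorder_neqE_nat)
    qed
    have "\<exists>i\<in>F. \<mu> m (C i N) < \<epsilon>" for m
    proof (rule ccontr)
      assume "\<not> ?thesis"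
      then have "\<epsilon> * card F \<le> (\<Sum>i\<in>F. \<mu> m (C i N))"
        using sum_mono[of F "\<lambda>_. \<epsilon>" "\<lambda>i. \<mu> m (C i N)"] by (simp add: not_less mult.commute)
      also have "\<dots> = \<mu> m (\<Union>i\<in>F. C i N)" by (rule add_UN[symmetric]) (use F C disj in auto)
      also have "\<dots> \<le> K" by (intro K UN F C)
      finally show False using r F(3) \<open>\<epsilon> > 0\<close> by (simp add: algebra_simps)
    qed
    then obtain h where h: "\<And>m. h m \<in> F" "\<And>m. \<mu> m (C (h m) N) < \<epsilon>" by metis
    have "finite (h ` S)" using F(2) h(1) by (meson finite_subset image_subsetI)
    then obtain m where "m \<in> S" "infinite {a \<in> S. h a = h m}" using pigeonhole_infinite[OF S]
      by blast
    then show ?thesis using h F(1)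
      by (intro bexI[of _ "h m"] exI[of _ N] exI[of _ "{a \<in> S. h a = h m}"]) (auto, metis)
  qed

  define P where "P k = (\<lambda>(n, N, S). infinite S \<and> (\<forall>m\<in>S. \<mu> m (C n N) < c / 4 * (1/2) ^ Suc k))"
    for k
  define Q where "Q = (\<lambda>(n :: nat, N :: nat, S) (n', N' :: nat, S'). n' \<in> S \<and> S' \<subseteq> (S :: nat set))"
  have "\<exists>x. \<forall>k. P k (x k) \<and> Q (x k) (x (Suc k))"
  proof (rule dependent_nat_choice)
    show "\<exists>x. P 0 x" using select[of UNIV "c / 4 * (1/2) ^ Suc 0"] c unfolding P_def by auto
    fix x k assume "P k x"
    then show "\<exists>y. P (Suc k) y \<and> Q x y"
      using select[of "snd (snd x)" "c / 4 * (1/2) ^ Suc (Suc k)"] c unfolding P_def Q_def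
        by (cases x) fastforce
  qed
  then obtain x where x: "\<And>k. P k (x k)" "\<And>k. Q (x k) (x (Suc k))" by blast
  define n where "n k = fst (x k)" for k
  define D where "D k = C (fst (x k)) (fst (snd (x k)))" for k
  define S where "S k = snd (snd (x k))" for k
  have S: "n (Suc k) \<in> S k" "S (Suc k) \<subseteq> S k" "\<And>m. m \<in> S k \<Longrightarrow> \<mu> m (D k) < c / 4 * (1/2) ^ Suc k"
    for k
    using x(1)[of k] x(2)[of k] by (auto simp: P_def Q_def n_def S_def D_def split: prod.splits)
  have "S k \<subseteq> S j" if "j \<le> k" for j k using lift_Suc_antimono_le[of S, OF S(2) that] .
  then have nS: "n k \<in> S j" if "j < k" for j k
    using that S(1)[of "k - 1"] by (cases k) (auto simp: less_Suc_eq_le)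
  define B where "B k = D k - (\<Union>j\<in>{..<k}. D j)" for k
  have DC: "D k \<in> \<C>" for k by (simp add: D_def C)
  have "c / 2 \<le> \<mu> (n k) (B k)" for k
  proof -
    have "\<mu> (n k) (\<Union>j\<in>{..<k}. D j) \<le> (\<Sum>j\<in>{..<k}. \<mu> (n k) (D j))" by (intro sub_UN DC) auto
    also have "\<dots> \<le> (\<Sum>j\<in>{..<k}. c / 4 * (1/2) ^ Suc j)" by (intro sum_mono less_imp_le S(3) nS) auto
    also have "\<dots> = c / 4 * (1 - (1/2) ^ k)" by (induction k) (auto simp: algebra_simps)
    also have "\<dots> \<le> c / 4" using c by simp
    finally have "\<mu> (n k) (\<Union>j\<in>{..<k}. D j) \<le> c / 4" .
    moreover have "\<mu> (n k) (D k) \<le> \<mu> (n k) (B k \<union> (\<Union>j\<in>{..<k}. D j))"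
      unfolding B_def by (intro mono un DC diff UN) auto
    moreover have "\<dots> \<le> \<mu> (n k) (B k) + \<mu> (n k) (\<Union>j\<in>{..<k}. D j)"
      unfolding B_def by (intro subadd DC diff UN) auto
    moreover have "3 * c / 4 \<le> \<mu> (n k) (D k)" unfolding n_def D_def by (rule mass)
    ultimately show ?thesis by linarith
  qed
  moreover have "disjoint_family B"
  proof -
    have "B i \<inter> B j = {}" if "i < j" for i j using that by (auto simp: B_def)
    then show ?thesis unfolding disjoint_family_on_def by (metis Int_commute linorder_neqE_nat)
  qed
  moreover have "B k \<in> \<C>" for k unfolding B_def by (intro diff DC UN) auto
  ultimately show ?thesis by blast
qed

text \<open>
  Rosenthal's disjointness lemma. Partition the indices into infinitely many infinite pieces. If
  no piece has the required property, then each contains an index \<open>n\<close> such that \<open>\<rho> n\<close> is at least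
  \<open>\<epsilon>\<close> on the rest of the piece. The set of these indices meets every piece in one point only, so
  the masses of this set are smaller by \<open>\<epsilon>\<close> than those of the whole. This can be repeated at most
  \<open>K / \<epsilon>\<close> times.
\<close>

lemma Rosenthal:
  fixes \<rho> :: "nat \<Rightarrow> nat set \<Rightarrow> real"
  assumes mono: "\<And>n S T. S \<subseteq> T \<Longrightarrow> \<rho> n S \<le> \<rho> n T"
    and superadd: "\<And>n S T. S \<inter> T = {} \<Longrightarrow> \<rho> n S + \<rho> n T \<le> \<rho> n (S \<union> T)"
    and K: "\<And>n. \<rho> n UNIV \<le> K" and \<epsilon>: "\<epsilon> > 0"
  shows "\<exists>M. infinite M \<and> (\<forall>n\<in>M. \<rho> n (M - {n}) < \<epsilon>)"
proof -
  have claim: "\<exists>M. infinite M \<and> (\<forall>n\<in>M. \<rho> n (M - {n}) < \<epsilon>)"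
    if "infinite S" "\<And>n. n \<in> S \<Longrightarrow> \<rho> n S \<le> real j * \<epsilon>" for S and j :: nat
    using that
  proof (induction j arbitrary: S)
    case 0
    then have "\<rho> n (S - {n}) < \<epsilon>" if "n \<in> S" for n
      using mono[of "S - {n}" S n] "0.prems"(2)[OF that] \<epsilon> by auto
    then show ?case using 0 by blast
  next
    case (Suc j)
    define M where "M p = (\<lambda>k. enumerate S (prod_encode (p, k))) ` UNIV" for p
    have inj: "inj (enumerate S)" using strict_mono_enumerate[OF Suc.prems(1)]
      strict_mono_imp_inj_on by blast
    have sub: "M p \<subseteq> S" for p using enumerate_in_set[OF Suc.prems(1)] by (auto simp: M_def)
    have inf: "infinite (M p)" for p
      unfolding M_def by (intro range_inj_infinite injI) (auto dest!: injD[OF inj])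
    have disj: "p = q" if "x \<in> M p" "x \<in> M q" for p q x
      using that inj by (auto simp: M_def dest!: injD)
    show ?case
    proof (cases "\<exists>p. \<forall>n\<in>M p. \<rho> n (M p - {n}) < \<epsilon>")
      case True
      then show ?thesis using inf by blast
    next
      case False
      then obtain n where n: "\<And>p. n p \<in> M p" "\<And>p. \<epsilon> \<le> \<rho> (n p) (M p - {n p})" by (metis not_less)
      have "inj n" using n(1) disj by (metis injI)
      then have "infinite (range n)" by (rule range_inj_infinite)
      moreover have "\<rho> m (range n) \<le> real j * \<epsilon>" if m: "m \<in> range n" for m
      proof -
        obtain p where p: "m = n p" using m by blast
        have "range n \<inter> (M p - {n p}) = {}" using n(1) disj by blast
        then have "\<rho> m (range n) + \<rho> m (M p - {n p}) \<le> \<rho> m (range n \<union> (M p - {n p}))"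
          by (rule superadd)
        also have "\<dots> \<le> \<rho> m S" using n(1) sub by (intro mono) blast
        also have "\<dots> \<le> real (Suc j) * \<epsilon>" using n(1) sub p by (intro Suc.prems) blast
        finally show ?thesis using n(2)[of p] p by (simp add: algebra_simps)
      qed
      ultimately show ?thesis using Suc.IH by blast
    qed
  qed
  obtain j :: nat where "K < real j * \<epsilon>" using \<epsilon> reals_Archimedean3 by blast
  then show ?thesis using claim[of UNIV j] K by (meson infinite_UNIV_nat less_imp_le order_trans)
qed

section \<open>The weak topology and the ideal of weakly compact operators\<close>

lemma topspace_weak_topology [simp]:
  fixes s :: "'k::real_normed_field \<Rightarrow> 'e \<Rightarrow> 'e::real_normed_vector"
  shows "topspace (weak_topology s) = UNIV"
proof -
  have "UNIV \<in> {blinfun_apply \<phi> -` U | (\<phi> :: 'e \<Rightarrow>\<^sub>L 'k) U. (\<forall>c x. \<phi> (s c x) = c * \<phi> x) \<and> open U}"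
    by (intro CollectI exI[of _ 0] exI[of _ UNIV]) simp
  then show ?thesis
    unfolding weak_topology_def topology_generated_by_topspace by blast
qed

lemma continuous_map_weak_functional:
  fixes \<phi> :: "'e::real_normed_vector \<Rightarrow>\<^sub>L 'k::real_normed_field"
  assumes "\<And>c x. \<phi> (s c x) = c * \<phi> x"
  shows "continuous_map (weak_topology s) euclidean \<phi>"
proof -
  have "openin (weak_topology s) (blinfun_apply \<phi> -` U)" if "open U" for U
    unfolding weak_topology_def by (rule topology_generated_by_Basis) (use assms that in blast)
  then show ?thesis by (simp add: continuous_map vimage_def)
qed

lemma continuous_map_into_weak_topology:
  fixes s :: "'k::real_normed_field \<Rightarrow> 'e \<Rightarrow> 'e::real_normed_vector"
  assumes "\<And>\<phi> :: 'e \<Rightarrow>\<^sub>L 'k. (\<And>c x. \<phi> (s c x) = c * \<phi> x) \<Longrightarrow> continuous_map X euclidean (\<lambda>x. \<phi> (f x))"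
  shows "continuous_map X (weak_topology s) f"
  unfolding weak_topology_def
proof (rule continuous_on_generated_topo)
  fix U assume "U \<in> {blinfun_apply \<phi> -` U | (\<phi> :: 'e \<Rightarrow>\<^sub>L 'k) U. (\<forall>c x. \<phi> (s c x) = c * \<phi> x) \<and>
    open U}"
  then obtain \<phi> :: "'e \<Rightarrow>\<^sub>L 'k" and V where U: "U = blinfun_apply \<phi> -` V"
    "\<And>c x. \<phi> (s c x) = c * \<phi> x" "open V" by blast
  then have "openin X {x \<in> topspace X. \<phi> (f x) \<in> V}"
    using assms[OF U(2)] by (simp add: continuous_map)
  moreover have "f -` U \<inter> topspace X = {x \<in> topspace X. \<phi> (f x) \<in> V}" using U by auto
  ultimately show "openin X (f -` U \<inter> topspace X)" by simp
next
  show "f ` topspace X \<subseteq> \<Union> {blinfun_apply \<phi> -` U | (\<phi> :: 'e \<Rightarrow>\<^sub>L 'k) U. (\<forall>c x. \<phi> (s c x) =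
    c * \<phi> x) \<and> open U}"
    using topspace_weak_topology[of s] unfolding weak_topology_def topology_generated_by_topspace
      by simp
qed

definition eval_at :: "'a \<Rightarrow> ('a::topological_space \<Rightarrow>\<^sub>C 'k::real_normed_vector) \<Rightarrow>\<^sub>L 'k"
  where "eval_at x = Blinfun (\<lambda>f. apply_bcontfun f x)"

lemma eval_at [simp]: "blinfun_apply (eval_at x) f = apply_bcontfun f x"
  unfolding eval_at_def
  by (subst bounded_linear_Blinfun_apply, rule bounded_linear_intro[where K=1])
    (simp_all add: norm_bounded)

lemma continuous_map_weak_eval:
  "continuous_map (weak_topology (cscale :: 'k::real_normed_field \<Rightarrow> ('a::topological_space \<Rightarrow>\<^sub>C 'k)
    \<Rightarrow> _)) euclidean
    (\<lambda>f. apply_bcontfun f x)"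
proof -
  have "blinfun_apply (eval_at x) = (\<lambda>f :: 'a \<Rightarrow>\<^sub>C 'k. apply_bcontfun f x)" by (rule ext) simp
  then show ?thesis using continuous_map_weak_functional[of
    "eval_at x :: ('a \<Rightarrow>\<^sub>C 'k) \<Rightarrow>\<^sub>L 'k" cscale] by simp
qed

lemma Hausdorff_weak_topology:
  "Hausdorff_space (weak_topology (cscale :: 'k::real_normed_field \<Rightarrow>
    ('a::topological_space \<Rightarrow>\<^sub>C 'k) \<Rightarrow> _))"
  unfolding Hausdorff_space_def
proof (intro allI impI)
  fix f g :: "'a \<Rightarrow>\<^sub>C 'k"
  assume "f \<in> topspace (weak_topology cscale) \<and> g \<in> topspace (weak_topology cscale) \<and> f \<noteq> g"
  then obtain x where "apply_bcontfun f x \<noteq> apply_bcontfun g x" using bcontfun_eqI by blast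
  then obtain U V where UV: "open U" "open V" "apply_bcontfun f x \<in> U" "apply_bcontfun g x \<in> V"
    "U \<inter> V = {}" by (meson hausdorff)
  have "openin (weak_topology cscale) {h :: 'a \<Rightarrow>\<^sub>C 'k. apply_bcontfun h x \<in> U}"
    "openin (weak_topology cscale) {h :: 'a \<Rightarrow>\<^sub>C 'k. apply_bcontfun h x \<in> V}"
    using continuous_map_weak_eval[where x=x and 'k='k] UV by (simp_all add: continuous_map)
  then show "\<exists>U V. openin (weak_topology cscale) U \<and> openin (weak_topology cscale) V \<and> f \<in> U \<and>
    g \<in> V \<and> disjnt U V"
    using UV by (intro exI[of _ "{h. apply_bcontfun h x \<in> U}"]
      exI[of _ "{h. apply_bcontfun h x \<in> V}"]) (auto simp: disjnt_def)
qed

text \<open>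
  The closure in the definition of weakly compact operators can be forgotten because the weak
  topology is separated, even by evaluations at points.
\<close>

lemma weakly_compact_opsI:
  fixes T :: "('a::topological_space \<Rightarrow>\<^sub>C 'k::real_normed_field) \<Rightarrow>\<^sub>L ('a \<Rightarrow>\<^sub>C 'k)"
  assumes T: "T \<in> bounded_ops cscale" and K: "compactin (weak_topology cscale) K"
    "blinfun_apply T ` cball 0 1 \<subseteq> K"
  shows "T \<in> weakly_compact_ops cscale"
proof -
  have "closedin (weak_topology cscale) K"
    using K(1) Hausdorff_weak_topology compactin_imp_closedin by blast
  then have "weak_topology cscale closure_of (blinfun_apply T ` cball 0 1) \<subseteq> K"
    by (intro closure_of_minimal K)
  then have "compactin (weak_topology cscale)
    (weak_topology cscale closure_of (blinfun_apply T ` cball 0 1))"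
    using closed_compactin[OF K(1)] closedin_closure_of by blast
  then show ?thesis using T by (simp add: weakly_compact_ops_def)
qed

lemma weakly_compact_opsE:
  fixes T :: "('a::topological_space \<Rightarrow>\<^sub>C 'k::real_normed_field) \<Rightarrow>\<^sub>L ('a \<Rightarrow>\<^sub>C 'k)"
  assumes "T \<in> weakly_compact_ops cscale"
  obtains K where "T \<in> bounded_ops cscale" "compactin (weak_topology cscale) K"
    "blinfun_apply T ` cball 0 1 \<subseteq> K"
  using assms closure_of_subset[of "blinfun_apply T ` cball 0 1" "weak_topology cscale"]
  by (auto simp: weakly_compact_ops_def)

lemma continuous_map_weak_bounded_op:
  fixes T :: "('a::topological_space \<Rightarrow>\<^sub>C 'k::real_normed_field) \<Rightarrow>\<^sub>L ('a \<Rightarrow>\<^sub>C 'k)"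
  assumes "T \<in> bounded_ops cscale"
  shows "continuous_map (weak_topology cscale) (weak_topology cscale) T"
proof (rule continuous_map_into_weak_topology)
  fix \<phi> :: "('a \<Rightarrow>\<^sub>C 'k) \<Rightarrow>\<^sub>L 'k" assume "\<And>c x. \<phi> (cscale c x) = c * \<phi> x"
  then have "continuous_map (weak_topology cscale) euclidean (blinfun_apply (\<phi> o\<^sub>L T))"
    using assms by (intro continuous_map_weak_functional) (simp add: bounded_ops_def)
  moreover have "blinfun_apply (\<phi> o\<^sub>L T) = (\<lambda>x. \<phi> (T x))" by (rule ext) simp
  ultimately show "continuous_map (weak_topology cscale) euclidean (\<lambda>x. \<phi> (T x))" by simp
qed

lemma bounded_ops_compose:
  fixes S T :: "('a::topological_space \<Rightarrow>\<^sub>C 'k::real_normed_field) \<Rightarrow>\<^sub>L ('a \<Rightarrow>\<^sub>C 'k)"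
  shows "S \<in> bounded_ops cscale \<Longrightarrow> T \<in> bounded_ops cscale \<Longrightarrow> S o\<^sub>L T \<in> bounded_ops cscale"
  by (simp add: bounded_ops_def)

lemma cscale_commute: "cscale c (cscale d f) = cscale d (cscale c f)"
  by (rule bcontfun_eqI) simp

lemma cscale_add: "cscale c (f + g) = cscale c f + cscale c g"
  by (rule bcontfun_eqI) (simp add: distrib_left)

lemma bounded_ops_add:
  fixes S T :: "('a::topological_space \<Rightarrow>\<^sub>C 'k::real_normed_field) \<Rightarrow>\<^sub>L ('a \<Rightarrow>\<^sub>C 'k)"
  shows "S \<in> bounded_ops cscale \<Longrightarrow> T \<in> bounded_ops cscale \<Longrightarrow> S + T \<in> bounded_ops cscale"
  by (simp add: bounded_ops_def blinfun.add_left cscale_add)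

lemma bounded_ops_op_scale: "T \<in> bounded_ops cscale \<Longrightarrow> op_scale cscale c T \<in> bounded_ops cscale"
  by (simp add: bounded_ops_def op_scale_cscale_apply cscale_commute)

lemma op_scale_compose: "op_scale cscale c T = op_scale cscale c id_blinfun o\<^sub>L T"
  by (rule blinfun_eqI) (simp add: op_scale_cscale_apply)

lemma id_bounded_ops: "id_blinfun \<in> bounded_ops cscale"
  by (simp add: bounded_ops_def)

context
  fixes W :: "('a::topological_space \<Rightarrow>\<^sub>C 'k::real_normed_field) \<Rightarrow>\<^sub>L ('a \<Rightarrow>\<^sub>C 'k)"
  assumes W: "W \<in> weakly_compact_ops cscale"
begin

lemma weakly_compact_compose_left:
  assumes "S \<in> bounded_ops cscale"
  shows "S o\<^sub>L W \<in> weakly_compact_ops cscale"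
proof -
  obtain K where K: "W \<in> bounded_ops cscale" "compactin (weak_topology cscale) K"
    "blinfun_apply W ` cball 0 1 \<subseteq> K"
    using W by (rule weakly_compact_opsE)
  show ?thesis
  proof (rule weakly_compact_opsI)
    show "compactin (weak_topology cscale) (blinfun_apply S ` K)"
      using image_compactin[OF K(2) continuous_map_weak_bounded_op[OF assms]] .
  qed (use assms K in \<open>auto intro: bounded_ops_compose\<close>)
qed

lemma weakly_compact_op_scale: "op_scale cscale c W \<in> weakly_compact_ops cscale"
  unfolding op_scale_compose[of c W] by (intro weakly_compact_compose_left bounded_ops_op_scale
    id_bounded_ops)

lemma weakly_compact_compose_right:
  assumes "S \<in> bounded_ops cscale"
  shows "W o\<^sub>L S \<in> weakly_compact_ops cscale"
proof -
  define r where "r = norm S + 1"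
  have r: "r > 0" by (simp add: r_def add_nonneg_pos)
  obtain K where K: "op_scale cscale (of_real r) W \<in> bounded_ops cscale"
    "compactin (weak_topology cscale) K"
      "blinfun_apply (op_scale cscale (of_real r) W) ` cball 0 1 \<subseteq> K"
    using weakly_compact_op_scale by (rule weakly_compact_opsE)
  have "W (S f) \<in> K" if "norm f \<le> 1" for f
  proof -
    have "norm (S f) \<le> norm S * 1"
      using norm_blinfun[of S f] that mult_left_mono[OF that norm_ge_zero[of S]] by linarith
    then have "norm (S f) \<le> r" by (simp add: r_def)
    then have "(1/r) *\<^sub>R S f \<in> cball 0 1" using r by (simp add: field_simps)
    moreover have "op_scale cscale (of_real r) W ((1/r) *\<^sub>R S f) = W (S f)"
      using r by (simp add: op_scale_cscale_apply cscale_of_real blinfun.scaleR_right)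
    ultimately show ?thesis using K(3) by (metis image_subset_iff)
  qed
  then show ?thesis
    using assms W by (intro weakly_compact_opsI[OF _ K(2)])
      (auto intro: bounded_ops_compose simp: weakly_compact_ops_def)
qed

end

lemma weakly_compact_add:
  fixes V W :: "('a::topological_space \<Rightarrow>\<^sub>C 'k::real_normed_field) \<Rightarrow>\<^sub>L ('a \<Rightarrow>\<^sub>C 'k)"
  assumes "V \<in> weakly_compact_ops cscale" "W \<in> weakly_compact_ops cscale"
  shows "V + W \<in> weakly_compact_ops cscale"
proof -
  obtain K where K: "V \<in> bounded_ops cscale" "compactin (weak_topology cscale) K"
    "blinfun_apply V ` cball 0 1 \<subseteq> K"
    using assms(1) by (rule weakly_compact_opsE)
  obtain H where H: "W \<in> bounded_ops cscale" "compactin (weak_topology cscale) H"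
    "blinfun_apply W ` cball 0 1 \<subseteq> H"
    using assms(2) by (rule weakly_compact_opsE)
  let ?X = "weak_topology (cscale :: 'k \<Rightarrow> ('a \<Rightarrow>\<^sub>C 'k) \<Rightarrow> _)"
  have "continuous_map (prod_topology ?X ?X) ?X (\<lambda>z. fst z + snd z)"
  proof (rule continuous_map_into_weak_topology)
    fix \<phi> :: "('a \<Rightarrow>\<^sub>C 'k) \<Rightarrow>\<^sub>L 'k" assume "\<And>c x. \<phi> (cscale c x) = c * \<phi> x"
    then have "continuous_map ?X euclidean \<phi>" by (rule continuous_map_weak_functional)
    then show "continuous_map (prod_topology ?X ?X) euclidean (\<lambda>z. \<phi> (fst z + snd z))"
      unfolding blinfun.add_right
      by (intro continuous_map_add continuous_map_compose[OF continuous_map_fst, unfolded o_def]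
        continuous_map_compose[OF continuous_map_snd, unfolded o_def])
  qed
  then have "compactin ?X ((\<lambda>z. fst z + snd z) ` (K \<times> H))"
    by (intro image_compactin) (use K H in \<open>auto simp: compactin_Times\<close>)
  moreover have "blinfun_apply (V + W) ` cball 0 1 \<subseteq> (\<lambda>z. fst z + snd z) ` (K \<times> H)"
    using K(3) H(3) by (force simp: blinfun.add_left)
  ultimately show ?thesis using K(1) H(1) by (intro weakly_compact_opsI bounded_ops_add)
qed

lemma zero_weakly_compact: "(0 :: ('a::topological_space \<Rightarrow>\<^sub>C 'k::real_normed_field) \<Rightarrow>\<^sub>L
  ('a \<Rightarrow>\<^sub>C 'k)) \<in> weakly_compact_ops cscale"
proof (rule weakly_compact_opsI)
  show "(0 :: ('a \<Rightarrow>\<^sub>C 'k) \<Rightarrow>\<^sub>L ('a \<Rightarrow>\<^sub>C 'k)) \<in> bounded_ops cscale"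
    unfolding bounded_ops_def by (auto intro!: bcontfun_eqI)
  show "compactin (weak_topology cscale) {0 :: 'a \<Rightarrow>\<^sub>C 'k}" by simp
qed auto

section \<open>Operators dominated by a Hilbertian seminorm\<close>

text \<open>
  Real-linear half-spaces are a subbase of a topology that is finer than the weak one, so by
  Alexander's subbase theorem the finite intersection property has to be checked only for families
  of closed half-spaces. Unlike general weakly closed sets, these are convex.
\<close>

lemma compactin_weak_topology_halfspaces:
  fixes s :: "'k::{real_normed_field,euclidean_space} \<Rightarrow> 'e \<Rightarrow> 'e::real_normed_vector"
  assumes FIP: "\<And>\<H> :: (('e \<Rightarrow> real) \<times> real) set. (\<And>z. z \<in> \<H> \<Longrightarrow> bounded_linear (fst z)) \<Longrightarrow>
      (\<And>\<F>. finite \<F> \<Longrightarrow> \<F> \<subseteq> \<H> \<Longrightarrow> \<exists>x\<in>K. \<forall>z\<in>\<F>. snd z \<le> fst z x) \<Longrightarrow>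
      \<exists>x\<in>K. \<forall>z\<in>\<H>. snd z \<le> fst z x"
  shows "compactin (weak_topology s) K"
proof -
  define half where "half z = {x. fst z x < snd z}" for z :: "('e \<Rightarrow> real) \<times> real"
  define \<B> where "\<B> = half ` {z. bounded_linear (fst z)}"
  define X where "X = topology (arbitrary union_of
    (finite intersection_of (\<lambda>x. x \<in> \<B>) relative_to K))"
  have topX: "topspace X = K" unfolding X_def topspace_subbase by simp
  have openX: "openin X {x \<in> K. \<psi> x < r}" if "bounded_linear \<psi>" for \<psi> :: "'e \<Rightarrow> real" and r
  proof -
    have "half (\<psi>, r) \<in> \<B>" unfolding \<B>_def using that by (intro imageI) simp
    then have "(finite intersection_of (\<lambda>x. x \<in> \<B>) relative_to K) (K \<inter> half (\<psi>, r))"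
      by (intro relative_to_inc finite_intersection_of_inc)
    then have "openin X (K \<inter> half (\<psi>, r))"
      unfolding X_def openin_subbase by (rule arbitrary_union_of_inc)
    moreover have "K \<inter> half (\<psi>, r) = {x \<in> K. \<psi> x < r}" by (auto simp: half_def)
    ultimately show ?thesis by simp
  qed
  have "compact_space X"
  proof (rule Alexander_subbase_alt[where \<B> = \<B> and U = K])
    have "half (\<lambda>_. 0, 1) \<in> \<B>" unfolding \<B>_def by (intro imageI) simp
    then show "K \<subseteq> \<Union>\<B>" by (auto simp: half_def)
    fix \<C> assume \<C>: "\<C> \<subseteq> \<B>" "K \<subseteq> \<Union>\<C>"
    define \<H> where "\<H> = {z. bounded_linear (fst z) \<and> half z \<in> \<C>}"
    have "\<exists>\<F>. finite \<F> \<and> \<F> \<subseteq> \<H> \<and> \<not> (\<exists>x\<in>K. \<forall>z\<in>\<F>. snd z \<le> fst z x)"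
    proof (rule ccontr)
      assume neg: "\<not> ?thesis"
      have "\<exists>x\<in>K. \<forall>z\<in>\<H>. snd z \<le> fst z x"
      proof (rule FIP)
        show "bounded_linear (fst z)" if "z \<in> \<H>" for z using that by (simp add: \<H>_def)
        show "\<exists>x\<in>K. \<forall>z\<in>\<F>. snd z \<le> fst z x" if "finite \<F>" "\<F> \<subseteq> \<H>" for \<F> using neg that by blast
      qed
      then obtain x where x: "x \<in> K" "\<And>z. z \<in> \<H> \<Longrightarrow> snd z \<le> fst z x" by blast
      obtain B where B: "B \<in> \<C>" "x \<in> B" using \<C>(2) x(1) by blast
      obtain z where z: "bounded_linear (fst z)" "B = half z" using B(1) \<C>(1) unfolding \<B>_def
        by blast
      then have "z \<in> \<H>" using B(1) by (simp add: \<H>_def)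
      then show False using x(2)[of z] B(2) z(2) by (simp add: half_def)
    qed
    then obtain \<F> where \<F>: "finite \<F>" "\<F> \<subseteq> \<H>" "\<not> (\<exists>x\<in>K. \<forall>z\<in>\<F>. snd z \<le> fst z x)" by (elim exE conjE)
    have "K \<subseteq> \<Union> (half ` \<F>)"
    proof
      fix x assume "x \<in> K"
      then have "\<exists>z\<in>\<F>. \<not> snd z \<le> fst z x" using \<F>(3) by blast
      then show "x \<in> \<Union> (half ` \<F>)" by (simp add: half_def not_le)
    qed
    then show "\<exists>\<C>'. finite \<C>' \<and> \<C>' \<subseteq> \<C> \<and> K \<subseteq> \<Union>\<C>'"
      using \<F>(1,2) by (intro exI[of _ "half ` \<F>"]) (auto simp: \<H>_def)
  qed (simp add: X_def)
  then have "compactin X K" using topX by (simp add: compact_space_def)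
  moreover have "continuous_map X (weak_topology s) (\<lambda>x. x)"
  proof (rule continuous_map_into_weak_topology)
    fix \<phi> :: "'e \<Rightarrow>\<^sub>L 'k"
    have "continuous_map X euclidean (\<lambda>x. \<phi> x \<bullet> b)" for b
    proof -
      have bl: "bounded_linear (\<lambda>x. \<phi> x \<bullet> b)" "bounded_linear (\<lambda>x. - (\<phi> x \<bullet> b))"
        by (intro bounded_linear_minus bounded_linear_intros)+
      have "openin X {x \<in> K. \<phi> x \<bullet> b < r}" "openin X {x \<in> K. r < \<phi> x \<bullet> b}" for r
        using openX[OF bl(1), of r] openX[OF bl(2), of "- r"] by simp_all
      then show ?thesis by (simp add: continuous_map_upper_lower_semicontinuous_lt topX)
    qed
    then have "continuous_map X euclidean (\<lambda>x. (\<phi> x \<bullet> b) *\<^sub>R b)" for b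
      by (intro continuous_map_compose[of X euclidean "\<lambda>x. \<phi> x \<bullet> b" euclidean
        "\<lambda>t. t *\<^sub>R b", unfolded o_def])
        (auto intro!: continuous_intros)
    then have "continuous_map X euclidean (\<lambda>x. \<Sum>b\<in>Basis. (\<phi> x \<bullet> b) *\<^sub>R b)"
      by (intro continuous_map_sum) auto
    then show "continuous_map X euclidean (\<lambda>x. \<phi> x)" by (simp add: euclidean_representation)
  qed
  ultimately show ?thesis using image_compactin[of X K "weak_topology s" "\<lambda>x. x"] by simp
qed

text \<open>
  Think of \<open>q\<close> as the square of a Hilbert space seminorm. Given closed half-spaces whose finite
  intersections meet the closure of the image of the unit ball, one looks for a common point. For
  a finite set \<open>F\<close> of slightly enlarged half-spaces, the vectors in the unit ball that \<open>W\<close> maps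
  into all of them form a nonempty convex set \<open>C F\<close>. The infimum \<open>d F\<close> of \<open>q\<close> on \<open>C F\<close> increases
  with \<open>F\<close>; let \<open>D\<close> be its supremum. By the parallelogram law, two near-minimal vectors of subsets
  of one set \<open>C F\<close> with \<open>d F\<close> close to \<open>D\<close> are close to each other. So the images of near-minimal
  vectors for increasing \<open>F\<close> form a Cauchy sequence, and the limit of the sequence does not change
  if a single half-space is added to all \<open>F\<close>. Hence the limit lies in every half-space.
\<close>

lemma Hilbertian_compact:
  fixes W :: "'e::real_normed_vector \<Rightarrow>\<^sub>L 'f::real_normed_vector" and q :: "'e \<Rightarrow> real"
    and s :: "'k::{real_normed_field,euclidean_space} \<Rightarrow> 'f \<Rightarrow> 'f"
  assumes complete: "\<And>X :: nat \<Rightarrow> 'f. Cauchy X \<Longrightarrow> \<exists>h. X \<longlonglongrightarrow> h"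
    and parallelogram: "\<And>f g. q ((1/2) *\<^sub>R (f + g)) + q ((1/2) *\<^sub>R (f - g)) = (q f + q g) / 2"
    and nonneg: "\<And>f. 0 \<le> q f" and bound: "\<And>f. norm f \<le> 1 \<Longrightarrow> q f \<le> R"
    and cont: "\<And>e. e > 0 \<Longrightarrow> \<exists>d>0. \<forall>f. q f < d \<longrightarrow> norm (W f) < e"
  shows "compactin (weak_topology s) (closure (blinfun_apply W ` cball 0 1))"
proof (rule compactin_weak_topology_halfspaces)
  fix \<H> :: "(('f \<Rightarrow> real) \<times> real) set"
  assume bl: "\<And>z. z \<in> \<H> \<Longrightarrow> bounded_linear (fst z)"
    and FIP: "\<And>\<F>. finite \<F> \<Longrightarrow> \<F> \<subseteq> \<H> \<Longrightarrow> \<exists>x\<in>closure (blinfun_apply W ` cball 0 1). \<forall>z\<in>\<F>. snd z \<le>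
      fst z x"
  define \<H>' where "\<H>' = {z. \<exists>r>snd z. (fst z, r) \<in> \<H>}"
  define C where "C F = {f \<in> cball 0 1. \<forall>z\<in>F. snd z \<le> fst z (W f)}"
    for F :: "(('f \<Rightarrow> real) \<times> real) set"
  have C_anti: "C B \<subseteq> C A" if "A \<subseteq> B" for A B using that unfolding C_def by blast
  define fin where "fin F \<longleftrightarrow> finite F \<and> F \<subseteq> \<H>'" for F
  have bl': "bounded_linear (fst z)" if z: "z \<in> \<H>'" for z
  proof -
    obtain r where "(fst z, r) \<in> \<H>" using z by (auto simp: \<H>'_def)
    from bl[OF this] show ?thesis by simp
  qed
  have nonempty: "C F \<noteq> {}" if "fin F" for F
  proof -
    have "\<forall>z\<in>F. \<exists>r>snd z. (fst z, r) \<in> \<H>" using that by (auto simp: fin_def \<H>'_def)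
    then obtain r where r: "\<And>z. z \<in> F \<Longrightarrow> snd z < r z" "\<And>z. z \<in> F \<Longrightarrow> (fst z, r z) \<in> \<H>" by metis
    have "\<exists>x\<in>closure (blinfun_apply W ` cball 0 1). \<forall>z\<in>(\<lambda>z. (fst z, r z)) ` F. snd z \<le> fst z x"
    proof (rule FIP)
      show "finite ((\<lambda>z. (fst z, r z)) ` F)" using that by (simp add: fin_def)
      show "(\<lambda>z. (fst z, r z)) ` F \<subseteq> \<H>" using r(2) by blast
    qed
    then obtain x where x: "x \<in> closure (blinfun_apply W ` cball 0 1)" "\<And>z. z \<in> F \<Longrightarrow> r z \<le> fst z x"
      by auto
    have opn: "open (\<Inter>z\<in>F. {y. snd z < fst z y})"
    proof (intro open_INT ballI)
      fix z assume "z \<in> F"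
      then have "z \<in> \<H>'" using that by (auto simp: fin_def)
      then have "continuous_on UNIV (fst z)" using bl' linear_continuous_on by blast
      then show "open {y. snd z < fst z y}" by (intro open_Collect_less continuous_intros)
    qed (use that in \<open>simp add: fin_def\<close>)
    have "x \<in> (\<Inter>z\<in>F. {y. snd z < fst z y})" using x(2) r(1) by fastforce
    then have "(\<Inter>z\<in>F. {y. snd z < fst z y}) \<inter> closure (blinfun_apply W ` cball 0 1) \<noteq> {}"
      using x(1) by blast
    then have "(\<Inter>z\<in>F. {y. snd z < fst z y}) \<inter> blinfun_apply W ` cball 0 1 \<noteq> {}"
      using open_Int_closure_eq_empty[OF opn] by blast
    then obtain f where "f \<in> cball 0 1" "\<And>z. z \<in> F \<Longrightarrow> snd z < fst z (W f)" by blast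
    then have "f \<in> C F" by (simp add: C_def less_imp_le)
    then show ?thesis by blast
  qed
  define d where "d F = Inf (q ` C F)" for F
  have bdd: "bdd_below (q ` C F)" for F using nonneg by (intro bdd_belowI2) auto
  have d_le: "d F \<le> q f" if "f \<in> C F" for F f unfolding d_def using bdd that
    by (intro cInf_lower) auto
  have d_R: "d F \<le> R" if F: "fin F" for F
  proof -
    obtain f where f: "f \<in> C F" using nonempty[OF F] by blast
    then have "q f \<le> R" by (intro bound) (simp add: C_def)
    then show ?thesis using d_le[OF f] by simp
  qed
  define D where "D = (SUP F\<in>Collect fin. d F)"
  have bddD: "bdd_above (d ` Collect fin)" using d_R by (intro bdd_aboveI2) auto
  have fin0: "fin {}" by (simp add: fin_def)
  have dD: "d F \<le> D" if "fin F" for F unfolding D_def using bddD that by (intro cSUP_upper) auto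
  define \<epsilon> :: "nat \<Rightarrow> real" where "\<epsilon> n = 1 / (real n + 1)" for n
  have \<epsilon>: "\<epsilon> n > 0" for n by (simp add: \<epsilon>_def)
  have \<epsilon>0: "\<epsilon> \<longlonglongrightarrow> 0" unfolding \<epsilon>_def using LIMSEQ_inverse_real_of_nat
    by (simp add: inverse_eq_divide add.commute)
  have "\<exists>F. fin F \<and> D - \<epsilon> n < d F" for n
  proof -
    have "D - \<epsilon> n < (SUP F\<in>Collect fin. d F)" using \<epsilon>[of n] by (simp add: D_def)
    then show ?thesis using less_cSUP_iff[of "Collect fin" d "D - \<epsilon> n"] bddD fin0 by auto
  qed
  then obtain F where F: "\<And>n. fin (F n)" "\<And>n. D - \<epsilon> n < d (F n)" by metis
  define G where "G n = (\<Union>i\<le>n. F i)" for n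
  have G: "fin (G n)" for n using F(1) by (auto simp: G_def fin_def)
  have FG: "F n \<subseteq> G m" if "n \<le> m" for n m using that by (auto simp: G_def)
  have "\<exists>f. f \<in> C E \<and> q f < D + \<epsilon> n" if "fin E" for E n
  proof -
    have "Inf (q ` C E) < D + \<epsilon> n" using dD[OF that] \<epsilon>[of n] by (simp add: d_def)
    then show ?thesis using cInf_less_iff[OF _ bdd, of E "D + \<epsilon> n"] nonempty[OF that] by auto
  qed
  then obtain pick where pick: "\<And>E n. fin E \<Longrightarrow> pick E n \<in> C E"
    "\<And>E n. fin E \<Longrightarrow> q (pick E n) < D + \<epsilon> n" by metis
  have \<epsilon>_mono: "\<epsilon> m \<le> \<epsilon> n" if "n \<le> m" for n m using that by (simp add: \<epsilon>_def frac_le)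
  have close: "q ((1/2) *\<^sub>R (pick E i - pick E' j)) \<le> 2 * \<epsilon> n"
    if "fin E" "fin E'" "F n \<subseteq> E" "F n \<subseteq> E'" "n \<le> i" "n \<le> j" for E E' n i j
  proof -
    define f where "f = pick E i"
    define g where "g = pick E' j"
    have f: "f \<in> C (F n)" and g: "g \<in> C (F n)"
      using pick(1)[OF that(1)] pick(1)[OF that(2)] C_anti[OF that(3)] C_anti[OF that(4)]
        unfolding f_def g_def by blast+
    have "(1/2) *\<^sub>R (f + g) \<in> C (F n)"
    proof -
      have "norm (f + g) \<le> 2" using f g norm_triangle_ineq[of f g] by (simp add: C_def)
      moreover have "snd z \<le> fst z (W ((1/2) *\<^sub>R (f + g)))" if "z \<in> F n" for z
      proof -
        have "z \<in> \<H>'" using F(1)[of n] that by (auto simp: fin_def)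
        then interpret bounded_linear "fst z" by (rule bl')
        have "snd z \<le> fst z (W f)" "snd z \<le> fst z (W g)" using f g that by (simp_all add: C_def)
        then show ?thesis by (simp add: blinfun.scaleR_right blinfun.add_right scaleR add)
      qed
      ultimately show ?thesis by (simp add: C_def)
    qed
    then have "D - \<epsilon> n \<le> q ((1/2) *\<^sub>R (f + g))" using d_le F(2)[of n] by fastforce
    moreover have "q f \<le> D + \<epsilon> n" "q g \<le> D + \<epsilon> n"
      using pick(2)[OF that(1), of i] pick(2)[OF that(2), of j] \<epsilon>_mono that unfolding f_def g_def
        by fastforce+
    moreover define a b where "a = q ((1/2) *\<^sub>R (f + g))" and "b = q ((1/2) *\<^sub>R (f - g))"
    moreover have "a + b = (q f + q g) / 2" unfolding a_def b_def by (rule parallelogram)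
    ultimately have "b \<le> 2 * \<epsilon> n" by (simp add: field_simps)
    then show ?thesis by (simp add: b_def f_def g_def)
  qed
  have small: "\<exists>n. \<forall>E E' i j. fin E \<longrightarrow> fin E' \<longrightarrow> F n \<subseteq> E \<longrightarrow> F n \<subseteq> E' \<longrightarrow> n \<le> i \<longrightarrow> n \<le> j \<longrightarrow>
      norm (W (pick E i) - W (pick E' j)) < e" if e: "e > 0" for e
  proof -
    obtain \<delta> where \<delta>: "\<delta> > 0" "\<And>f. q f < \<delta> \<Longrightarrow> norm (W f) < e / 2" using cont[of "e/2"] e
      by (metis half_gt_zero)
    obtain n where n: "2 * \<epsilon> n < \<delta>"
      using order_tendstoD(2)[OF tendsto_mult_right_zero[OF \<epsilon>0, of 2] \<delta>(1)]
        by (auto simp: eventually_sequentially)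
    have "norm (W (pick E i) - W (pick E' j)) < e"
      if "fin E" "fin E'" "F n \<subseteq> E" "F n \<subseteq> E'" "n \<le> i" "n \<le> j" for E E' i j
      using \<delta>(2)[OF order_le_less_trans[OF close[OF that] n]]
      by (simp add: blinfun.scaleR_right blinfun.diff_right)
    then show ?thesis by blast
  qed
  define f where "f n = pick (G n) n" for n
  have "Cauchy (\<lambda>n. W (f n))"
  proof (rule metric_CauchyI)
    fix e :: real assume "e > 0"
    then obtain n where "\<And>E E' i j. fin E \<Longrightarrow> fin E' \<Longrightarrow> F n \<subseteq> E \<Longrightarrow> F n \<subseteq> E' \<Longrightarrow> n \<le> i \<Longrightarrow> n \<le> j \<Longrightarrow>
      norm (W (pick E i) - W (pick E' j)) < e" using small by meson
    then show "\<exists>M. \<forall>m\<ge>M. \<forall>n\<ge>M. dist (W (f m)) (W (f n)) < e"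
      unfolding f_def dist_norm using G FG by meson
  qed
  then obtain h where h: "(\<lambda>n. W (f n)) \<longlonglongrightarrow> h" using complete by blast
  have "h \<in> closure (blinfun_apply W ` cball 0 1)"
    unfolding closure_sequential
  proof (intro exI[of _ "\<lambda>n. W (f n)"] conjI allI h imageI)
    show "f n \<in> cball 0 1" for n using pick(1)[OF G, of n n] by (simp add: f_def C_def)
  qed
  moreover have limit: "s \<le> \<psi> h" if "(\<psi>, s) \<in> \<H>'" for \<psi> s
  proof -
    define f' where "f' n = pick (insert (\<psi>, s) (G n)) n" for n
    have fin': "fin (insert (\<psi>, s) (G n))" for n using G[of n] that by (simp add: fin_def)
    have "(\<lambda>n. W (f' n) - W (f n)) \<longlonglongrightarrow> 0"
    proof (rule LIMSEQ_I)
      fix e :: real assume "e > 0"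
      then obtain n where "\<And>E E' i j. fin E \<Longrightarrow> fin E' \<Longrightarrow> F n \<subseteq> E \<Longrightarrow> F n \<subseteq> E' \<Longrightarrow> n \<le> i \<Longrightarrow> n \<le> j \<Longrightarrow>
        norm (W (pick E i) - W (pick E' j)) < e" using small by meson
      then have "norm (W (f' m) - W (f m)) < e" if "m \<ge> n" for m
        unfolding f_def f'_def using fin' G FG[OF that] that by (meson order_trans subset_insertI)
      then show "\<exists>no. \<forall>n\<ge>no. norm (W (f' n) - W (f n) - 0) < e" by auto
    qed
    from tendsto_add[OF this h] have "(\<lambda>n. W (f' n)) \<longlonglongrightarrow> h" by simp
    moreover have "continuous_on UNIV \<psi>" using bl'[OF that] linear_continuous_on[of \<psi>] by simp
    ultimately have "(\<lambda>n. \<psi> (W (f' n))) \<longlonglongrightarrow> \<psi> h"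
      by (intro continuous_on_tendsto_compose[of UNIV \<psi>]) auto
    moreover have "s \<le> \<psi> (W (f' n))" for n using pick(1)[OF fin', of n n]
      by (simp add: f'_def C_def)
    ultimately show ?thesis using LIMSEQ_le_const by blast
  qed
  moreover have "snd z \<le> fst z h" if z: "z \<in> \<H>" for z
  proof (rule_tac dense_le)
    fix s assume "s < snd z"
    then have "(fst z, s) \<in> \<H>'" using z by (auto simp: \<H>'_def intro!: exI[of _ "snd z"])
    then show "s \<le> fst z h" by (rule limit)
  qed
  ultimately show "\<exists>x\<in>closure (blinfun_apply W ` cball 0 1). \<forall>z\<in>\<H>. snd z \<le> fst z x" by blast
qed

section \<open>The distance to the weakly compact operators\<close>

lemma complete_bcontfun: "complete (UNIV :: ('a::topological_space \<Rightarrow>\<^sub>C 'b::banach) set)"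
  unfolding complete_def
proof (intro allI impI)
  fix X :: "nat \<Rightarrow> 'a \<Rightarrow>\<^sub>C 'b"
  assume "(\<forall>n. X n \<in> UNIV) \<and> Cauchy X"
  then have "Cauchy X" by simp
  have "uniformly_Cauchy_on UNIV (\<lambda>n x. X n x)"
    unfolding uniformly_Cauchy_on_def
  proof (intro allI impI)
    fix e :: real assume "e > 0"
    then obtain M where "\<And>m n. m \<ge> M \<Longrightarrow> n \<ge> M \<Longrightarrow> dist (X m) (X n) < e"
      using \<open>Cauchy X\<close> unfolding Cauchy_def by meson
    then show "\<exists>M. \<forall>x\<in>UNIV. \<forall>m\<ge>M. \<forall>n\<ge>M. dist (X m x) (X n x) < e"
      by (meson dist_fun_lt_imp_dist_val_lt)
  qed
  then obtain l where l: "uniform_limit UNIV (\<lambda>n x. X n x) l sequentially"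
    using Cauchy_uniformly_convergent uniformly_convergent_on_def by blast
  obtain n where n: "\<And>x. dist (X n x) (l x) < 1"
    using uniform_limitD[OF l, of 1] by (auto simp: eventually_sequentially)
  have "continuous_on UNIV l" by (rule uniform_limit_theorem[OF _ l]) auto
  moreover have "norm (l x) \<le> norm (X n) + 1" for x
    using n[of x] norm_bounded[of "X n" x] norm_triangle_ineq2[of "l x" "X n x"]
    by (simp add: dist_norm norm_minus_commute)
  ultimately have "l \<in> bcontfun" by (rule bcontfun_normI)
  then have "X \<longlonglongrightarrow> Bcontfun l"
    using l by (intro uniform_limit_tendsto_bcontfun) (simp add: Bcontfun_inverse)
  then show "\<exists>l\<in>UNIV. X \<longlonglongrightarrow> l" by blast
qed

lemma continuous_on_indicat_clopen:
  assumes "open A" "closed A"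
  shows "continuous_on UNIV (indicat_real A)"
proof -
  have "continuous_on A (indicat_real A)"
    by (subst continuous_on_cong[OF refl, where g="\<lambda>_. 1"]) auto
  moreover have "continuous_on (- A) (indicat_real A)"
    by (subst continuous_on_cong[OF refl, where g="\<lambda>_. 0"]) auto
  ultimately have "continuous_on (A \<union> - A) (indicat_real A)"
    using assms by (intro continuous_on_open_Un) auto
  then show ?thesis by simp
qed

lemma indicat_real_disjoint_Un: "A \<inter> B = {} \<Longrightarrow> indicat_real (A \<union> B) =
  (\<lambda>x. indicat_real A x + indicat_real B x)"
  by (auto simp: fun_eq_iff indicator_def)

context extremally_disconnected_compact
begin

text \<open>
  If no finite sum of set functions \<open>\<mu> y\<close> controls the others, one finds recursively clopen sets
  \<open>A n\<close> and points \<open>x n\<close> such that \<open>A n\<close> has large mass for \<open>x n\<close> and tiny mass for all earlier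
  points.
\<close>

lemma control_or_disjoint:
  fixes T :: "('l \<Rightarrow>\<^sub>C 'k::real_normed_field) \<Rightarrow>\<^sub>L ('l \<Rightarrow>\<^sub>C 'k)"
  defines "\<mu> \<equiv> \<lambda>x A. variation (\<lambda>f. apply_bcontfun (T f) x) (indicat_real A)"
  assumes T: "T \<in> bounded_ops cscale" and c: "c > 0"
  obtains (control) F \<eta> where "finite F" "\<eta> > 0"
      "\<And>A x. open A \<Longrightarrow> closed A \<Longrightarrow> (\<Sum>y\<in>F. \<mu> y A) < \<eta> \<Longrightarrow> \<mu> x A \<le> c"
  | (disjoint) B y where "disjoint_family B" "\<And>k :: nat. open (B k)" "\<And>k. closed (B k)"
    "\<And>k. c / 2 \<le> \<mu> (y k) (B k)"
proof (cases "\<exists>F \<eta>. finite F \<and> \<eta> > 0 \<and> (\<forall>A x. open A \<longrightarrow> closed A \<longrightarrow> (\<Sum>y\<in>F. \<mu> y A) < \<eta> \<longrightarrow> \<mu> x A \<le> c)")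
  case True
  then show thesis using control by blast
next
  case False
  then have ex: "\<exists>A x. open A \<and> closed A \<and> (\<Sum>y\<in>F. \<mu> y A) < \<eta> \<and> c < \<mu> x A" if "finite F" "\<eta> > 0"
    for F \<eta>
    using that by (meson not_le)
  interpret scalar_functional "\<lambda>f. apply_bcontfun (T f) x" "norm T" for x
    using T by (rule scalar_functional_eval)
  have nonneg: "0 \<le> \<mu> x A" for x A
    unfolding \<mu>_def by (rule variation_nonneg[where R=1]) (auto simp: indicator_def)
  (* A state of the recursion carries the set F of all earlier points. *)
  define P where "P n = (\<lambda>(F, A, x). finite F \<and> open A \<and> closed A \<and>
    (\<Sum>y\<in>F. \<mu> y A) < c / 4 * (1/2) ^ n \<and> c < \<mu> x A)" for n :: nat
  define Q where "Q = (\<lambda>(F, A :: 'l set, x :: 'l) (F', A' :: 'l set, x' :: 'l). F' = insert x F)"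
  have "\<exists>z. \<forall>n. P n (z n) \<and> Q (z n) (z (Suc n))"
  proof (rule dependent_nat_choice)
    obtain A x where "open A" "closed A" "c < \<mu> x A" using ex[of "{}" 1] by auto
    then show "\<exists>z. P 0 z" using c by (intro exI[of _ "({}, A, x)"]) (simp add: P_def)
    fix z n assume z: "P n z"
    obtain F A x where z_eq: "z = (F, A, x)" by (cases z)
    obtain A' x' where "open A'" "closed A'" "(\<Sum>y\<in>insert x F. \<mu> y A') < c / 4 * (1/2) ^ Suc n"
      "c < \<mu> x' A'"
      using ex[of "insert x F" "c / 4 * (1/2) ^ Suc n"] c z unfolding z_eq P_def by fastforce
    then show "\<exists>z'. P (Suc n) z' \<and> Q z z'"
      using z by (intro exI[of _ "(insert x F, A', x')"]) (simp add: z_eq P_def Q_def)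
  qed
  then obtain z where z: "\<And>n. P n (z n)" "\<And>n. Q (z n) (z (Suc n))" by blast
  define F A x where "F n = fst (z n)" and "A n = fst (snd (z n))" and "x n = snd (snd (z n))" for n
  have F: "finite (F n)" "F (Suc n) = insert (x n) (F n)" and A: "open (A n)" "closed (A n)"
    "c < \<mu> (x n) (A n)"
    and sum: "(\<Sum>y\<in>F n. \<mu> y (A n)) < c / 4 * (1/2) ^ n" for n
    using z(1)[of n] z(2)[of n] by (simp_all add: P_def Q_def F_def A_def x_def case_prod_unfold)
  have xF: "x i \<in> F n" if "i < n" for i n
    using that by (induction n) (auto simp: F(2) less_Suc_eq)
  have "\<exists>(m :: nat \<Rightarrow> nat) B. disjoint_family B \<and>
    (\<forall>k. B k \<in> {A. open A \<and> closed A} \<and> c / 2 \<le> \<mu> (x (m k)) (B k))"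
  proof (rule disjoint_sets_of_almost_disjoint_masses[where K="norm T" and A=A])
    show "\<mu> (x n) (S \<union> S') = \<mu> (x n) S + \<mu> (x n) S'"
      if "S \<in> {A. open A \<and> closed A}" "S' \<in> {A. open A \<and> closed A}" "S \<inter> S' = {}" for n S S'
      unfolding \<mu>_def indicat_real_disjoint_Un[OF that(3)]
      using that by (intro variation_add[where R=1] continuous_on_indicat_clopen)
        (auto simp: indicator_def)
    show "\<mu> (x n) S \<le> norm T" for n S
      unfolding \<mu>_def using variation_le[of "indicat_real S" 1] by (auto simp: indicator_def)
    show "\<mu> (x i) (A n) \<le> c / 4 * (1/2) ^ n" if "i < n" for i n
    proof -
      have "\<mu> (x i) (A n) \<le> (\<Sum>y\<in>F n. \<mu> y (A n))"
        using xF[OF that] F(1) nonneg by (intro member_le_sum) auto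
      then show ?thesis using sum[of n] by simp
    qed
  qed (use A c nonneg in \<open>auto intro: less_imp_le\<close>)
  then obtain m :: "nat \<Rightarrow> nat" and B where "disjoint_family B"
    "\<forall>k. B k \<in> {A. open A \<and> closed A} \<and> c / 2 \<le> \<mu> (x (m k)) (B k)"
    by blast
  then show thesis by (intro disjoint[of B "\<lambda>k. x (m k)"]) auto
qed

end

text \<open>
  The scalars for which operators can be split. They will be the real and the complex numbers, and
  what follows is carried out for both at once.
\<close>

locale extremally_disconnected_scalars = extremally_disconnected_compact L
  for L :: "'l::t2_space itself" +
  fixes scalars :: "'k::{real_normed_field,euclidean_space} itself"
  assumes dominated_split_scalars: "\<And>(T :: ('l \<Rightarrow>\<^sub>C 'k) \<Rightarrow>\<^sub>L ('l \<Rightarrow>\<^sub>C 'k)) p q M.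
    T \<in> bounded_ops cscale \<Longrightarrow> scalar_seminorm p \<Longrightarrow> scalar_seminorm q \<Longrightarrow> (\<And>f. p f \<le> M * norm f) \<Longrightarrow>
    (\<And>f x. norm (apply_bcontfun (blinfun_apply T f) x) \<le> p f + q f) \<Longrightarrow>
    \<exists>W \<in> bounded_ops cscale. (\<forall>f x. norm (apply_bcontfun (blinfun_apply W f) x) \<le> p f) \<and>
      (\<forall>f x. norm (apply_bcontfun (blinfun_apply T f - blinfun_apply W f) x) \<le> q f)"
begin

text \<open>
  Let \<open>\<lambda>\<close> be the sum of the variations at the points of \<open>F\<close>. Cutting \<open>f\<close> at a low level, one sees
  that \<open>\<bar>T f\<bar> \<le> M \<lambda>(\<bar>f\<bar>) + 2 c \<bar>\<bar>f\<bar>\<bar>\<close>: if the set where \<open>f\<close> is above this level has \<open>\<lambda>\<close>-mass below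
  \<open>\<eta>\<close>, then the control of the set functions applies, and otherwise \<open>\<lambda>(\<bar>f\<bar>)\<close> is a fixed proportion
  of \<open>\<bar>\<bar>f\<bar>\<bar>\<close> at least. Splitting \<open>T\<close> along this bound yields \<open>W\<close> with \<open>\<bar>W f\<bar> \<le> M \<lambda>(\<bar>f\<bar>)\<close>. As \<open>\<lambda>\<close>
  is additive on nonnegative continuous functions, \<open>f \<mapsto> \<lambda>(\<bar>f\<bar>\<^sup>2)\<close> satisfies the parallelogram law.
\<close>

lemma near_weakly_compact:
  fixes T :: "('l \<Rightarrow>\<^sub>C 'k) \<Rightarrow>\<^sub>L ('l \<Rightarrow>\<^sub>C 'k)"
  defines "\<mu> \<equiv> \<lambda>x. variation (\<lambda>f. apply_bcontfun (T f) x)"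
  assumes T: "T \<in> bounded_ops cscale" and c: "c > 0" and F: "finite F" and \<eta>: "\<eta> > 0"
    and control: "\<And>A x. open A \<Longrightarrow> closed A \<Longrightarrow> (\<Sum>y\<in>F. \<mu> y (indicat_real A)) < \<eta> \<Longrightarrow>
      \<mu> x (indicat_real A) \<le> c"
  shows "\<exists>W \<in> weakly_compact_ops cscale. norm (T - W) \<le> 2 * c"
proof -
  interpret scalar_functional "\<lambda>f. apply_bcontfun (T f) x" "norm T" for x
    using T by (rule scalar_functional_eval)
  define lam where "lam g = (\<Sum>y\<in>F. \<mu> y g)" for g
  define \<Lambda> where "\<Lambda> = card F * norm T"
  have \<Lambda>: "\<Lambda> \<ge> 0" by (simp add: \<Lambda>_def)
  have lam_mono: "lam g \<le> lam h" if "\<And>x. 0 \<le> g x" "\<And>x. g x \<le> h x" "\<And>x. h x \<le> R" for g h R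
    unfolding lam_def \<mu>_def by (intro sum_mono variation_mono[where R=R] that)
  have lam_scale: "lam (\<lambda>x. r * g x) = r * lam g" if "\<And>x. 0 \<le> g x" "\<And>x. g x \<le> R" "0 \<le> r" for g r R
    unfolding lam_def \<mu>_def sum_distrib_left
      by (intro sum.cong refl variation_scale[where R=R] that)
  have lam_add: "lam (\<lambda>x. g x + h x) = lam g + lam h"
    if "\<And>x. 0 \<le> g x" "\<And>x. g x \<le> R" "continuous_on UNIV g" "\<And>x. 0 \<le> h x" "\<And>x. h x \<le> R"
      "continuous_on UNIV h" for g h R
    unfolding lam_def \<mu>_def sum.distrib[symmetric]
      by (intro sum.cong refl variation_add[where R=R] that)
  have lam_nonneg: "0 \<le> lam g" if "\<And>x. 0 \<le> g x" "\<And>x. g x \<le> R" for g R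
    unfolding lam_def \<mu>_def by (intro sum_nonneg variation_nonneg[where R=R] that)
  have lam_le: "lam g \<le> \<Lambda> * R" if "\<And>x. 0 \<le> g x" "\<And>x. g x \<le> R" for g R
  proof -
    have "lam g \<le> (\<Sum>y\<in>F. norm T * R)" unfolding lam_def \<mu>_def by (intro sum_mono variation_le that)
    then show ?thesis by (simp add: \<Lambda>_def)
  qed
  define p\<^sub>0 where "p\<^sub>0 f = lam (\<lambda>x. norm (apply_bcontfun f x))" for f :: "'l \<Rightarrow>\<^sub>C 'k"
  have norm_cont: "continuous_on UNIV (\<lambda>x. norm (apply_bcontfun f x))" for f :: "'l \<Rightarrow>\<^sub>C 'k"
    by (intro continuous_intros) simp
  have p0_nonneg: "0 \<le> p\<^sub>0 f" for f unfolding p\<^sub>0_def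
    by (rule lam_nonneg[OF norm_ge_zero norm_bounded])

  (* The level of the cut relative to the norm of f: below it, T f is at most c times this norm. *)
  define e where "e = c / (norm T + 1)"
  have e: "e > 0" using c by (simp add: e_def add_nonneg_pos)
  have "norm T * e = c * (norm T / (norm T + 1))" by (simp add: e_def)
  also have "\<dots> \<le> c * 1" using c by (intro mult_left_mono) (auto simp: divide_le_eq add_nonneg_pos)
  finally have Te: "norm T * e \<le> c" by simp
  define M where "M = norm T / (\<eta> * e)"
  have M: "M \<ge> 0" using \<eta> e unfolding M_def by (intro divide_nonneg_nonneg mult_nonneg_nonneg) auto
  have estimate: "norm (apply_bcontfun (T f) x) \<le> M * p\<^sub>0 f + 2 * c * norm f" for f x
  proof (cases "f = 0")
    case False
    then have f: "norm f > 0" by simp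
    define A where "A = closure {x. e * norm f < norm (apply_bcontfun f x)}"
    have "open {x. e * norm f < norm (apply_bcontfun f x)}"
      by (intro open_Collect_less continuous_intros) simp
    then have A: "open A" "closed A" unfolding A_def using open_closure closed_closure by blast+
    have inA: "e * norm f \<le> norm (apply_bcontfun f x)" if "x \<in> A" for x
    proof -
      have "closed {x. e * norm f \<le> norm (apply_bcontfun f x)}"
        by (intro closed_Collect_le continuous_intros) simp
      then have "A \<subseteq> {x. e * norm f \<le> norm (apply_bcontfun f x)}"
        unfolding A_def by (intro closure_minimal) auto
      then show ?thesis using that by blast
    qed
    have outA: "norm (apply_bcontfun f x) \<le> e * norm f" if "x \<notin> A" for x
    proof (rule ccontr)
      assume "\<not> ?thesis"
      then have "x \<in> {x. e * norm f < norm (apply_bcontfun f x)}" by simp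
      then have "x \<in> A" unfolding A_def by (rule subsetD[OF closure_subset])
      then show False using that by contradiction
    qed
    have cA: "continuous_on UNIV (indicat_real A)" using A by (rule continuous_on_indicat_clopen)
    show ?thesis
    proof (cases "lam (indicat_real A) < \<eta>")
      case True
      define f\<^sub>1 where "f\<^sub>1 = Bcontfun (\<lambda>x. indicat_real A x *\<^sub>R apply_bcontfun f x)"
      have f1: "apply_bcontfun f\<^sub>1 x = indicat_real A x *\<^sub>R apply_bcontfun f x" for x
        unfolding f\<^sub>1_def using cA by (subst apply_Bcontfun) (auto intro!: continuous_intros)
      have "norm (apply_bcontfun (T f\<^sub>1) x) \<le> \<mu> x (\<lambda>x. norm f * indicat_real A x)"
        unfolding \<mu>_def
        by (rule variation_upper[where R="norm f"]) (auto simp: f1 norm_bounded indicator_def)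
      also have "\<dots> = norm f * \<mu> x (indicat_real A)"
        unfolding \<mu>_def by (rule variation_scale[where R=1]) (auto simp: indicator_def)
      also have "\<dots> \<le> norm f * c"
        using control[OF A] True by (intro mult_left_mono) (auto simp: lam_def)
      finally have 1: "norm (apply_bcontfun (T f\<^sub>1) x) \<le> norm f * c" .
      have "norm (f - f\<^sub>1) \<le> e * norm f"
        by (rule norm_bound) (use outA e f in \<open>auto simp: f1 indicator_def\<close>)
      then have "norm T * norm (f - f\<^sub>1) \<le> norm T * (e * norm f)" by (intro mult_left_mono) auto
      also have "\<dots> \<le> c * norm f" using mult_right_mono[OF Te, of "norm f"]
        by (simp add: algebra_simps)
      finally have 2: "norm (apply_bcontfun (T (f - f\<^sub>1)) x) \<le> c * norm f"
        using bound[of "f - f\<^sub>1" x] by linarith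
      have "T f = T f\<^sub>1 + T (f - f\<^sub>1)" by (simp add: blinfun.diff_right)
      then have "norm (apply_bcontfun (T f) x) \<le> norm (apply_bcontfun (T f\<^sub>1) x) +
        norm (apply_bcontfun (T (f - f\<^sub>1)) x)"
        by (simp add: norm_triangle_ineq)
      also have "\<dots> \<le> 2 * c * norm f" using 1 2 by (simp add: algebra_simps)
      also have "\<dots> \<le> M * p\<^sub>0 f + 2 * c * norm f" using M p0_nonneg by simp
      finally show ?thesis .
    next
      case False
      have "\<eta> * (e * norm f) \<le> (e * norm f) * lam (indicat_real A)"
        using False e f by (simp add: mult.commute)
      also have "\<dots> = lam (\<lambda>x. (e * norm f) * indicat_real A x)"
        by (rule lam_scale[symmetric, where R=1]) (use e in \<open>auto simp: indicator_def\<close>)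
      also have "\<dots> \<le> p\<^sub>0 f"
        unfolding p\<^sub>0_def
        by (rule lam_mono[where R="norm f"]) (use inA e norm_bounded in \<open>auto simp: indicator_def\<close>)
      finally have "\<eta> * e * norm f \<le> p\<^sub>0 f" by (simp add: mult.assoc)
      then have "M * (\<eta> * e * norm f) \<le> M * p\<^sub>0 f" using M by (intro mult_left_mono)
      moreover have "M * (\<eta> * e * norm f) = norm T * norm f" using \<eta> e by (simp add: M_def)
      ultimately have "norm (apply_bcontfun (T f) x) \<le> M * p\<^sub>0 f" using bound[of f x] by linarith
      then show ?thesis using c by (meson add_increasing2 mult_nonneg_nonneg norm_ge_zero
        order_trans less_imp_le zero_le_numeral)
    qed
  qed (simp add: p0_nonneg M)

  have "scalar_seminorm p\<^sub>0"
    unfolding scalar_seminorm_def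
  proof (intro conjI allI)
    fix f g :: "'l \<Rightarrow>\<^sub>C 'k" and a :: 'k
    have "p\<^sub>0 (f + g) \<le> lam (\<lambda>x. norm (apply_bcontfun f x) + norm (apply_bcontfun g x))"
      unfolding p\<^sub>0_def
      by (rule lam_mono[where R="norm f + norm g"])
        (auto intro: norm_triangle_ineq add_mono norm_bounded)
    also have "\<dots> = p\<^sub>0 f + p\<^sub>0 g"
      unfolding p\<^sub>0_def
      by (rule lam_add[where R="norm f + norm g"])
        (auto intro: norm_cont order_trans[OF norm_bounded])
    finally show "p\<^sub>0 (f + g) \<le> p\<^sub>0 f + p\<^sub>0 g" .
    show "p\<^sub>0 (cscale a f) = norm a * p\<^sub>0 f"
      unfolding p\<^sub>0_def cscale_apply norm_mult
        by (rule lam_scale[OF norm_ge_zero norm_bounded norm_ge_zero])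
  qed
  then have p: "scalar_seminorm (\<lambda>f. M * p\<^sub>0 f)"
    using M unfolding scalar_seminorm_def
      by (auto simp: distrib_left[symmetric] intro!: mult_left_mono)
  have norm_cscale: "norm (cscale a f) = norm a * norm f" for a and f :: "'l \<Rightarrow>\<^sub>C 'k"
  proof (rule antisym)
    show *: "norm (cscale a f) \<le> norm a * norm f" for a and f :: "'l \<Rightarrow>\<^sub>C 'k"
      by (rule norm_bound) (simp add: norm_mult mult_left_mono norm_bounded)
    show "norm a * norm f \<le> norm (cscale a f)"
    proof (cases "a = 0")
      case False
      then have "f = cscale (inverse a) (cscale a f)" by (intro bcontfun_eqI) simp
      then have "norm f \<le> norm (inverse a) * norm (cscale a f)" using * by metis
      then have "norm a * norm f \<le> norm a * (inverse (norm a) * norm (cscale a f))"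
        unfolding norm_inverse by (intro mult_left_mono) auto
      also have "\<dots> = norm (cscale a f)" using False by simp
      finally show ?thesis .
    qed simp
  qed
  have q: "scalar_seminorm (\<lambda>f :: 'l \<Rightarrow>\<^sub>C 'k. 2 * c * norm f)"
    unfolding scalar_seminorm_def
  proof (intro conjI allI)
    show "2 * c * norm (f + g) \<le> 2 * c * norm f + 2 * c * norm g" for f g :: "'l \<Rightarrow>\<^sub>C 'k"
      unfolding distrib_left[symmetric] using c by (intro mult_left_mono norm_triangle_ineq) auto
    show "2 * c * norm (cscale a f) = norm a * (2 * c * norm f)" for a and f :: "'l \<Rightarrow>\<^sub>C 'k"
      by (simp add: norm_cscale)
  qed
  have pM: "M * p\<^sub>0 f \<le> (M * \<Lambda>) * norm f" for f
    using lam_le[of "\<lambda>x. norm (apply_bcontfun f x)" "norm f"] M norm_bounded[of f]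
    unfolding p\<^sub>0_def mult.assoc by (intro mult_left_mono) auto
  from dominated_split_scalars[OF T p q pM estimate]
  obtain W where W: "W \<in> bounded_ops cscale"
      and "\<forall>f x. norm (apply_bcontfun (blinfun_apply W f) x) \<le> M * p\<^sub>0 f"
      and "\<forall>f x. norm (apply_bcontfun (blinfun_apply T f - blinfun_apply W f) x) \<le> 2 * c * norm f"
    by (elim bexE conjE) (rule that)
  then have Wp: "norm (apply_bcontfun (W f) x) \<le> M * p\<^sub>0 f"
      and Wq: "norm (apply_bcontfun (T f - W f) x) \<le> 2 * c * norm f" for f x
    by simp_all

  (* The square of the Hilbert space seminorm, for which W is continuous. *)
  define q\<^sub>0 where "q\<^sub>0 f = lam (\<lambda>x. (norm (apply_bcontfun f x))\<^sup>2)" for f :: "'l \<Rightarrow>\<^sub>C 'k"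
  have sq: "(norm (apply_bcontfun f x))\<^sup>2 \<le> (norm f)\<^sup>2" for f :: "'l \<Rightarrow>\<^sub>C 'k" and x
    by (intro power_mono norm_bounded) auto
  have sq_cont: "continuous_on UNIV (\<lambda>x. (norm (apply_bcontfun f x))\<^sup>2)" for f :: "'l \<Rightarrow>\<^sub>C 'k"
    by (intro continuous_intros) simp
  have q_add: "lam (\<lambda>x. (norm (apply_bcontfun f x))\<^sup>2 + (norm (apply_bcontfun g x))\<^sup>2) = q\<^sub>0 f +
    q\<^sub>0 g" for f g :: "'l \<Rightarrow>\<^sub>C 'k"
    unfolding q\<^sub>0_def by (rule lam_add[where R="(norm f)\<^sup>2 + (norm g)\<^sup>2"])
      (auto intro: sq_cont order_trans[OF sq])
  have "compactin (weak_topology (cscale :: 'k \<Rightarrow> ('l \<Rightarrow>\<^sub>C 'k) \<Rightarrow> _))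
    (closure (blinfun_apply W ` cball 0 1))"
  proof (rule Hilbertian_compact[where q=q\<^sub>0 and R=\<Lambda>])
    show "\<exists>h. X \<longlonglongrightarrow> h" if "Cauchy X" for X :: "nat \<Rightarrow> 'l \<Rightarrow>\<^sub>C 'k"
      using complete_bcontfun that unfolding complete_def by blast
    show "q\<^sub>0 ((1/2) *\<^sub>R (f + g)) + q\<^sub>0 ((1/2) *\<^sub>R (f - g)) = (q\<^sub>0 f + q\<^sub>0 g) / 2" for f g
    proof -
      have "(norm ((1/2) *\<^sub>R (a + b)))\<^sup>2 + (norm ((1/2) *\<^sub>R (a - b)))\<^sup>2 =
        (1/2) * ((norm a)\<^sup>2 + (norm b)\<^sup>2)" for a b :: 'k
        by (simp add: power2_norm_eq_inner inner_simps field_simps inner_commute)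
      then have "q\<^sub>0 ((1/2) *\<^sub>R (f + g)) + q\<^sub>0 ((1/2) *\<^sub>R (f - g)) =
        lam (\<lambda>x. (1/2) * ((norm (apply_bcontfun f x))\<^sup>2 + (norm (apply_bcontfun g x))\<^sup>2))"
        unfolding q_add[symmetric] by (simp only: plus_bcontfun.rep_eq minus_bcontfun.rep_eq
          scaleR_bcontfun.rep_eq)
      also have "\<dots> = (1/2) * lam (\<lambda>x. (norm (apply_bcontfun f x))\<^sup>2 +
        (norm (apply_bcontfun g x))\<^sup>2)"
        by (rule lam_scale[where R="(norm f)\<^sup>2 + (norm g)\<^sup>2"]) (auto intro: add_mono sq)
      finally show ?thesis unfolding q_add by simp
    qed
    show "0 \<le> q\<^sub>0 f" for f unfolding q\<^sub>0_def by (rule lam_nonneg[OF _ sq]) simp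
    show "q\<^sub>0 f \<le> \<Lambda>" if "norm f \<le> 1" for f
    proof -
      have "(norm (apply_bcontfun f x))\<^sup>2 \<le> 1" for x
        using norm_bounded[of f x] that by (intro power_le_one) auto
      then show ?thesis unfolding q\<^sub>0_def using lam_le[of "\<lambda>x. (norm (apply_bcontfun f x))\<^sup>2" 1]
        by simp
    qed
    show "\<exists>d>0. \<forall>f. q\<^sub>0 f < d \<longrightarrow> norm (W f) < \<epsilon>" if \<epsilon>: "\<epsilon> > 0" for \<epsilon>
    proof -
      have small: "a * (\<epsilon> / (4 * (a + 1))) \<le> \<epsilon> / 4" if "a \<ge> 0" for a
      proof -
        have "a * (\<epsilon> / (4 * (a + 1))) = (\<epsilon> / 4) * (a / (a + 1))" by simp
        also have "\<dots> \<le> (\<epsilon> / 4) * 1" using that \<epsilon> by (intro mult_left_mono) (auto simp: divide_le_eq)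
        finally show ?thesis by simp
      qed
      define t where "t = \<epsilon> / (4 * (M * \<Lambda> + 1))"
      have M\<Lambda>: "M * \<Lambda> \<ge> 0" using M \<Lambda> by simp
      have t: "t > 0" "M * \<Lambda> * t \<le> \<epsilon> / 4"
        using \<epsilon> M\<Lambda> small[OF M\<Lambda>] unfolding t_def by (auto intro!: divide_pos_pos)
      define d where "d = t * (\<epsilon> / (4 * (M + 1)))"
      have d: "d > 0" "M * (d / t) \<le> \<epsilon> / 4"
        using \<epsilon> t M small[OF M] unfolding d_def by (auto intro!: divide_pos_pos mult_pos_pos)
      have "norm (W f) < \<epsilon>" if "q\<^sub>0 f < d" for f
      proof -
        (* A substitute for the Cauchy-Schwarz inequality between lam |f| and lam |f|^2. *)
        have pt: "norm a \<le> t + (1/t) * (norm a)\<^sup>2" for a :: 'k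
        proof (cases "norm a \<le> t")
          case False
          then have "t * norm a \<le> norm a * norm a" by (intro mult_right_mono) auto
          then have "norm a \<le> (1/t) * (norm a)\<^sup>2" using t(1)
            by (simp add: field_simps power2_eq_square)
          then show ?thesis using t(1) by linarith
        qed (use t in \<open>simp add: add_increasing2\<close>)
        have sqt: "0 \<le> (1/t) * (norm (apply_bcontfun f x))\<^sup>2"
            "(1/t) * (norm (apply_bcontfun f x))\<^sup>2 \<le> t + (1/t) * (norm f)\<^sup>2" for x
        proof -
          show "0 \<le> (1/t) * (norm (apply_bcontfun f x))\<^sup>2" using t(1) by simp
          have "(1/t) * (norm (apply_bcontfun f x))\<^sup>2 \<le> (1/t) * (norm f)\<^sup>2"
            using t(1) sq by (intro mult_left_mono) auto
          then show "(1/t) * (norm (apply_bcontfun f x))\<^sup>2 \<le> t + (1/t) * (norm f)\<^sup>2" using t(1)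
            by linarith
        qed
        have tR: "t \<le> t + (1/t) * (norm f)\<^sup>2" using t(1) by simp
        have "p\<^sub>0 f \<le> lam (\<lambda>x. t + (1/t) * (norm (apply_bcontfun f x))\<^sup>2)"
          unfolding p\<^sub>0_def
          by (rule lam_mono[OF norm_ge_zero pt, where R="t + (t + (1/t) * (norm f)\<^sup>2)"])
            (rule add_left_mono[OF sqt(2)])
        also have "\<dots> = lam (\<lambda>x. t) + lam (\<lambda>x. (1/t) * (norm (apply_bcontfun f x))\<^sup>2)"
          by (rule lam_add[OF _ tR _ sqt]) (use t(1) in \<open>auto intro!: continuous_intros\<close>)
        also have "lam (\<lambda>x. t) \<le> \<Lambda> * t" using t(1) by (intro lam_le) auto
        also have "lam (\<lambda>x. (1/t) * (norm (apply_bcontfun f x))\<^sup>2) = (1/t) * q\<^sub>0 f"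
          unfolding q\<^sub>0_def using t(1) by (intro lam_scale[OF _ sq]) auto
        also have "(1/t) * q\<^sub>0 f \<le> d / t" using that t(1) by (simp add: divide_right_mono)
        finally have "p\<^sub>0 f \<le> \<Lambda> * t + d / t" by simp
        then have "M * p\<^sub>0 f \<le> M * (\<Lambda> * t + d / t)" using M by (intro mult_left_mono)
        also have "\<dots> = M * \<Lambda> * t + M * (d / t)" by (simp add: distrib_left mult.assoc)
        also have "\<dots> \<le> \<epsilon> / 2" using t(2) d(2) by linarith
        finally have "norm (W f) \<le> \<epsilon> / 2" by (intro norm_bound order_trans[OF Wp])
        then show ?thesis using \<epsilon> by simp
      qed
      then show ?thesis using d(1) by blast
    qed
  qed
  then have "W \<in> weakly_compact_ops cscale" by (rule weakly_compact_opsI[OF W _ closure_subset])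
  moreover have "norm (T - W) \<le> 2 * c"
    by (rule norm_blinfun_bound) (use c norm_bound[OF Wq] in \<open>simp_all add: blinfun.diff_left\<close>)
  ultimately show ?thesis by blast
qed

lemma disjoint_masses:
  fixes T :: "('l \<Rightarrow>\<^sub>C 'k) \<Rightarrow>\<^sub>L ('l \<Rightarrow>\<^sub>C 'k)"
  assumes T: "T \<in> bounded_ops cscale" and d: "weak_essential_norm cscale T > 0"
  shows "\<exists>B y. disjoint_family B \<and> (\<forall>k :: nat. open (B k) \<and> closed (B k) \<and>
    weak_essential_norm cscale T / 8 \<le> variation (\<lambda>f. apply_bcontfun (T f) (y k))
      (indicat_real (B k)))"
proof -
  have le: "weak_essential_norm cscale T \<le> norm (T - W)" if "W \<in> weakly_compact_ops cscale" for W
    unfolding weak_essential_norm_def by (rule cINF_lower)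
      (use that in \<open>auto intro: bdd_belowI2[where m=0]\<close>)
  define c where "c = weak_essential_norm cscale T / 4"
  have c: "c > 0" using d by (simp add: c_def)
  show ?thesis
  proof (rule control_or_disjoint[OF T c])
    fix F :: "'l set" and \<eta> :: real
    assume "finite F" "\<eta> > 0" "\<And>A x. open A \<Longrightarrow> closed A \<Longrightarrow>
      (\<Sum>y\<in>F. variation (\<lambda>f. apply_bcontfun (T f) y) (indicat_real A)) < \<eta> \<Longrightarrow>
      variation (\<lambda>f. apply_bcontfun (T f) x) (indicat_real A) \<le> c"
    then have "\<exists>W \<in> weakly_compact_ops cscale. norm (T - W) \<le> 2 * c"
      by (rule near_weakly_compact[OF T c])
    then obtain W where "W \<in> weakly_compact_ops cscale" "norm (T - W) \<le> 2 * c" ..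
    then have False using le[of W] d by (simp add: c_def)
    then show ?thesis ..
  next
    fix B :: "nat \<Rightarrow> 'l set" and y
    assume "disjoint_family B" "\<And>k. open (B k)" "\<And>k. closed (B k)"
      "\<And>k. c / 2 \<le> variation (\<lambda>f. apply_bcontfun (T f) (y k)) (indicat_real (B k))"
    then show ?thesis by (intro exI[of _ B] exI[of _ y]) (simp add: c_def)
  qed
qed

end

section \<open>Factoring the identity of the bounded sequences\<close>

text \<open>
  The equation \<open>Z a = b\<close> is the fixed point equation of the contraction \<open>a \<mapsto> b + (a - Z a)\<close>.
\<close>

lemma near_identity_invertible:
  fixes Z :: "'e::real_normed_vector \<Rightarrow>\<^sub>L 'e"
  assumes complete: "complete (UNIV :: 'e set)" and near: "\<And>a. norm (Z a - a) \<le> norm a / 2"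
  shows "\<exists>Y. Z o\<^sub>L Y = id_blinfun \<and> Y o\<^sub>L Z = id_blinfun \<and> norm Y \<le> 2"
proof -
  have le: "norm a \<le> 2 * norm (Z a)" for a
    using near[of a] norm_triangle_ineq2[of a "Z a"] by (simp add: norm_minus_commute)
  have inj: "a = b" if "Z a = Z b" for a b
    using le[of "a - b"] that by (simp add: blinfun.diff_right)
  have "\<exists>a. Z a = b" for b
  proof -
    have "dist (b + (x - Z x)) (b + (y - Z y)) \<le> 1/2 * dist x y" for x y
      using near[of "x - y"] by (simp add: dist_norm blinfun.diff_right norm_minus_commute
        algebra_simps)
    then have "\<exists>!a\<in>UNIV. b + (a - Z a) = a"
      by (intro Banach_fix[OF complete UNIV_not_empty, where c="1/2"]) auto
    then obtain a where "b + (a - Z a) = a" by blast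
    then have "Z a = b" by (simp add: algebra_simps)
    then show ?thesis ..
  qed
  then obtain Y where Y: "\<And>b. Z (Y b) = b" by metis
  have bl: "bounded_linear Y"
  proof (rule bounded_linear_intro)
    show "Y (a + b) = Y a + Y b" for a b by (rule inj) (simp add: blinfun.add_right Y)
    show "Y (r *\<^sub>R a) = r *\<^sub>R Y a" for r a by (rule inj) (simp add: blinfun.scaleR_right Y)
    show "norm (Y a) \<le> norm a * 2" for a using le[of "Y a"] by (simp add: Y)
  qed
  have app: "blinfun_apply (Blinfun Y) = Y" by (rule bounded_linear_Blinfun_apply[OF bl])
  have "norm (Blinfun Y) \<le> 2"
    by (rule norm_blinfun_bound) (use le[of "Y _"] in \<open>simp_all add: app Y\<close>)
  moreover have "Z o\<^sub>L Blinfun Y = id_blinfun" by (rule blinfun_eqI) (simp add: app Y)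
  moreover have "Blinfun Y o\<^sub>L Z = id_blinfun"
    by (rule blinfun_eqI) (simp add: app, rule inj, simp add: Y)
  ultimately show ?thesis by blast
qed

lemma apply_Bcontfun_sequence:
  fixes f :: "nat \<Rightarrow> 'b::real_normed_vector"
  assumes "\<And>n. norm (f n) \<le> M"
  shows "apply_bcontfun (Bcontfun f) = f"
  using bcontfun_normI[of f M] assms by (simp add: Bcontfun_inverse)

lemma (in scalar_functional) variation_attained:
  assumes "\<And>x. 0 \<le> g x" "r < variation \<phi> g"
  shows "\<exists>f. (\<forall>x. norm (apply_bcontfun f x) \<le> g x) \<and> r < norm (\<phi> f)"
  using variation_least[of g r] assms by (meson not_le)

context extremally_disconnected_scalars
begin

text \<open>
  Rosenthal's lemma applies because in an extremally disconnected space disjoint open sets have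
  disjoint closures, so that the variation is superadditive as a function of the index set.
\<close>

lemma Rosenthal_subsequence:
  fixes T :: "('l \<Rightarrow>\<^sub>C 'k) \<Rightarrow>\<^sub>L ('l \<Rightarrow>\<^sub>C 'k)"
  assumes T: "T \<in> bounded_ops cscale" and B: "disjoint_family B" "\<And>k :: nat. open (B k)" and \<epsilon>:
    "\<epsilon> > 0"
  shows "\<exists>M. infinite M \<and> (\<forall>n\<in>M. variation (\<lambda>f. apply_bcontfun (T f) (y n))
    (indicat_real (closure (\<Union>i\<in>M - {n}. B i))) < \<epsilon>)"
proof (rule Rosenthal[OF _ _ _ \<epsilon>, where K="norm T"])
  interpret scalar_functional "\<lambda>f. apply_bcontfun (T f) x" "norm T" for x
    using T by (rule scalar_functional_eval)
  fix n and R S :: "nat set"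
  show "variation (\<lambda>f. apply_bcontfun (T f) (y n)) (indicat_real (closure (\<Union>i\<in>R. B i))) \<le>
      variation (\<lambda>f. apply_bcontfun (T f) (y n)) (indicat_real (closure (\<Union>i\<in>S. B i)))" if "R \<subseteq> S"
  proof -
    have "closure (\<Union>i\<in>R. B i) \<subseteq> closure (\<Union>i\<in>S. B i)" using that by (intro closure_mono) blast
    then show ?thesis by (intro variation_mono[where R=1]) (auto simp: indicator_def)
  qed
  show "variation (\<lambda>f. apply_bcontfun (T f) (y n)) (indicat_real (closure (\<Union>i\<in>R. B i))) +
      variation (\<lambda>f. apply_bcontfun (T f) (y n)) (indicat_real (closure (\<Union>i\<in>S. B i))) \<le>
      variation (\<lambda>f. apply_bcontfun (T f) (y n)) (indicat_real (closure (\<Union>i\<in>R \<union> S. B i)))" if "R \<inter>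
        S = {}"
  proof -
    have op: "open (\<Union>i\<in>R. B i)" for R using B(2) by blast
    have "B i \<inter> B j = {}" if "i \<in> R" "j \<in> S" for i j
      using B(1) that \<open>R \<inter> S = {}\<close> by (metis UNIV_I disjoint_family_onD disjoint_iff)
    then have "(\<Union>i\<in>R. B i) \<inter> (\<Union>i\<in>S. B i) = {}" by (simp add: Int_UN_distrib2)
    then have "(\<Union>i\<in>R. B i) \<inter> closure (\<Union>i\<in>S. B i) = {}"
      using open_Int_closure_eq_empty[OF op[of R], of "\<Union>i\<in>S. B i"] by simp
    then have "closure (\<Union>i\<in>R. B i) \<inter> closure (\<Union>i\<in>S. B i) = {}"
      using open_Int_closure_eq_empty[OF open_closure[OF op[of S]], of "\<Union>i\<in>R. B i"]
        by (simp add: Int_commute)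
    then have "indicat_real (closure (\<Union>i\<in>R \<union> S. B i)) =
      (\<lambda>x. indicat_real (closure (\<Union>i\<in>R. B i)) x + indicat_real (closure (\<Union>i\<in>S. B i)) x)"
      unfolding UN_Un closure_Un by (rule indicat_real_disjoint_Un)
    then show ?thesis by (simp only:) (rule variation_superadditive[where R=1],
      auto simp: indicator_def)
  qed
  show "variation (\<lambda>f. apply_bcontfun (T f) (y n)) (indicat_real (closure (\<Union>i\<in>UNIV. B i))) \<le> norm T"
    using variation_le[of "indicat_real (closure (\<Union>i\<in>UNIV. B i))" 1] by (auto simp: indicator_def)
qed

text \<open>
  On the copy of the bounded sequences that is spanned by the functions \<open>f k\<close>, the value of \<open>T\<close> at
  the point \<open>y (e k)\<close> is \<open>a k * u k\<close> up to an error: the rest of \<open>a\<close> lives on the closure of the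
  union of the other sets, where the variation at \<open>y (e k)\<close> is below \<open>d / 32\<close>. As
  \<open>\<bar>u k\<bar> > d / 16\<close>, the composition \<open>Z\<close> differs from the identity by at most one half in norm, and
  its inverse \<open>Y\<close> completes the factorization.
\<close>

lemma factors_identity:
  fixes T :: "('l \<Rightarrow>\<^sub>C 'k) \<Rightarrow>\<^sub>L ('l \<Rightarrow>\<^sub>C 'k)"
  defines "d \<equiv> weak_essential_norm cscale T"
  assumes T: "T \<in> bounded_ops cscale" and d: "d > 0"
  shows "\<exists>(U :: ('l \<Rightarrow>\<^sub>C 'k) \<Rightarrow>\<^sub>L (nat \<Rightarrow>\<^sub>C 'k)) V.
    (\<forall>c f. blinfun_apply U (cscale c f) = cscale c (blinfun_apply U f)) \<and>
    (\<forall>c a. blinfun_apply V (cscale c a) = cscale c (blinfun_apply V a)) \<and>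
    norm U \<le> 16 \<and> norm V \<le> 2 \<and> (\<forall>a. blinfun_apply U (blinfun_apply T (blinfun_apply V a)) = d *\<^sub>R
      a)"
proof -
  interpret scalar_functional "\<lambda>f. apply_bcontfun (T f) x" "norm T" for x
    using T by (rule scalar_functional_eval)
  obtain B :: "nat \<Rightarrow> 'l set" and y where B: "disjoint_family B" "\<And>k. open (B k)" "\<And>k. closed (B k)"
      "\<And>k. d / 8 \<le> variation (\<lambda>f. apply_bcontfun (T f) (y k)) (indicat_real (B k))"
    using disjoint_masses[OF T] d unfolding d_def by blast
  (* The mass of B k is at least d / 8, so a function on B k reaches more than d / 16. Errors
     of at most half of this amount are tolerable. *)
  obtain M where M: "infinite M"
      "\<And>n. n \<in> M \<Longrightarrow> variation (\<lambda>f. apply_bcontfun (T f) (y n))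
        (indicat_real (closure (\<Union>i\<in>M - {n}. B i))) < d / 32"
    using Rosenthal_subsequence[OF T B(1,2), of "d / 32" y] d by auto
  define e where "e = enumerate M"
  have e: "e k \<in> M" "e j = e k \<longleftrightarrow> j = k" for j k
    unfolding e_def by (rule enumerate_in_set[OF M(1)], rule
      strict_mono_eq[OF strict_mono_enumerate[OF M(1)]])
  have "\<exists>f. (\<forall>x. norm (apply_bcontfun f x) \<le> indicat_real (B (e k)) x) \<and>
    d / 16 < norm (apply_bcontfun (T f) (y (e k)))" for k
    using B(4)[of "e k"] d by (intro variation_attained) auto
  then obtain f where f: "\<And>k x. norm (apply_bcontfun (f k) x) \<le> indicat_real (B (e k)) x"
      "\<And>k. d / 16 < norm (apply_bcontfun (T (f k)) (y (e k)))" by metis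
  have f1: "norm (apply_bcontfun (f k) x) \<le> 1" for k x
    by (rule order_trans[OF f(1)]) (simp add: indicator_def)
  have f0: "apply_bcontfun (f k) x = 0" if "x \<notin> B (e k)" for k x
    using f(1)[of k x] that by simp
  define u where "u k = apply_bcontfun (T (f k)) (y (e k))" for k
  have u: "d / 16 < norm (u k)" "u k \<noteq> 0" for k
  proof -
    show "d / 16 < norm (u k)" using f(2)[of k] by (simp add: u_def)
    then show "u k \<noteq> 0" using d by auto
  qed
  have inv_u: "norm (of_real d / u k) \<le> 16" for k
  proof -
    have "0 < norm (u k)" using u(2)[of k] by simp
    then show ?thesis using u(1)[of k] d by (simp add: norm_divide pos_divide_le_eq)
  qed
  have "disjoint_family (\<lambda>k. B (e k))" using B(1) by (simp add: disjoint_family_on_def e(2))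
  from gluing_operator[OF B(2) this, of "\<lambda>k. apply_bcontfun (f k)",
    OF continuous_on_apply_bcontfun f1]
  obtain V\<^sub>0 :: "(nat \<Rightarrow>\<^sub>C 'k) \<Rightarrow>\<^sub>L ('l \<Rightarrow>\<^sub>C 'k)"
    where V0: "\<forall>c a. blinfun_apply V\<^sub>0 (cscale c a) = cscale c (blinfun_apply V\<^sub>0 a)" "norm V\<^sub>0 \<le> 1"
      "\<forall>a n. \<forall>x\<in>B (e n). blinfun_apply V\<^sub>0 a x = a n * f n x"
        "\<forall>a x. x \<notin> closure (\<Union>n. B (e n)) \<longrightarrow> blinfun_apply V\<^sub>0 a x = 0"
    by (elim exE conjE) (rule that)
  have V0_norm: "norm (V\<^sub>0 a) \<le> norm a" for a
    using norm_blinfun[of V\<^sub>0 a] mult_right_mono[OF V0(2), of "norm a"] by simp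
  have err: "norm (apply_bcontfun (T (V\<^sub>0 a)) (y (e k)) - a k * u k) \<le> norm a * (d / 32)" for a k
  proof -
    define C where "C = closure (\<Union>i\<in>M - {e k}. B i)"
    define h where "h = V\<^sub>0 a - cscale (a k) (f k)"
    have "norm (apply_bcontfun h x) \<le> norm a * indicat_real C x" for x
    proof (cases "x \<in> B (e k)")
      case True
      then have "apply_bcontfun h x = 0" using V0(3) by (simp add: h_def)
      then show ?thesis by simp
    next
      case nB: False
      then have hx: "apply_bcontfun h x = V\<^sub>0 a x" by (simp add: h_def f0)
      show ?thesis
      proof (cases "x \<in> C")
        case True
        then show ?thesis using norm_bounded[of "V\<^sub>0 a" x] V0_norm[of a] hx by simp
      next
        case False
        have "B (e n) \<subseteq> B (e k) \<union> (\<Union>i\<in>M - {e k}. B i)" for n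
          using e(1)[of n] by (cases "e n = e k") auto
        then have "(\<Union>n. B (e n)) \<subseteq> B (e k) \<union> (\<Union>i\<in>M - {e k}. B i)" by (rule UN_least)
        then have "closure (\<Union>n. B (e n)) \<subseteq> closure (B (e k) \<union> (\<Union>i\<in>M - {e k}. B i))"
          by (rule closure_mono)
        also have "\<dots> = B (e k) \<union> C" using B(3) by (simp add: C_def)
        finally have "x \<notin> closure (\<Union>n. B (e n))" using nB False by blast
        then show ?thesis using V0(4) hx by simp
      qed
    qed
    then have "norm (apply_bcontfun (T h) (y (e k))) \<le>
      variation (\<lambda>f. apply_bcontfun (T f) (y (e k))) (\<lambda>x. norm a * indicat_real C x)"
      by (rule variation_upper[where R="norm a"]) (simp add: indicator_def)
    also have "\<dots> = norm a * variation (\<lambda>f. apply_bcontfun (T f) (y (e k))) (indicat_real C)"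
      by (rule variation_scale[where R=1]) (auto simp: indicator_def)
    also have "\<dots> \<le> norm a * (d / 32)"
      using M(2)[OF e(1), of k] by (intro mult_left_mono) (auto simp: C_def)
    finally have "norm (apply_bcontfun (T h) (y (e k))) \<le> norm a * (d / 32)" .
    moreover have "apply_bcontfun (T h) (y (e k)) =
      apply_bcontfun (T (V\<^sub>0 a)) (y (e k)) - a k * u k"
      using scale[of "a k" "f k"] by (simp add: h_def u_def blinfun.diff_right)
    ultimately show ?thesis by simp
  qed

  define U\<^sub>0 where "U\<^sub>0 g = Bcontfun (\<lambda>k. (of_real d / u k) * apply_bcontfun g (y (e k)))"
    for g :: "'l \<Rightarrow>\<^sub>C 'k"
  have U0_le: "norm ((of_real d / u k) * apply_bcontfun g (y (e k))) \<le> 16 * norm g"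
    for g :: "'l \<Rightarrow>\<^sub>C 'k" and k
    unfolding norm_mult by (intro mult_mono inv_u norm_bounded) auto
  have U0: "apply_bcontfun (U\<^sub>0 g) k = (of_real d / u k) * apply_bcontfun g (y (e k))" for g k
    unfolding U\<^sub>0_def by (subst apply_Bcontfun_sequence[OF U0_le]) (rule refl)
  have U0_norm: "norm (U\<^sub>0 g) \<le> 16 * norm g" for g
    by (rule norm_bound) (unfold U0, rule U0_le)
  have bl: "bounded_linear U\<^sub>0"
  proof (rule bounded_linear_intro)
    show "U\<^sub>0 (g + h) = U\<^sub>0 g + U\<^sub>0 h" for g h by (rule bcontfun_eqI) (simp add: U0 distrib_left)
    show "U\<^sub>0 (r *\<^sub>R g) = r *\<^sub>R U\<^sub>0 g" for r g by (rule bcontfun_eqI) (simp add: U0)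
    show "norm (U\<^sub>0 g) \<le> norm g * 16" for g using U0_norm[of g] by simp
  qed
  define U where "U = Blinfun U\<^sub>0"
  have U: "blinfun_apply U = U\<^sub>0" unfolding U_def by (rule bounded_linear_Blinfun_apply[OF bl])
  define Z where "Z = (1/d) *\<^sub>R (U o\<^sub>L T o\<^sub>L V\<^sub>0)"
  have Zk: "apply_bcontfun (Z a) k = (1 / u k) * apply_bcontfun (T (V\<^sub>0 a)) (y (e k))" for a k
    using d by (simp add: Z_def blinfun.scaleR_left U U0 scaleR_conv_of_real)
  have near: "norm (Z a - a) \<le> norm a / 2" for a
  proof (rule norm_bound)
    fix k
    have "apply_bcontfun (Z a - a) k = (1 / u k) *
      (apply_bcontfun (T (V\<^sub>0 a)) (y (e k)) - a k * u k)"
      using u(2)[of k] by (simp add: Zk field_simps)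
    then have "norm (apply_bcontfun (Z a - a) k) =
      norm (1 / u k) * norm (apply_bcontfun (T (V\<^sub>0 a)) (y (e k)) - a k * u k)"
      by (simp only: norm_mult)
    also have "\<dots> \<le> (16 / d) * (norm a * (d / 32))"
    proof (intro mult_mono err)
      have "0 < norm (u k)" using u(2)[of k] by simp
      then show "norm (1 / u k) \<le> 16 / d" using u(1)[of k] d by (simp add: norm_divide divide_simps)
    qed (use d in auto)
    also have "\<dots> = norm a / 2" using d by simp
    finally show "norm (apply_bcontfun (Z a - a) k) \<le> norm a / 2" .
  qed
  obtain Y where Y: "Z o\<^sub>L Y = id_blinfun" "Y o\<^sub>L Z = id_blinfun" "norm Y \<le> 2"
    using near_identity_invertible[OF complete_bcontfun near] by blast
  have ZY: "Z (Y a) = a" "Y (Z a) = a" for a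
    using Y(1,2) by (metis blinfun_apply_blinfun_compose id_blinfun.rep_eq)+
  have Tc: "T (cscale c f) = cscale c (T f)" for c f using T by (simp add: bounded_ops_def)
  have Zc: "Z (cscale c a) = cscale c (Z a)" for c a
    by (rule bcontfun_eqI) (simp add: Zk V0(1) Tc)
  have Yc: "Y (cscale c a) = cscale c (Y a)" for c a
    by (metis ZY Zc)
  define V where "V = V\<^sub>0 o\<^sub>L Y"
  have "norm V \<le> norm V\<^sub>0 * norm Y" unfolding V_def by (rule norm_blinfun_compose)
  also have "\<dots> \<le> 1 * 2" by (intro mult_mono V0 Y) auto
  finally have "norm V \<le> 2" by simp
  moreover have "norm U \<le> 16" by (rule norm_blinfun_bound) (simp_all add: U U0_norm)
  moreover have "U (cscale c g) = cscale c (U g)" for c g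
    by (rule bcontfun_eqI) (simp add: U U0)
  moreover have "V (cscale c a) = cscale c (V a)" for c a by (simp add: V_def Yc V0(1))
  moreover have "U (T (V a)) = d *\<^sub>R a" for a
  proof -
    have "d *\<^sub>R a = d *\<^sub>R Z (Y a)" by (simp add: ZY)
    also have "\<dots> = U (T (V a))" using d by (simp add: Z_def V_def blinfun.scaleR_left)
    finally show ?thesis by simp
  qed
  ultimately show ?thesis by blast
qed

end

section \<open>Algebra norms on the weak Calkin algebra\<close>

lemma uminus_weakly_compact:
  fixes W :: "('a::topological_space \<Rightarrow>\<^sub>C 'k::real_normed_field) \<Rightarrow>\<^sub>L ('a \<Rightarrow>\<^sub>C 'k)"
  assumes "W \<in> weakly_compact_ops cscale"
  shows "- W \<in> weakly_compact_ops cscale"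
proof -
  have "- W = op_scale cscale (- 1) W"
    by (rule blinfun_eqI, rule bcontfun_eqI) (simp add: op_scale_cscale_apply blinfun.minus_left)
  then show ?thesis using weakly_compact_op_scale[OF assms] by metis
qed

lemma op_scale_of_real: "op_scale cscale (of_real r) T = r *\<^sub>R T"
  by (rule blinfun_eqI) (simp add: op_scale_cscale_apply cscale_of_real blinfun.scaleR_left)

lemma op_scale_add: "op_scale cscale c (S + T) = op_scale cscale c S + op_scale cscale c T"
  by (rule blinfun_eqI) (simp add: op_scale_cscale_apply blinfun.add_left cscale_add)

lemma weak_coset_absorb:
  fixes W T :: "('a::topological_space \<Rightarrow>\<^sub>C 'k::real_normed_field) \<Rightarrow>\<^sub>L ('a \<Rightarrow>\<^sub>C 'k)"
  assumes "W \<in> weakly_compact_ops cscale"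
  shows "weak_coset cscale (W + T) = weak_coset cscale T"
proof -
  have "V + (W + T) = (V + W) + T" "V + T = (V + - W) + (W + T)" for V by simp_all
  then show ?thesis
    unfolding weak_coset_eq
    using weakly_compact_add[OF _ assms] weakly_compact_add[OF _ uminus_weakly_compact[OF assms]]
      by blast
qed

lemma self_in_weak_coset: "T \<in> weak_coset cscale
  (T :: ('a::topological_space \<Rightarrow>\<^sub>C 'k::real_normed_field) \<Rightarrow>\<^sub>L ('a \<Rightarrow>\<^sub>C 'k))"
  using zero_weakly_compact unfolding weak_coset_eq by force

text \<open>
  The product of two cosets is defined as the union of the cosets of all products of
  representatives. That these cosets coincide is the ideal property.
\<close>

lemma weak_calkin_mult:
  fixes S T :: "('a::topological_space \<Rightarrow>\<^sub>C 'k::real_normed_field) \<Rightarrow>\<^sub>L ('a \<Rightarrow>\<^sub>C 'k)"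
  assumes S: "S \<in> bounded_ops cscale" and T: "T \<in> bounded_ops cscale"
  shows "weak_coset cscale S \<otimes>\<^bsub>weak_calkin cscale\<^esub> weak_coset cscale T =
    weak_coset cscale (S o\<^sub>L T)"
proof -
  have "weak_coset cscale (A o\<^sub>L B) = weak_coset cscale (S o\<^sub>L T)"
    if "A \<in> weak_coset cscale S" "B \<in> weak_coset cscale T" for A B
  proof -
    obtain V W where V: "V \<in> weakly_compact_ops cscale" "A = V + S" and W:
      "W \<in> weakly_compact_ops cscale" "B = W + T"
      using \<open>A \<in> _\<close> \<open>B \<in> _\<close> by (auto simp: weak_coset_eq)
    have B: "B \<in> bounded_ops cscale"
      unfolding W(2) using W(1) T by (intro bounded_ops_add) (simp_all add: weakly_compact_ops_def)
    have "A o\<^sub>L B = ((V o\<^sub>L B) + (S o\<^sub>L W)) + (S o\<^sub>L T)"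
      by (rule blinfun_eqI) (simp add: V(2) W(2) blinfun.add_left blinfun.add_right)
    then show ?thesis
      using weak_coset_absorb[OF weakly_compact_add[OF weakly_compact_compose_right[OF V(1) B]
        weakly_compact_compose_left[OF W(1) S]]]
      by simp
  qed
  then have "(\<Union>A\<in>weak_coset cscale S. \<Union>B\<in>weak_coset cscale T. weak_coset cscale (A o\<^sub>L B)) =
    weak_coset cscale (S o\<^sub>L T)"
    using self_in_weak_coset[of S] self_in_weak_coset[of T] by blast
  moreover have "weak_coset cscale S \<otimes>\<^bsub>weak_calkin cscale\<^esub> weak_coset cscale T =
      (\<Union>A\<in>weak_coset cscale S. \<Union>B\<in>weak_coset cscale T. weak_coset cscale (A o\<^sub>L B))"
    by (simp add: weak_calkin_def Let_def FactRing_def rcoset_mult_def weak_coset_def op_ring_def)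
  ultimately show ?thesis by simp
qed

lemma weak_calkin_smult:
  fixes T :: "('a::topological_space \<Rightarrow>\<^sub>C 'k::real_normed_field) \<Rightarrow>\<^sub>L ('a \<Rightarrow>\<^sub>C 'k)"
  shows "c \<odot>\<^bsub>weak_calkin cscale\<^esub> weak_coset cscale T = weak_coset cscale (op_scale cscale c T)"
proof -
  have "weak_coset cscale (op_scale cscale c A) = weak_coset cscale (op_scale cscale c T)" if A:
    "A \<in> weak_coset cscale T" for A
  proof -
    obtain V where V: "V \<in> weakly_compact_ops cscale" "A = V + T" using A
      by (auto simp: weak_coset_eq)
    show ?thesis unfolding V(2) op_scale_add
      by (rule weak_coset_absorb[OF weakly_compact_op_scale[OF V(1)]])
  qed
  then have "(\<Union>A\<in>weak_coset cscale T. weak_coset cscale (op_scale cscale c A)) =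
    weak_coset cscale (op_scale cscale c T)"
    using self_in_weak_coset[of T] by blast
  then show ?thesis by (simp add: weak_calkin_def Let_def)
qed

lemma weak_calkin_zero: "\<zero>\<^bsub>weak_calkin s\<^esub> = weakly_compact_ops s"
  by (simp add: weak_calkin_def Let_def FactRing_def)

text \<open>
  From now on an algebra norm is used only through its values \<open>n T\<close> on operators.
\<close>

lemma algebra_norm_on_operators:
  fixes N :: "(('a::topological_space \<Rightarrow>\<^sub>C 'k::real_normed_field) \<Rightarrow>\<^sub>L ('a \<Rightarrow>\<^sub>C 'k)) set \<Rightarrow> real"
  defines "n \<equiv> \<lambda>T. N (weak_coset cscale T)"
  assumes N: "algebra_norm (weak_calkin cscale) N"
  shows "T \<in> bounded_ops cscale \<Longrightarrow> 0 \<le> n T"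
    and "S \<in> bounded_ops cscale \<Longrightarrow> T \<in> bounded_ops cscale \<Longrightarrow> n (S o\<^sub>L T) \<le> n S * n T"
    and "T \<in> bounded_ops cscale \<Longrightarrow> n (r *\<^sub>R T) = \<bar>r\<bar> * n T"
    and "T \<in> bounded_ops cscale \<Longrightarrow> n T = 0 \<Longrightarrow> T \<in> weakly_compact_ops cscale"
proof -
  assume T: "T \<in> bounded_ops cscale"
  then have carr: "weak_coset cscale T \<in> carrier (weak_calkin cscale)"
    by (simp add: carrier_weak_calkin)
  show "0 \<le> n T" using N carr by (simp add: algebra_norm_def n_def)
  have "N (of_real r \<odot>\<^bsub>weak_calkin cscale\<^esub> weak_coset cscale T) =
    norm (of_real r :: 'k) * N (weak_coset cscale T)"
    using N carr unfolding algebra_norm_def by blast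
  then show "n (r *\<^sub>R T) = \<bar>r\<bar> * n T"
    by (simp add: weak_calkin_smult op_scale_of_real n_def)
  show "T \<in> weakly_compact_ops cscale" if "n T = 0"
  proof -
    have "weak_coset cscale T = \<zero>\<^bsub>weak_calkin cscale\<^esub>" using N carr that
      unfolding algebra_norm_def n_def by blast
    then show ?thesis using self_in_weak_coset[of T] by (simp add: weak_calkin_zero)
  qed
  show "n (S o\<^sub>L T) \<le> n S * n T" if S: "S \<in> bounded_ops cscale"
  proof -
    have "weak_coset cscale S \<in> carrier (weak_calkin cscale)" using S
      by (simp add: carrier_weak_calkin)
    then have "N (weak_coset cscale S \<otimes>\<^bsub>weak_calkin cscale\<^esub> weak_coset cscale T) \<le>
      N (weak_coset cscale S) * N (weak_coset cscale T)"
      using N carr unfolding algebra_norm_def by blast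
    then show ?thesis by (simp add: weak_calkin_mult[OF S T] n_def)
  qed
qed

section \<open>Double sequences\<close>

text \<open>
  The rearrangements of bounded sequences that are needed below are all of this form.
\<close>

definition weighted_composition :: "(nat \<Rightarrow> 'k::real_normed_field) \<Rightarrow> (nat \<Rightarrow> nat) \<Rightarrow> (nat \<Rightarrow>\<^sub>C 'k) \<Rightarrow>\<^sub>L
  (nat \<Rightarrow>\<^sub>C 'k)"
  where "weighted_composition w \<sigma> = Blinfun (\<lambda>a. Bcontfun (\<lambda>k. w k * apply_bcontfun a (\<sigma> k)))"

lemma weighted_composition:
  assumes w: "\<And>k. norm (w k) \<le> M"
  shows "apply_bcontfun (blinfun_apply (weighted_composition w \<sigma>) a) k =
    w k * apply_bcontfun a (\<sigma> k)"
proof -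
  have M: "0 \<le> M" using w[of 0] norm_ge_zero order_trans by blast
  have le: "norm (w k * apply_bcontfun a (\<sigma> k)) \<le> norm a * M" for a k
    unfolding norm_mult mult.commute[of "norm (w k)"] by (intro mult_mono norm_bounded w) auto
  define G where "G a = Bcontfun (\<lambda>k. w k * apply_bcontfun a (\<sigma> k))" for a
  have G: "apply_bcontfun (G a) k = w k * apply_bcontfun a (\<sigma> k)" for a k
    unfolding G_def by (subst apply_Bcontfun_sequence[OF le]) (rule refl)
  have "bounded_linear G"
  proof (rule bounded_linear_intro[where K=M])
    show "norm (G a) \<le> norm a * M" for a by (rule norm_bound) (simp only: G le)
    show "G (a + b) = G a + G b" for a b by (rule bcontfun_eqI) (simp add: G distrib_left)
    show "G (r *\<^sub>R a) = r *\<^sub>R G a" for r a by (rule bcontfun_eqI) (simp add: G)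
  qed
  then show ?thesis
    unfolding weighted_composition_def G_def[symmetric]
      by (simp add: bounded_linear_Blinfun_apply G)
qed

definition scalar_linear :: "(('a::topological_space \<Rightarrow>\<^sub>C 'k::real_normed_field) \<Rightarrow>\<^sub>L
  ('b::topological_space \<Rightarrow>\<^sub>C 'k)) \<Rightarrow> bool"
  where "scalar_linear F \<longleftrightarrow> (\<forall>c f. blinfun_apply F (cscale c f) = cscale c (blinfun_apply F f))"

lemma scalar_linear_compose: "scalar_linear F \<Longrightarrow> scalar_linear G \<Longrightarrow> scalar_linear (F o\<^sub>L G)"
  by (simp add: scalar_linear_def)

lemma bounded_ops_iff: "T \<in> bounded_ops cscale \<longleftrightarrow> scalar_linear T"
  by (simp add: bounded_ops_def scalar_linear_def)

lemma scalar_linear_weighted_composition: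
  assumes "\<And>k. norm (w k) \<le> M"
  shows "scalar_linear (weighted_composition w \<sigma>)"
  unfolding scalar_linear_def
  by (intro allI bcontfun_eqI) (simp add: weighted_composition[OF assms])

text \<open>
  A sequence \<open>a\<close> is read as the double sequence \<open>(i, k) \<mapsto> a (prod_encode (i, k))\<close>.
\<close>

definition seq_row :: "nat \<Rightarrow> (nat \<Rightarrow>\<^sub>C 'k::real_normed_field) \<Rightarrow>\<^sub>L (nat \<Rightarrow>\<^sub>C 'k)"
  where "seq_row m = weighted_composition (\<lambda>_. 1) (\<lambda>k. prod_encode (m, k))"

definition embed_row :: "nat \<Rightarrow> (nat \<Rightarrow>\<^sub>C 'k::real_normed_field) \<Rightarrow>\<^sub>L (nat \<Rightarrow>\<^sub>C 'k)"
  where "embed_row m = weighted_composition (\<lambda>j. if fst (prod_decode j) =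
    m then 1 else 0) (\<lambda>j. snd (prod_decode j))"

text \<open>
  The factor 2 makes up for the weights \<open>2\<^sup>-\<^sup>m\<close> that \<open>amalgamate_sources\<close> needs for convergence.
\<close>

definition rows_down :: "(nat \<Rightarrow>\<^sub>C 'k::real_normed_field) \<Rightarrow>\<^sub>L (nat \<Rightarrow>\<^sub>C 'k)"
  where "rows_down = weighted_composition (\<lambda>_. 2)
    (\<lambda>j. prod_encode (Suc (fst (prod_decode j)), snd (prod_decode j)))"

definition rows_up :: "(nat \<Rightarrow>\<^sub>C 'k::real_normed_field) \<Rightarrow>\<^sub>L (nat \<Rightarrow>\<^sub>C 'k)"
  where "rows_up = weighted_composition (\<lambda>j. if fst (prod_decode j) = 0 then 0 else 1)
    (\<lambda>j. prod_encode (fst (prod_decode j) - 1, snd (prod_decode j)))"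

lemma row_apply: "apply_bcontfun (blinfun_apply (seq_row m) a) k =
  apply_bcontfun a (prod_encode (m, k))"
  unfolding seq_row_def by (subst weighted_composition[where M=1]) auto

lemma embed_row_apply:
  "apply_bcontfun (blinfun_apply (embed_row m) b) (prod_encode (i, k)) =
    (if i = m then apply_bcontfun b k else 0)"
  unfolding embed_row_def by (subst weighted_composition[where M=1]) auto

lemma rows_down_apply:
  "apply_bcontfun (blinfun_apply rows_down a) (prod_encode (i, k)) =
    2 * apply_bcontfun a (prod_encode (Suc i, k))"
  unfolding rows_down_def by (subst weighted_composition[where M=2]) auto

lemma rows_up_apply:
  "apply_bcontfun (blinfun_apply rows_up a) (prod_encode (i, k)) =
    (case i of 0 \<Rightarrow> 0 | Suc i' \<Rightarrow> apply_bcontfun a (prod_encode (i', k)))"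
  unfolding rows_up_def by (subst weighted_composition[where M=1]) (auto split: nat.splits)

lemma scalar_linear_rows:
  "scalar_linear (seq_row m)" "scalar_linear (embed_row m)" "scalar_linear rows_down"
    "scalar_linear rows_up"
  unfolding seq_row_def embed_row_def rows_down_def rows_up_def
  by (rule scalar_linear_weighted_composition[where M=2]; simp)+

lemma matrix_eqI:
  assumes "\<And>i k. apply_bcontfun a (prod_encode (i, k)) = apply_bcontfun b (prod_encode (i, k))"
  shows "a = b"
proof (rule bcontfun_eqI)
  fix j
  show "apply_bcontfun a j = apply_bcontfun b j"
    using assms[of "fst (prod_decode j)" "snd (prod_decode j)"] by simp
qed

lemma row_embed_row: "seq_row m (embed_row i b) = (if m = i then b else 0)"
  by (rule bcontfun_eqI) (simp add: row_apply embed_row_apply)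

lemma row_rows_down: "seq_row 0 ((blinfun_apply rows_down ^^ m) a) = 2 ^ m *\<^sub>R seq_row m a"
proof -
  have "apply_bcontfun ((blinfun_apply rows_down ^^ m) a) (prod_encode (i, k)) =
    2 ^ m * apply_bcontfun a (prod_encode (m + i, k))" for i k
    by (induction m arbitrary: i) (simp_all add: rows_down_apply)
  then show ?thesis by (intro bcontfun_eqI) (simp add: row_apply scaleR_conv_of_real)
qed

lemma rows_up_embed_row: "(blinfun_apply rows_up ^^ m) (embed_row 0 b) = embed_row m b"
proof (induction m)
  case (Suc m)
  have "rows_up (embed_row m b) = embed_row (Suc m) b"
    by (rule matrix_eqI) (simp add: rows_up_apply embed_row_apply split: nat.split)
  then show ?case using Suc by simp
qed simp

lemma norm_row_le: "norm (seq_row m a) \<le> norm a"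
  by (rule norm_bound) (simp add: row_apply norm_bounded)

lemma amalgamate_targets:
  fixes U :: "nat \<Rightarrow> ('a::topological_space \<Rightarrow>\<^sub>C 'k::real_normed_field) \<Rightarrow>\<^sub>L (nat \<Rightarrow>\<^sub>C 'k)"
  assumes lin: "\<And>m. scalar_linear (U m)" and C: "\<And>m. norm (U m) \<le> C"
  shows "\<exists>U'. scalar_linear U' \<and> (\<forall>m f. seq_row m (blinfun_apply U' f) = blinfun_apply (U m) f)"
proof -
  define F where "F f = Bcontfun (\<lambda>j. apply_bcontfun (U (fst (prod_decode j)) f)
    (snd (prod_decode j)))" for f
  have le: "norm (apply_bcontfun (U m f) k) \<le> norm f * C" for m f k
  proof -
    have "norm (apply_bcontfun (U m f) k) \<le> norm (U m) * norm f"
      using norm_bounded norm_blinfun order_trans by blast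
    also have "\<dots> \<le> C * norm f" by (intro mult_right_mono C) simp
    finally show ?thesis by (simp add: mult.commute)
  qed
  have F: "apply_bcontfun (F f) j = apply_bcontfun (U (fst (prod_decode j)) f)
    (snd (prod_decode j))" for f j
    unfolding F_def by (subst apply_Bcontfun_sequence[OF le]) (rule refl)
  have bl: "bounded_linear F"
  proof (rule bounded_linear_intro)
    show "F (f + g) = F f + F g" for f g by (rule bcontfun_eqI) (simp add: F blinfun.add_right)
    show "F (r *\<^sub>R f) = r *\<^sub>R F f" for r f by (rule bcontfun_eqI) (simp add: F blinfun.scaleR_right)
    show "norm (F f) \<le> norm f * C" for f by (rule norm_bound) (simp add: F le)
  qed
  have app: "blinfun_apply (Blinfun F) = F" by (rule bounded_linear_Blinfun_apply[OF bl])
  have "scalar_linear (Blinfun F)"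
    unfolding scalar_linear_def app
    by (intro allI bcontfun_eqI) (use lin in \<open>simp add: F scalar_linear_def\<close>)
  moreover have "seq_row m (Blinfun F f) = U m f" for m f
    by (rule bcontfun_eqI) (simp add: app F row_apply)
  ultimately show ?thesis by blast
qed

text \<open>
  The operator is \<open>a \<mapsto> \<Sum>m. 2\<^sup>-\<^sup>m V m (row m of a)\<close>.
\<close>

lemma amalgamate_sources:
  fixes V :: "nat \<Rightarrow> (nat \<Rightarrow>\<^sub>C 'k::{real_normed_field,banach}) \<Rightarrow>\<^sub>L ('a::topological_space \<Rightarrow>\<^sub>C 'k)"
  assumes lin: "\<And>m. scalar_linear (V m)" and C: "\<And>m. norm (V m) \<le> C"
  shows "\<exists>V'. scalar_linear V' \<and> (\<forall>m b. blinfun_apply V' (embed_row m b) =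
    (1/2) ^ m *\<^sub>R blinfun_apply (V m) b)"
proof -
  have C0: "0 \<le> C" using C[of 0] norm_ge_zero order_trans by blast
  define t where "t a m x = (1/2) ^ m *\<^sub>R apply_bcontfun (V m (seq_row m a)) x" for a m x
  have t_le: "norm (t a m x) \<le> (1/2) ^ m * (C * norm a)" for a m x
  proof -
    have "norm (apply_bcontfun (V m (seq_row m a)) x) \<le> norm (V m) * norm (seq_row m a)"
      using norm_bounded norm_blinfun order_trans by blast
    also have "\<dots> \<le> C * norm a" using C0 by (intro mult_mono C norm_row_le) auto
    finally show ?thesis unfolding t_def by (simp add: mult_left_mono)
  qed
  have geo: "summable (\<lambda>m. (1/2) ^ m * (C * norm a))" for a :: "nat \<Rightarrow>\<^sub>C 'k"
    by (intro summable_mult2 summable_geometric) simp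
  have t_sum: "summable (\<lambda>m. t a m x)" for a x
    by (rule summable_comparison_test'[OF geo[of a], of 0]) (rule t_le)
  have sum_le: "norm (\<Sum>m. t a m x) \<le> norm a * (2 * C)" for a x
  proof -
    have "norm (\<Sum>m. t a m x) \<le> (\<Sum>m. (1/2) ^ m * (C * norm a))"
      by (rule norm_suminf_le[OF t_le geo])
    also have "\<dots> = (\<Sum>m. (1/2) ^ m) * (C * norm a)"
      by (rule suminf_mult2[symmetric]) (simp add: summable_geometric)
    also have "\<dots> = norm a * (2 * C)" by (simp add: suminf_geometric)
    finally show ?thesis .
  qed
  define G where "G a = Bcontfun (\<lambda>x. \<Sum>m. t a m x)" for a
  have G: "apply_bcontfun (G a) x = (\<Sum>m. t a m x)" for a x
  proof -
    have "uniform_limit UNIV (\<lambda>n x. \<Sum>m<n. t a m x) (\<lambda>x. \<Sum>m. t a m x) sequentially"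
      by (rule Weierstrass_m_test[OF t_le geo])
    then have "continuous_on UNIV (\<lambda>x. \<Sum>m. t a m x)"
      by (rule uniform_limit_theorem[rotated])
        (auto simp: t_def intro!: always_eventually continuous_intros)
    then have "(\<lambda>x. \<Sum>m. t a m x) \<in> bcontfun" using sum_le by (rule bcontfun_normI)
    then show ?thesis by (simp add: G_def Bcontfun_inverse)
  qed
  have bl: "bounded_linear G"
  proof (rule bounded_linear_intro)
    show "G (a + b) = G a + G b" for a b
    proof (rule bcontfun_eqI)
      fix x
      have "t (a + b) m x = t a m x + t b m x" for m
        by (simp add: t_def blinfun.add_right scaleR_add_right)
      then show "apply_bcontfun (G (a + b)) x = apply_bcontfun (G a + G b) x"
        by (simp add: G suminf_add[OF t_sum t_sum])
    qed
    show "G (r *\<^sub>R a) = r *\<^sub>R G a" for r a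
    proof (rule bcontfun_eqI)
      fix x
      have "t (r *\<^sub>R a) m x = r *\<^sub>R t a m x" for m by (simp add: t_def blinfun.scaleR_right)
      then show "apply_bcontfun (G (r *\<^sub>R a)) x = apply_bcontfun (r *\<^sub>R G a) x"
        by (simp add: G suminf_scaleR_right[OF t_sum])
    qed
    show "norm (G a) \<le> norm a * (2 * C)" for a by (rule norm_bound) (simp only: G sum_le)
  qed
  have app: "blinfun_apply (Blinfun G) = G" by (rule bounded_linear_Blinfun_apply[OF bl])
  have "scalar_linear (Blinfun G)"
    unfolding scalar_linear_def app
  proof (intro allI bcontfun_eqI)
    fix c a x
    have "t (cscale c a) m x = c * t a m x" for m
      using lin[of m] scalar_linear_rows(1)[of m, where 'a='k]
        by (simp add: t_def scalar_linear_def)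
    then show "apply_bcontfun (G (cscale c a)) x = apply_bcontfun (cscale c (G a)) x"
      by (simp add: G suminf_mult[OF t_sum])
  qed
  moreover have "Blinfun G (embed_row m b) = (1/2) ^ m *\<^sub>R V m b" for m b
  proof (rule bcontfun_eqI)
    fix x
    have "(\<Sum>i. t (embed_row m b) i x) = (\<Sum>i\<in>{m}. t (embed_row m b) i x)"
      by (rule suminf_finite) (auto simp: t_def row_embed_row)
    then show "apply_bcontfun (Blinfun G (embed_row m b)) x =
      apply_bcontfun ((1/2) ^ m *\<^sub>R V m b) x"
      by (simp add: app G t_def row_embed_row)
  qed
  ultimately show ?thesis by blast
qed

section \<open>A complemented copy of the bounded sequences\<close>

context extremally_disconnected_compact
begin

text \<open>
  A weak cluster point \<open>g\<close> of the functions \<open>h m\<close> would be equal to 1 at all points \<open>y k\<close>, hence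
  also at an accumulation point \<open>z\<close> of these points. But all \<open>h m\<close> vanish at \<open>z\<close>. The proof turns
  this into an open cover without a finite subcover.
\<close>

lemma not_weakly_compact:
  fixes E :: "('l \<Rightarrow>\<^sub>C 'k::real_normed_field) \<Rightarrow>\<^sub>L ('l \<Rightarrow>\<^sub>C 'k)"
  assumes y: "inj y" and h: "\<And>m. norm (h m) \<le> 1" "\<And>m. E (h m) = h m"
    and h_eval: "\<And>m k :: nat. apply_bcontfun (h m) (y k) = (if k \<le> m then 1 else 0)"
  shows "E \<notin> weakly_compact_ops cscale"
proof
  assume "E \<in> weakly_compact_ops cscale"
  then obtain K where K: "compactin (weak_topology cscale) K" "blinfun_apply E ` cball 0 1 \<subseteq> K"
    by (rule weakly_compact_opsE)
  have hK: "h m \<in> K" for m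
  proof -
    have "E (h m) \<in> K" using K(2) h(1)[of m] by auto
    then show ?thesis by (simp add: h(2))
  qed
  have "infinite (range y)" using y by (rule range_inj_infinite)
  then obtain z where z: "z islimpt range y"
    using Heine_Borel_imp_Bolzano_Weierstrass[OF compact_UNIV] by blast
  have tail: "z \<in> closure (y ` {m<..})" for m
  proof -
    have "UNIV = {..m} \<union> {m<..}" by auto
    then have "range y = y ` {..m} \<union> y ` {m<..}" by (metis image_Un)
    then have "z islimpt y ` {m<..}" using z by (simp add: islimpt_Un_finite)
    then show ?thesis by (simp add: closure_def)
  qed
  have closed_at: "g z \<in> C" if "closed C" "continuous_on UNIV g" "\<And>k. k > m \<Longrightarrow> g (y k) \<in> C"
    for g :: "'l \<Rightarrow> 'k" and C m
  proof -
    have "closed (g -` C)" using that(1,2)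
      by (simp add: continuous_closed_vimage continuous_on_eq_continuous_at)
    moreover have "y ` {m<..} \<subseteq> g -` C" using that(3) by auto
    ultimately show ?thesis using tail[of m] closure_minimal by blast
  qed
  have hz: "apply_bcontfun (h m) z = 0" for m
    using closed_at[of "{0}" "apply_bcontfun (h m)" m] by (simp add: h_eval)
  define V where "V = {g :: 'l \<Rightarrow>\<^sub>C 'k. 1/3 < norm (apply_bcontfun g z)}"
  define D where "D k = {g :: 'l \<Rightarrow>\<^sub>C 'k. 1/2 < norm (apply_bcontfun g (y k) - 1)}" for k
  have opn: "openin (weak_topology cscale) {g :: 'l \<Rightarrow>\<^sub>C 'k. apply_bcontfun g x \<in> S}" if "open S"
    for x and S :: "'k set"
    using continuous_map_weak_eval[where x=x and 'k='k] that by (simp add: continuous_map)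
  have "openin (weak_topology cscale) V"
    using opn[of "{c. 1/3 < norm c}" z] unfolding V_def
      by (simp add: open_Collect_less continuous_intros)
  moreover have "openin (weak_topology cscale) (D k)" for k
    using opn[of "{c. 1/2 < norm (c - 1)}" "y k"] unfolding D_def
      by (simp add: open_Collect_less continuous_intros)
  moreover have "K \<subseteq> \<Union> (insert V (range D))"
  proof
    fix g :: "'l \<Rightarrow>\<^sub>C 'k"
    have "g \<in> V" if "\<And>k. g \<notin> D k"
    proof -
      have "apply_bcontfun g z \<in> cball 1 (1/2)"
      proof (rule closed_at[where m=0])
        show "apply_bcontfun g (y k) \<in> cball 1 (1/2)" for k
          using that[of k] by (simp add: D_def not_less dist_norm norm_minus_commute)
      qed auto
      then have "norm (1 :: 'k) - norm (apply_bcontfun g z) \<le> 1/2"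
        using norm_triangle_ineq2[of 1 "apply_bcontfun g z"] by (simp add: dist_norm)
      then show ?thesis by (simp add: V_def)
    qed
    then show "g \<in> \<Union> (insert V (range D))" by blast
  qed
  ultimately have "\<exists>\<F>. finite \<F> \<and> \<F> \<subseteq> insert V (range D) \<and> K \<subseteq> \<Union>\<F>"
    by (intro compactinD[OF K(1)]) auto
  then obtain \<F> where \<F>: "finite \<F>" "\<F> \<subseteq> insert V (range D)" "K \<subseteq> \<Union>\<F>"
    by blast
  have "finite (\<F> - {V})" "\<F> - {V} \<subseteq> range D" using \<F> by auto
  then obtain C where C: "finite C" "\<F> - {V} = D ` C" by (metis finite_subset_image)
  obtain m where m: "\<And>k. k \<in> C \<Longrightarrow> k \<le> m" using C(1) finite_nat_set_iff_bounded_le by auto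
  have "h m \<notin> V" by (simp add: V_def hz)
  moreover have "h m \<notin> D k" if "k \<in> C" for k using m[OF that] by (simp add: D_def h_eval)
  moreover have "h m \<in> \<Union>\<F>" using hK \<F>(3) by blast
  ultimately show False using C(2) by blast
qed

end

context extremally_disconnected_compact
begin

text \<open>
  The embedding \<open>J\<close> glues multiples of the indicator functions of the sets \<open>B k\<close>, and \<open>Q\<close>
  evaluates at one point of each set. The functions \<open>J (ind m)\<close> show that the projection \<open>J o\<^sub>L Q\<close>
  is not weakly compact.
\<close>

lemma complemented_sequence_space:
  fixes B :: "nat \<Rightarrow> 'l set"
  assumes B: "disjoint_family B" "\<And>k. open (B k)" "\<And>k. B k \<noteq> {}"
  shows "\<exists>(J :: (nat \<Rightarrow>\<^sub>C 'k::{real_normed_field,euclidean_space}) \<Rightarrow>\<^sub>L ('l \<Rightarrow>\<^sub>C 'k)) Q.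
    scalar_linear J \<and> scalar_linear Q \<and>
    (\<forall>a. blinfun_apply Q (blinfun_apply J a) = a) \<and> J o\<^sub>L Q \<notin> weakly_compact_ops cscale"
proof -
  have "\<exists>p. \<forall>k. p k \<in> B k" using B(3) by (intro choice) blast
  then obtain p where p: "\<And>k. p k \<in> B k" by blast
  have pB: "p k \<in> B j \<longleftrightarrow> k = j" for j k
    using p B(1) by (metis UNIV_I disjoint_family_onD disjoint_iff)
  have "norm (1 :: 'k) \<le> 1" by simp
  from gluing_operator[OF B(2,1) continuous_on_const this]
  obtain J :: "(nat \<Rightarrow>\<^sub>C 'k) \<Rightarrow>\<^sub>L ('l \<Rightarrow>\<^sub>C 'k)"
    where J: "\<forall>c a. blinfun_apply J (cscale c a) = cscale c (blinfun_apply J a)" "norm J \<le> 1"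
      "\<forall>a n. \<forall>x\<in>B n. apply_bcontfun (blinfun_apply J a) x = apply_bcontfun a n * 1"
    by (elim exE conjE) (rule that)
  have Jp: "apply_bcontfun (J a) (p k) = a k" for a k using J(3) p by simp
  define F where "F f = Bcontfun (\<lambda>k. apply_bcontfun f (p k))" for f :: "'l \<Rightarrow>\<^sub>C 'k"
  have F: "apply_bcontfun (F f) k = apply_bcontfun f (p k)" for f k
    unfolding F_def by (subst apply_Bcontfun_sequence[OF norm_bounded]) (rule refl)
  have bl: "bounded_linear F"
  proof (rule bounded_linear_intro)
    show "F (f + g) = F f + F g" for f g by (rule bcontfun_eqI) (simp add: F)
    show "F (r *\<^sub>R f) = r *\<^sub>R F f" for r f by (rule bcontfun_eqI) (simp add: F)
    show "norm (F f) \<le> norm f * 1" for f by (rule norm_bound) (simp add: F norm_bounded)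
  qed
  define Q where "Q = Blinfun F"
  have Q: "apply_bcontfun (Q f) k = apply_bcontfun f (p k)" for f k
    unfolding Q_def bounded_linear_Blinfun_apply[OF bl] by (rule F)
  have QJ: "Q (J a) = a" for a by (rule bcontfun_eqI) (simp add: Q Jp)
  define ind :: "nat \<Rightarrow> nat \<Rightarrow>\<^sub>C 'k" where "ind m = Bcontfun (\<lambda>k. if k \<le> m then 1 else 0)" for m
  have ind: "apply_bcontfun (ind m) k = (if k \<le> m then 1 else 0)" for m k
    unfolding ind_def by (subst apply_Bcontfun_sequence[where M=1]) auto
  have ind_norm: "norm (ind m) \<le> 1" for m by (rule norm_bound) (simp add: ind)
  have "J o\<^sub>L Q \<notin> weakly_compact_ops cscale"
  proof (rule not_weakly_compact[of p "\<lambda>m. J (ind m)"])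
    show "inj p" using pB p by (metis injI)
    show "norm (J (ind m)) \<le> 1" for m
      using norm_blinfun[of J "ind m"] mult_mono[OF J(2) ind_norm[of m]] by simp
  qed (simp_all add: QJ Jp ind)
  moreover have "scalar_linear J" using J(1) by (simp add: scalar_linear_def)
  moreover have "scalar_linear Q" unfolding scalar_linear_def
    by (intro allI bcontfun_eqI) (simp add: Q)
  ultimately show ?thesis using QJ by blast
qed

end

section \<open>Minimality\<close>

context extremally_disconnected_scalars
begin

text \<open>
  The operators \<open>conj X\<close> let operators \<open>X\<close> on the bounded sequences act inside the space of
  continuous functions. All factors of the product \<open>factorization\<close> are independent of \<open>m\<close>, except
  for \<open>T m\<close> and for the powers contained in \<open>L\<^sub>m m\<close> and \<open>R\<^sub>m m\<close>. So \<open>n (T m)\<close> must not be much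
  smaller than \<open>\<omega> (T m)\<close> divided by the \<open>m\<close>-th power of a constant.
\<close>

theorem weak_essential_norm_minimal_scalars:
  "weak_essential_norm_minimal (cscale :: 'k \<Rightarrow> ('l \<Rightarrow>\<^sub>C 'k) \<Rightarrow> 'l \<Rightarrow>\<^sub>C 'k)"
  unfolding weak_essential_norm_minimal_def
proof (intro allI impI)
  fix N :: "(('l \<Rightarrow>\<^sub>C 'k) \<Rightarrow>\<^sub>L ('l \<Rightarrow>\<^sub>C 'k)) set \<Rightarrow> real"
  assume N: "algebra_norm (weak_calkin cscale) N"
  define n where "n T = N (weak_coset cscale T)" for T
  note n = algebra_norm_on_operators[OF N, folded n_def, unfolded bounded_ops_iff]
  define \<omega> where "\<omega> = (weak_essential_norm cscale :: (('l \<Rightarrow>\<^sub>C 'k) \<Rightarrow>\<^sub>L ('l \<Rightarrow>\<^sub>C 'k)) \<Rightarrow> real)"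
  have "\<exists>c>0. \<forall>T\<in>bounded_ops cscale. c * \<omega> T \<le> n T"
  proof (rule ccontr)
    assume neg: "\<not> ?thesis"
    have "\<exists>T. scalar_linear T \<and> n T < inverse (fact m) * \<omega> T" for m :: nat
    proof -
      have "inverse (fact m) > (0 :: real)" by simp
      then show ?thesis using neg by (metis bounded_ops_iff not_le)
    qed
    then obtain T where T: "\<And>m. scalar_linear (T m)"
      "\<And>m :: nat. n (T m) < inverse (fact m) * \<omega> (T m)" by metis
    have \<omega>: "\<omega> (T m) > 0" for m
    proof -
      have "0 < inverse (fact m) * \<omega> (T m)" using T(2)[of m] n(1)[OF T(1), of m] by linarith
      then show ?thesis by (simp add: zero_less_mult_iff)
    qed
    have "\<exists>U V. scalar_linear U \<and> scalar_linear V \<and> norm U \<le> 16 \<and> norm V \<le> 2 \<and>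
        (\<forall>a :: nat \<Rightarrow>\<^sub>C 'k. blinfun_apply U (blinfun_apply (T m) (blinfun_apply V a)) = \<omega> (T m) *\<^sub>R
          a)" for m
      using factors_identity[of "T m"] T(1)[of m] \<omega>[of m]
        unfolding \<omega>_def bounded_ops_iff scalar_linear_def by blast
    then obtain U V where UV: "\<And>m. scalar_linear (U m)" "\<And>m. scalar_linear (V m)"
      "\<And>m. norm (U m) \<le> 16" "\<And>m. norm (V m) \<le> 2"
        "\<And>m (a :: nat \<Rightarrow>\<^sub>C 'k). blinfun_apply (U m) (blinfun_apply (T m) (blinfun_apply (V m) a)) =
          \<omega> (T m) *\<^sub>R a"
      by metis
    obtain U' where U': "scalar_linear U'"
      "\<And>m f. seq_row m (blinfun_apply U' f) = blinfun_apply (U m) f"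
      using amalgamate_targets[of U, OF UV(1,3)] by blast
    obtain V' where V': "scalar_linear V'"
      "\<And>m b. blinfun_apply V' (embed_row m b) = (1/2) ^ m *\<^sub>R blinfun_apply (V m) b"
      using amalgamate_sources[of V, OF UV(2,4)] by blast
    have "\<exists>B. disjoint_family B \<and> (\<forall>k :: nat. open (B k) \<and> B k \<noteq> ({} :: 'l set))"
    proof -
      obtain B y where B: "disjoint_family B" "\<And>k :: nat. open (B k)"
          "\<And>k. \<omega> (T 0) / 8 \<le> variation (\<lambda>f. apply_bcontfun (T 0 f) (y k)) (indicat_real (B k))"
        using disjoint_masses[of "T 0"] T(1)[of 0] \<omega>[of 0] unfolding \<omega>_def bounded_ops_iff by blast
      have "B k \<noteq> {}" for k
      proof
        assume "B k = {}"
        interpret scalar_functional "\<lambda>f. apply_bcontfun (T 0 f) (y k)" "norm (T 0)"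
          using T(1) by (intro scalar_functional_eval) (simp add: bounded_ops_iff)
        have "variation (\<lambda>f. apply_bcontfun (T 0 f) (y k)) (indicat_real (B k)) \<le> norm (T 0) * 0"
          by (rule variation_le) (simp_all add: \<open>B k = {}\<close>)
        then show False using B(3)[of k] \<omega>[of 0] by simp
      qed
      then show ?thesis using B by blast
    qed
    then obtain B :: "nat \<Rightarrow> 'l set" where "disjoint_family B" "\<And>k. open (B k)" "\<And>k. B k \<noteq> {}"
      by blast
    from complemented_sequence_space[OF this]
    obtain J :: "(nat \<Rightarrow>\<^sub>C 'k) \<Rightarrow>\<^sub>L ('l \<Rightarrow>\<^sub>C 'k)" and Q where J: "scalar_linear J" and Q:
      "scalar_linear Q"
        and "\<forall>a. blinfun_apply Q (blinfun_apply J a) = a" and JQ: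
          "J o\<^sub>L Q \<notin> weakly_compact_ops cscale"
      by (elim exE conjE) (rule that)
    then have QJ: "blinfun_apply Q (blinfun_apply J a) = a" for a by simp
    define conj where "conj X = (J o\<^sub>L X) o\<^sub>L Q" for X
    have conj: "scalar_linear X \<Longrightarrow> scalar_linear (conj X)" for X
      unfolding conj_def using J Q by (intro scalar_linear_compose)
    have conj_app: "conj X f = J (X (Q f))" for X f by (simp add: conj_def)
    have power: "scalar_linear (((o\<^sub>L) A ^^ i) S) \<and> n (((o\<^sub>L) A ^^ i) S) \<le> n A ^ i * n S"
      if A: "scalar_linear A" and S: "scalar_linear S" for A S i
    proof (induction i)
      case (Suc i)
      have "n (A o\<^sub>L ((o\<^sub>L) A ^^ i) S) \<le> n A * n (((o\<^sub>L) A ^^ i) S)" using n(2)[OF A] Suc by blast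
      also have "\<dots> \<le> n A * (n A ^ i * n S)" using Suc n(1)[OF A] by (intro mult_left_mono) auto
      finally show ?case using Suc A by (simp add: scalar_linear_compose mult.assoc)
    qed (simp add: S)
    define L\<^sub>m where "L\<^sub>m m = ((o\<^sub>L) (conj rows_down) ^^ m) (J o\<^sub>L U')" for m
    define R\<^sub>m where "R\<^sub>m m = ((o\<^sub>L) (conj rows_up) ^^ m) (conj (embed_row 0))" for m
    have Lm_app: "L\<^sub>m m f = J ((blinfun_apply rows_down ^^ m) (U' f))" for m f
      unfolding L\<^sub>m_def by (induction m) (simp_all add: conj_app QJ)
    have Rm_app: "R\<^sub>m m f = J ((blinfun_apply rows_up ^^ m) (embed_row 0 (Q f)))" for m f
      unfolding R\<^sub>m_def by (induction m) (simp_all add: conj_app QJ)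
    have Lm: "scalar_linear (L\<^sub>m m)" "n (L\<^sub>m m) \<le> n (conj rows_down) ^ m * n (J o\<^sub>L U')" for m
      unfolding L\<^sub>m_def using power[OF conj[OF scalar_linear_rows(3)]
        scalar_linear_compose[OF J U'(1)]] by blast+
    have Rm: "scalar_linear (R\<^sub>m m)" "n (R\<^sub>m m) \<le> n (conj rows_up) ^ m * n (conj (embed_row 0))"
      for m
      unfolding R\<^sub>m_def using power[OF conj[OF scalar_linear_rows(4)]
        conj[OF scalar_linear_rows(2)]] by blast+
    have lin: "scalar_linear (conj (seq_row 0))" "scalar_linear (V' o\<^sub>L Q)"
      "scalar_linear (J o\<^sub>L Q)"
      using conj scalar_linear_rows V'(1) Q J by (auto intro: scalar_linear_compose)
    have factorization: "\<omega> (T m) *\<^sub>R (J o\<^sub>L Q) =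
      conj (seq_row 0) o\<^sub>L (L\<^sub>m m o\<^sub>L (T m o\<^sub>L ((V' o\<^sub>L Q) o\<^sub>L R\<^sub>m m)))" for m
    proof (rule blinfun_eqI)
      fix f
      have "blinfun_apply (conj (seq_row 0) o\<^sub>L (L\<^sub>m m o\<^sub>L (T m o\<^sub>L ((V' o\<^sub>L Q) o\<^sub>L R\<^sub>m m)))) f =
          J (seq_row 0 ((blinfun_apply rows_down ^^ m) (U' (T m (V' (embed_row m (Q f)))))))"
        by (simp add: conj_app Lm_app Rm_app QJ rows_up_embed_row)
      also have "\<dots> = J ((2 ^ m * (1/2) ^ m) *\<^sub>R U m (T m (V m (Q f))))"
        by (simp add: row_rows_down U'(2) V'(2) blinfun.scaleR_right)
      also have "\<dots> = J (\<omega> (T m) *\<^sub>R Q f)"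
        by (simp add: UV(5) power_mult_distrib[symmetric])
      finally show "blinfun_apply (\<omega> (T m) *\<^sub>R (J o\<^sub>L Q)) f =
          blinfun_apply (conj (seq_row 0) o\<^sub>L (L\<^sub>m m o\<^sub>L (T m o\<^sub>L ((V' o\<^sub>L Q) o\<^sub>L R\<^sub>m m)))) f"
        by (simp add: blinfun.scaleR_left blinfun.scaleR_right)
    qed
    define K where "K = n (conj rows_down) * n (conj rows_up)"
    define C where "C = n (conj (seq_row 0)) * n (J o\<^sub>L U') * n (V' o\<^sub>L Q) * n (conj (embed_row 0))"
    have nn: "0 \<le> n A" if "scalar_linear A" for A using n(1) that .
    have compose_le: "n (A o\<^sub>L B) \<le> a * b" if "scalar_linear A" "scalar_linear B" "n A \<le> a"
      "n B \<le> b" for A B a b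
      using n(2)[OF that(1,2)] mult_mono[OF that(3,4) order_trans[OF nn that(3)] nn] that
        by linarith
    have "n (J o\<^sub>L Q) \<le> C * (inverse (fact m) * K ^ m)" for m
    proof -
      have "\<omega> (T m) * n (J o\<^sub>L Q) = n (\<omega> (T m) *\<^sub>R (J o\<^sub>L Q))"
        using n(3)[OF lin(3), of "\<omega> (T m)"] \<omega>[of m] by simp
      also have "\<dots> \<le> n (conj (seq_row 0)) *
        ((n (conj rows_down) ^ m * n (J o\<^sub>L U')) * ((inverse (fact m) * \<omega> (T m)) *
          (n (V' o\<^sub>L Q) * (n (conj rows_up) ^ m * n (conj (embed_row 0))))))"
        unfolding factorization
        by (intro compose_le scalar_linear_compose lin Lm Rm T less_imp_le[OF T(2)] order_refl Q
          V'(1))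
      also have "\<dots> = \<omega> (T m) * (C * (inverse (fact m) * K ^ m))"
        by (simp add: C_def K_def power_mult_distrib mult_ac)
      finally show ?thesis using \<omega>[of m] by simp
    qed
    moreover have "(\<lambda>m. C * (inverse (fact m) * K ^ m)) \<longlonglongrightarrow> C * 0"
      by (intro tendsto_mult_left summable_LIMSEQ_zero summable_exp)
    ultimately have "n (J o\<^sub>L Q) \<le> C * 0" by (intro LIMSEQ_le_const[of _ "C * 0"]) auto
    then have "n (J o\<^sub>L Q) = 0" using nn[OF lin(3)] by simp
    then show False using n(4)[OF lin(3)] JQ by simp
  qed
  then show "\<exists>c>0. \<forall>T\<in>bounded_ops cscale. c * weak_essential_norm cscale T \<le>
    N (weak_coset cscale T)"
    by (simp add: \<omega>_def n_def)
qed

end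

theorem corollary1p8:
  assumes compact_L: "compact (UNIV :: 'l::t2_space set)"
    and extremally_disconnected_L: "\<And>U :: 'l set. open U \<Longrightarrow> open (closure U)"
  shows "weak_essential_norm_minimal (cscale :: real \<Rightarrow> ('l \<Rightarrow>\<^sub>C real) \<Rightarrow> 'l \<Rightarrow>\<^sub>C real) \<and>
    weak_essential_norm_minimal (cscale :: complex \<Rightarrow> ('l \<Rightarrow>\<^sub>C complex) \<Rightarrow> 'l \<Rightarrow>\<^sub>C complex)"
proof -
  interpret extremally_disconnected_compact "TYPE('l)" by unfold_locales (use assms in auto)
  interpret R: extremally_disconnected_scalars "TYPE('l)" "TYPE(real)"
    by unfold_locales (rule dominated_split_real)
  interpret C: extremally_disconnected_scalars "TYPE('l)" "TYPE(complex)"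
    by unfold_locales (rule dominated_split_complex)
  show ?thesis using R.weak_essential_norm_minimal_scalars C.weak_essential_norm_minimal_scalars
    by blast
qed

end
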